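(* Let $I=(-1,1)$ and let $f$ be analytic on $[-1,1]$ with positive constants $C_f,K_f$ such that $\|f^{(n)}\|_{L^\infty(I)}\le C_fK_f^nn!$ for all $n\in\mathbb N_0$. Let the reaction coefficient be $b(x)=1$ for all $x\in I$. For $\varepsilon\in(0,1]$ let $u_\varepsilon\in H^1_0(I)$ be the solution of $$\int_{-1}^1\{\varepsilon^2u_\varepsilon'v'+u_\varepsilon v\}\,dx=\int_{-1}^1fv\,dx\qquad\text{for all }v\in H_0^1(I).$$ Then there exist positive constants $C,\beta$, independent of $\varepsilon\in(0,1]$ and of $p\ge1$, such that for all $p\in\mathbb N$ and $\varepsilon\in(0,1]$ there exists a $\tanh$ NN $\Phi^{u_\varepsilon,p}_\varepsilon$ with $$\|u_\varepsilon-\mathrm R(\Phi^{u_\varepsilon,p}_\varepsilon)\|_{W^{1,\infty}(I)}\le Ce^{-\beta p},$$ which implies that $$\varepsilon^{1/2}\|u_\varepsilon'-\mathrm R(\Phi^{u_\varepsilon,p}_\varepsilon)'\|_{L^2(I)}+\|u_\varepsilon-\mathrm R(\Phi^{u_\varepsilon,p}_\varepsilon)\|_{L^2(I)}\le Ce^{-\beta p},\qquad\|u_\varepsilon-\mathrm R(\Phi^{u_\varepsilon,p}_\varepsilon)\|_{L^\infty(I)}\le Ce^{-\beta p}.$$ For a constant $\tilde C>0$ independent of $f,p,\varepsilon,C$ and $\beta$, the network depth and size satisfy $$L(\Phi^{u_\varepsilon,p}_\varepsilon)=\lceil\log_2(p)\rceil+1,\qquad M(\Phi^{u_\varepsilon,p}_\varepsilon)\le\tilde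 Cp.$$ The weights and biases in the hidden layers are independent of $u_\varepsilon$ and depend only on $p,\varepsilon$ and $\beta$.
   Context: Neural networks (NNs): for $d,L\in\mathbb N$, a NN with input dimension $d$ and $L$ layers is a finite sequence $\Phi=((A_1,b_1),\dots,(A_L,b_L))$ with $N_0=d$, $N_1,\dots,N_L\in\mathbb N$, $A_\ell\in\mathbb R^{N_\ell\times N_{\ell-1}}$, $b_\ell\in\mathbb R^{N_\ell}$. For an activation $\varrho:\mathbb R\to\mathbb R$ (applied componentwise) its realization is $\mathrm R(\Phi):\mathbb R^d\to\mathbb R^{N_L}$, $x\mapsto x_L$, where $x_0=x$, $x_\ell=\varrho(A_\ell x_{\ell-1}+b_\ell)$ for $\ell=1,\dots,L-1$, and $x_L=A_Lx_{L-1}+b_L$. Layers $1,\dots,L-1$ are the hidden layers, layer $L$ is the output layer. The depth is $L(\Phi)=L$ and the size is $M(\Phi)=\sum_{\ell=1}^L(\|A_\ell\|_0+\|b_\ell\|_0)$, where $\|\cdot\|_0$ counts nonzero entries. A $\tanh$ NN uses only the activation $\tanh$; NNs of depth 1 (affine maps) are included. The norm is $\|F\|_{W^{1,\infty}(I)}=\max\{\|F\|_{L^\infty(I)},\|F'\|_{L^\infty(I)}\}$.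
   Formalization: The W^{1,∞} estimate is claimed only for p ≥ 2: at p = 1 the network has depth 1, hence is affine, and for f = 1 no C independent of ε exists; the energy-norm and L^∞ estimates, depth, size and hidden-layer claims are kept for all p ≥ 1. *)

theory Defs
  imports
    "HOL-Probability.Essential_Supremum"
    "Jordan_Normal_Form.Matrix"
begin

section \<open>Feedforward networks\<close>

type_synonym layer = "real Matrix.mat \<times> real Matrix.vec"
type_synonym network = "layer list"

text \<open>The list index \<open>l\<close> (from 0) holds layer \<open>l + 1\<close> of the informal numbering, so \<open>N l\<close> is the
  width on which that layer acts. All widths are positive.\<close>

definition is_network :: "nat \<Rightarrow> nat \<Rightarrow> network \<Rightarrow> bool" where
  "is_network d m \<Phi> \<longleftrightarrow> \<Phi> \<noteq> [] \<and>
     (\<exists>N. N 0 = d \<and> N (length \<Phi>) = m \<and> (\<forall>l\<le>length \<Phi>. 1 \<le> N l) \<and>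
        (\<forall>l<length \<Phi>. fst (\<Phi> ! l) \<in> carrier_mat (N (Suc l)) (N l) \<and>
                       snd (\<Phi> ! l) \<in> carrier_vec (N (Suc l))))"

text \<open>No activation is applied in the last layer; the value on the empty list is irrelevant.\<close>

fun realization :: "(real \<Rightarrow> real) \<Rightarrow> network \<Rightarrow> real Matrix.vec \<Rightarrow> real Matrix.vec" where
  "realization \<rho> [] x = x"
| "realization \<rho> [(A, b)] x = A *\<^sub>v x + b"
| "realization \<rho> ((A, b) # L # \<Phi>) x = realization \<rho> (L # \<Phi>) (map_vec \<rho> (A *\<^sub>v x + b))"

text \<open>The realization of a tanh network with one input and one output, read as a function of a
  real variable.\<close>

definition tanh_realization :: "network \<Rightarrow> real \<Rightarrow> real" where
  "tanh_realization \<Phi> x = vec_index (realization tanh \<Phi> (vec_of_list [x])) 0"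

definition nnz_mat :: "real Matrix.mat \<Rightarrow> nat" where
  "nnz_mat A = card {(i, j). i < dim_row A \<and> j < dim_col A \<and> index_mat A (i, j) \<noteq> 0}"

definition nnz_vec :: "real Matrix.vec \<Rightarrow> nat" where
  "nnz_vec b = card {i. i < dim_vec b \<and> vec_index b i \<noteq> 0}"

definition network_depth :: "network \<Rightarrow> nat" where
  "network_depth \<Phi> = length \<Phi>"

definition network_size :: "network \<Rightarrow> nat" where
  "network_size \<Phi> = (\<Sum>(A, b)\<leftarrow>\<Phi>. nnz_mat A + nnz_vec b)"

definition hidden_layers :: "network \<Rightarrow> layer list" where
  "hidden_layers \<Phi> = butlast \<Phi>"


section \<open>Lebesgue and Sobolev norms on an open set of reals\<close>

text \<open>Norms take values in \<^typ>\<open>ereal\<close> and are \<open>\<infinity>\<close> for functions outside the respective space.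
  In particular \<^const>\<open>esssup\<close> is \<open>\<infinity>\<close> for non-measurable functions.\<close>

definition square_integrable_on :: "(real \<Rightarrow> real) \<Rightarrow> real set \<Rightarrow> bool" where
  "square_integrable_on g I \<longleftrightarrow>
     g \<in> borel_measurable (lebesgue_on I) \<and> integrable (lebesgue_on I) (\<lambda>x. (g x)\<^sup>2)"

definition L2_norm :: "real set \<Rightarrow> (real \<Rightarrow> real) \<Rightarrow> ereal" where
  "L2_norm I g = (if square_integrable_on g I
                  then ereal (sqrt (LINT x|lebesgue_on I. (g x)\<^sup>2)) else \<infinity>)"

definition Linf_norm :: "real set \<Rightarrow> (real \<Rightarrow> real) \<Rightarrow> ereal" where
  "Linf_norm I g = esssup (lebesgue_on I) (\<lambda>x. ereal \<bar>g x\<bar>)"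

definition test_function_on :: "(real \<Rightarrow> real) \<Rightarrow> real set \<Rightarrow> bool" where
  "test_function_on \<phi> I \<longleftrightarrow>
     (\<forall>n x. ((deriv ^^ n) \<phi>) differentiable (at x)) \<and>
     compact (closure {x. \<phi> x \<noteq> 0}) \<and> closure {x. \<phi> x \<noteq> 0} \<subseteq> I"

definition locally_integrable_on :: "(real \<Rightarrow> real) \<Rightarrow> real set \<Rightarrow> bool" where
  "locally_integrable_on g I \<longleftrightarrow>
     (\<forall>K. compact K \<and> K \<subseteq> I \<longrightarrow> integrable (lebesgue_on K) g)"

definition has_weak_deriv_on :: "(real \<Rightarrow> real) \<Rightarrow> (real \<Rightarrow> real) \<Rightarrow> real set \<Rightarrow> bool" where
  "has_weak_deriv_on u g I \<longleftrightarrow>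
     locally_integrable_on u I \<and> locally_integrable_on g I \<and>
     (\<forall>\<phi>. test_function_on \<phi> I \<longrightarrow>
        (LINT x|lebesgue_on I. u x * deriv \<phi> x) = - (LINT x|lebesgue_on I. g x * \<phi> x))"

text \<open>A representative of the weak derivative, which is unique up to null sets; meaningful only
  if a weak derivative exists.\<close>

definition weak_deriv :: "real set \<Rightarrow> (real \<Rightarrow> real) \<Rightarrow> real \<Rightarrow> real" where
  "weak_deriv I u = (SOME g. has_weak_deriv_on u g I)"

definition W1inf_norm :: "real set \<Rightarrow> (real \<Rightarrow> real) \<Rightarrow> ereal" where
  "W1inf_norm I u = (if \<exists>g. has_weak_deriv_on u g I
                     then max (Linf_norm I u) (Linf_norm I (weak_deriv I u)) else \<infinity>)"

definition H1_on :: "real set \<Rightarrow> (real \<Rightarrow> real) set" where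
  "H1_on I = {u. square_integrable_on u I \<and> (\<exists>g. has_weak_deriv_on u g I) \<and>
                 square_integrable_on (weak_deriv I u) I}"

text \<open>\<open>H\<^sub>0\<^sup>1(I)\<close>: the closure of the test functions with respect to the \<open>H\<^sup>1\<close> norm.\<close>

definition H10_on :: "real set \<Rightarrow> (real \<Rightarrow> real) set" where
  "H10_on I = {u \<in> H1_on I. \<exists>\<phi> :: nat \<Rightarrow> real \<Rightarrow> real.
      (\<forall>n. test_function_on (\<phi> n) I) \<and>
      (\<lambda>n. L2_norm I (\<lambda>x. u x - \<phi> n x)) \<longlonglongrightarrow> 0 \<and>
      (\<lambda>n. L2_norm I (\<lambda>x. weak_deriv I u x - deriv (\<phi> n) x)) \<longlonglongrightarrow> 0}"


section \<open>Analytic data and the reaction-diffusion problem\<close>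

text \<open>The expansion is only required inside \<open>S\<close>, so nothing is assumed about the values of \<open>f\<close>
  outside \<open>S\<close>. At an endpoint of a closed interval the one-sided expansion determines the
  analytic continuation of \<open>f\<close> across that endpoint.\<close>

definition real_analytic_on :: "(real \<Rightarrow> real) \<Rightarrow> real set \<Rightarrow> bool" where
  "real_analytic_on f S \<longleftrightarrow>
     (\<forall>x\<in>S. \<exists>a. \<exists>r>0. \<forall>y\<in>S. \<bar>y - x\<bar> < r \<longrightarrow> (\<lambda>n. a n * (y - x) ^ n) sums f y)"

definition reaction_diffusion_solution ::
    "real set \<Rightarrow> real \<Rightarrow> (real \<Rightarrow> real) \<Rightarrow> (real \<Rightarrow> real) \<Rightarrow> (real \<Rightarrow> real) \<Rightarrow> bool" where
  "reaction_diffusion_solution I \<epsilon> b f u \<longleftrightarrow> u \<in> H10_on I \<and>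
     (\<forall>v \<in> H10_on I.
        (LINT x|lebesgue_on I. \<epsilon>\<^sup>2 * weak_deriv I u x * weak_deriv I v x + b x * u x * v x)
        = (LINT x|lebesgue_on I. f x * v x))"

text \<open>A pitfall for uniform bounds in \<open>W\<^sup>1\<^sup>,\<^sup>\<infinity>\<close>: for \<open>f = b = 1\<close> on \<open>(-1, 1)\<close> the solution is
  \<open>1 - cosh (x / \<epsilon>) / cosh (1 / \<epsilon>)\<close>, whose derivative takes all values between
  \<open>\<plusminus> tanh (1 / \<epsilon>) / \<epsilon>\<close>. Hence every affine function, i.e. every network of depth 1, has distance
  at least \<open>tanh (1 / \<epsilon>) / \<epsilon>\<close> from it in \<open>W\<^sup>1\<^sup>,\<^sup>\<infinity>\<close>, which is unbounded as \<open>\<epsilon> \<rightarrow> 0\<close>. Depth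
  \<open>\<lceil>log 2 p\<rceil> + 1\<close> equals 1 exactly for \<open>p = 1\<close>, so a bound independent of \<open>\<epsilon>\<close> in this norm can only
  be claimed for \<open>p \<ge> 2\<close>; the \<open>\<epsilon>\<close>-weighted energy norm and the \<open>L\<^sup>\<infinity>\<close> norm do not have this
  obstruction.\<close>

end

theory Submission
  imports Defs
begin

text \<open>Approximating \<open>f''\<close> by a truncated Chebyshev series and integrating twice gives polynomials \<open>Q\<close> of
  degree \<open>p\<close> for which \<open>g = f - Q\<close> is exponentially small together with \<open>g'\<close> and \<open>g''\<close>. For the right-hand
  side \<open>Q\<close> the equation has the polynomial solution \<open>P = \<Sum>i. \<epsilon>\<^sup>2\<^sup>i Q\<^sup>(\<^sup>2\<^sup>i\<^sup>)\<close>, and for the right-hand side \<open>g\<close>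
  it has the solution \<open>g + y\<close>, where \<open>y\<close> is the Green potential of \<open>\<epsilon>\<^sup>2 g''\<close>; both \<open>g\<close> and \<open>y\<close> are small
  in \<open>W\<^sup>1\<^sup>,\<^sup>\<infinity>\<close> uniformly in \<open>\<epsilon>\<close>. So up to an exponentially small error \<open>u\<close> is \<open>P\<close> plus a combination of
  the boundary layers \<open>exp (- (1 + x) / \<epsilon>)\<close> and \<open>exp (- (1 - x) / \<epsilon>)\<close>. A rescaled tanh neuron far out in
  its tail is arbitrarily close to an exponential, and difference quotients of exponentials are
  arbitrarily close to monomials; since the size of the weights is not restricted, a single hidden
  layer of \<open>p + 3\<close> neurons that does not depend on \<open>f\<close> suffices. All other hidden layers have width 1
  and transport \<open>x\<close> through the almost linear part of tanh.\<close>

section \<open>Chebyshev expansions\<close>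

text \<open>The norm carries no weight in \<epsilon>, while the derivatives of the boundary layers
  are of order 1/\<epsilon>. So the layers get neurons of their own, and what is dropped, g + y,
  must be small in C^1 without any help from \<epsilon>; this is why the second derivative of
  \<open>f\<close> is expanded and not \<open>f\<close> itself. The coefficients of P may be huge.
  This does no harm: they depend linearly on the bounded expansion coefficients of \<open>f\<close>,
  so the hidden layers can be tuned to a precision divided by a bound that involves only p and
  \<epsilon>. A weak solution is determined only almost everywhere and has to be identified with an
  explicit classical one. That takes uniqueness of weak derivatives and density of test functions,
  both proved here, and the energy identity. For p = 1 the prescribed depth leaves no hidden layer;
  there the zero network and a bound for the energy of the layers suffice.\<close>

fun cheb :: "nat \<Rightarrow> real poly" where
  "cheb 0 = 1"
| "cheb (Suc 0) = [:0, 1:]"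
| "cheb (Suc (Suc n)) = [:0, 2:] * cheb (Suc n) - cheb n"

lemma poly_cheb_cos: "poly (cheb n) (cos t) = cos (real n * t)"
proof (induction n rule: cheb.induct)
  case (3 n)
  have "cos (real (Suc (Suc n)) * t) + cos (real n * t) = 2 * cos t * cos (real (Suc n) * t)"
    using cos_plus_cos[of "real (Suc (Suc n)) * t" "real n * t"] by (simp add: algebra_simps add_divide_distrib)
  then show ?case using 3 by simp
qed auto

lemma degree_cheb: "degree (cheb n) \<le> n"
proof (induction n rule: cheb.induct)
  case (3 n)
  have "degree ([:0, 2:] * cheb (Suc n)) \<le> Suc (Suc n)"
    using degree_mult_le[of "[:0, 2:]" "cheb (Suc n)"] 3 by simp
  with 3 show ?case by (auto intro!: degree_diff_le)
qed auto

text \<open>Unnormalized: the weights 1/pi and 2/pi are attached only in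
  \<open>cheb_series_error\<close>. The substitution x = cos t turns the Chebyshev weight into
  Lebesgue measure.\<close>

definition cheb_coeff :: "(real \<Rightarrow> real) \<Rightarrow> nat \<Rightarrow> real" where
  "cheb_coeff F k = integral {0..pi} (\<lambda>t. F (cos t) * cos (real k * t))"

section \<open>Decay of the Chebyshev coefficients by integration by parts\<close>

lemma continuous_on_comp_cos:
  assumes "continuous_on {-1..1} F"
  shows "continuous_on S (\<lambda>t::real. F (cos t) :: real)"
  by (rule continuous_on_compose2[OF assms]) (auto intro: continuous_intros)

text \<open>Integration by parts of F(cos t) sin(k t), which vanishes at 0 and pi. The product sin(k
  t) sin t splits into the cosines with frequencies k - 1 and k + 1. The interior form of the
  fundamental theorem is used because \<open>F\<close> is differentiable only in the open
  interval.\<close>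

lemma cheb_coeff_deriv:
  assumes F: "continuous_on {-1..1} F" and F': "continuous_on {-1..1} F'"
    and d: "\<And>x. x \<in> {-1<..<1} \<Longrightarrow> (F has_field_derivative F' x) (at x)"
    and k: "1 \<le> k"
  shows "2 * real k * cheb_coeff F k = cheb_coeff F' (k - 1) - cheb_coeff F' (k + 1)"
proof -
  let ?G = "\<lambda>t. F (cos t) * sin (real k * t)"
  let ?g = "\<lambda>t. real k * (F (cos t) * cos (real k * t))
      - (F' (cos t) * cos (real (k - 1) * t) - F' (cos t) * cos (real (k + 1) * t)) / 2"
  have "(?g has_integral ?G pi - ?G 0) {0..pi}"
  proof (rule fundamental_theorem_of_calculus_interior)
    show "continuous_on {0..pi} ?G"
      by (intro continuous_intros continuous_on_comp_cos F)
    fix t :: real assume t: "t \<in> {0<..<pi}"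
    have "cos t \<in> {-1<..<1}"
      using cos_monotone_0_pi[of 0 t] cos_monotone_0_pi[of t pi] t by auto
    then have "((\<lambda>t. F (cos t)) has_field_derivative F' (cos t) * - sin t) (at t)"
      by (intro DERIV_chain2[OF d]) (auto intro!: derivative_eq_intros)
    then have "(?G has_field_derivative F' (cos t) * - sin t * sin (real k * t)
        + real k * cos (real k * t) * F (cos t)) (at t)"
      by (auto intro!: derivative_eq_intros)
    moreover have "cos (real (k - 1) * t) - cos (real (k + 1) * t) = 2 * sin (real k * t) * sin t"
      using k cos_diff_cos[of "real (k - 1) * t" "real (k + 1) * t"]
      by (simp add: of_nat_diff algebra_simps add_divide_distrib)
    then have "(F' (cos t) * cos (real (k - 1) * t) - F' (cos t) * cos (real (k + 1) * t)) / 2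
        = F' (cos t) * sin (real k * t) * sin t"
      by (simp flip: right_diff_distrib)
    ultimately show "(?G has_vector_derivative ?g t) (at t)"
      by (simp add: has_real_derivative_iff_has_vector_derivative algebra_simps)
  qed simp
  then have 1: "integral {0..pi} ?g = 0"
    by (simp add: integral_unique)
  have hi: "((\<lambda>t. F (cos t) * cos (real j * t)) has_integral cheb_coeff F j) {0..pi}"
    if "continuous_on {-1..1} F" for j and F :: "real \<Rightarrow> real"
    unfolding cheb_coeff_def
    by (intro integrable_integral integrable_continuous_interval continuous_intros continuous_on_comp_cos that)
  have "(?g has_integral real k * cheb_coeff F k - (cheb_coeff F' (k - 1) - cheb_coeff F' (k + 1)) / 2) {0..pi}"
    by (intro has_integral_diff has_integral_mult_right has_integral_divide hi F F')
  from integral_unique[OF this] 1 show ?thesis by simp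
qed

lemma abs_cheb_coeff_le:
  assumes "continuous_on {-1..1} F" and "\<And>x. x \<in> {-1..1} \<Longrightarrow> \<bar>F x\<bar> \<le> M"
  shows "\<bar>cheb_coeff F k\<bar> \<le> pi * M"
proof -
  have "norm (integral {0..pi} (\<lambda>t. F (cos t) * cos (real k * t))) \<le> M * (pi - 0)"
  proof (rule integral_bound)
    show "continuous_on {0..pi} (\<lambda>t. F (cos t) * cos (real k * t))"
      by (intro continuous_intros continuous_on_comp_cos assms)
    fix t :: real
    have "\<bar>F (cos t)\<bar> * \<bar>cos (real k * t)\<bar> \<le> M * 1"
      by (intro mult_mono assms) (use assms(2)[of "cos t"] in auto)
    then show "norm (F (cos t) * cos (real k * t)) \<le> M" by (simp add: abs_mult)
  qed simp
  then show ?thesis by (simp add: cheb_coeff_def mult.commute)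
qed

text \<open>Each use of \<open>cheb_coeff_deriv\<close> gains a factor 1/(2k) and produces two
  coefficients with indices k - 1 and k + 1. The index k - 1 gives the worse bound, so m steps gain
  the divisor k (k - 1) ... (k - m + 1).\<close>

lemma abs_cheb_coeff_le_derivs:
  fixes F :: "nat \<Rightarrow> real \<Rightarrow> real"
  assumes F: "\<And>n. continuous_on {-1..1} (F n)"
    and d: "\<And>n x. x \<in> {-1<..<1} \<Longrightarrow> (F n has_field_derivative F (Suc n) x) (at x)"
    and M: "\<And>n x. x \<in> {-1..1} \<Longrightarrow> \<bar>F n x\<bar> \<le> M n"
    and "m \<le> k"
  shows "\<bar>cheb_coeff (F n) k\<bar> \<le> pi * M (n + m) * (fact (k - m) / fact k)"
  using \<open>m \<le> k\<close>
proof (induction m arbitrary: n k)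
  case 0
  then show ?case using abs_cheb_coeff_le[OF F M] by simp
next
  case (Suc m)
  obtain j where k: "k = Suc j" using Suc.prems by (cases k) auto
  define A where "A = pi * M (n + Suc m)"
  have A0: "A \<ge> 0" using M[of 0 "n + Suc m"] by (auto simp: A_def intro!: mult_nonneg_nonneg)
  have 1: "\<bar>cheb_coeff (F (Suc n)) j\<bar> \<le> A * (fact (j - m) / fact j)"
    using Suc.IH[of j "Suc n"] Suc.prems by (simp add: k A_def)
  have 2: "\<bar>cheb_coeff (F (Suc n)) (k + 1)\<bar> \<le> A * (fact (k + 1 - m) / fact (k + 1))"
    using Suc.IH[of "k + 1" "Suc n"] Suc.prems by (simp add: A_def)
  define q where "q = fact (j - m) / (fact j :: real)"
  \<comment> \<open>With k = j + 1, passing from index j to k + 1 = j + 2 multiplies the quotient of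
    factorials by two factors that are at most 1.\<close>
  have "fact (k + 1 - m) = (real (j + 2 - m)) * (real (j + 1 - m) * fact (j - m))"
    using Suc.prems k by (simp add: Suc_diff_le algebra_simps)
  moreover have "fact (k + 1) = real (j + 2) * (real (j + 1) * fact j)"
    by (simp add: k algebra_simps)
  ultimately have "fact (k + 1 - m) / fact (k + 1)
      = (real (j + 2 - m) * (real (j + 1 - m) * fact (j - m))) / (real (j + 2) * (real (j + 1) * fact j))"
    by (simp only:)
  also have "\<dots> = (real (j + 2 - m) / real (j + 2)) * (real (j + 1 - m) / real (j + 1)) * q"
    by (simp only: q_def times_divide_times_eq mult.assoc)
  also have "\<dots> \<le> 1 * 1 * q"
    by (intro mult_mono) (auto simp: q_def)
  finally have 3: "A * (fact (k + 1 - m) / fact (k + 1)) \<le> A * q"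
    using A0 by (intro mult_left_mono) auto
  have e: "2 * real k * cheb_coeff (F n) k = cheb_coeff (F (Suc n)) j - cheb_coeff (F (Suc n)) (k + 1)"
    using cheb_coeff_deriv[OF F[of n] F[of "Suc n"] d[of _ n], of k] k by simp
  have "\<bar>x - y\<bar> \<le> 2 * c" if "\<bar>x\<bar> \<le> c" "\<bar>y\<bar> \<le> c" for x y c :: real
    using that by linarith
  from this[OF 1[folded q_def] order_trans[OF 2 3]]
  have "\<bar>2 * real k * cheb_coeff (F n) k\<bar> \<le> 2 * (A * q)" unfolding e .
  moreover have "\<bar>2 * real k * cheb_coeff (F n) k\<bar> = 2 * (real k * \<bar>cheb_coeff (F n) k\<bar>)"
    by (simp add: abs_mult)
  ultimately have "real k * \<bar>cheb_coeff (F n) k\<bar> \<le> A * q" by linarith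
  then have "\<bar>cheb_coeff (F n) k\<bar> \<le> A * q / real k"
    using k by (simp add: field_simps)
  also have "A * q / real k = A * (fact (k - Suc m) / fact k)"
    unfolding q_def k diff_Suc_Suc fact_Suc times_divide_eq_right divide_divide_eq_left
    by (simp only: mult.commute)
  finally show ?case by (simp add: A_def)
qed

text \<open>cos t cos(j t) is the mean of cos((j+1) t) and cos((j-1) t), so a further power of cos t
  only shifts the frequency.\<close>

lemma integral_cos_power_zero:
  assumes h: "continuous_on {0..pi} h"
    and z: "\<And>j. integral {0..pi} (\<lambda>t. h t * cos (real j * t)) = 0"
  shows "((\<lambda>t. h t * cos t ^ n * cos (real j * t)) has_integral 0) {0..pi}"
proof (induction n arbitrary: j)
  case 0
  have "(\<lambda>t. h t * cos (real j * t)) integrable_on {0..pi}"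
    by (intro integrable_continuous_interval continuous_intros h)
  then show ?case using z[of j] by (simp add: has_integral_integral)
next
  case (Suc n)
  show ?case
  proof (cases "j = 0")
    case True
    \<comment> \<open>For j = 0 there is no natural index j - 1; here the extra cos t is itself the
      factor of frequency 1.\<close>
    then show ?thesis using Suc[of 1] by (simp add: mult_ac)
  next
    case False
    have "((\<lambda>t. (h t * cos t ^ n * cos (real (j + 1) * t) + h t * cos t ^ n * cos (real (j - 1) * t)) / 2)
        has_integral (0 + 0) / 2) {0..pi}"
      by (intro has_integral_divide has_integral_add Suc)
    moreover have "(h t * cos t ^ n * cos (real (j + 1) * t) + h t * cos t ^ n * cos (real (j - 1) * t)) / 2
        = h t * cos t ^ Suc n * cos (real j * t)" for t
    proof -
      have "cos (real (j + 1) * t) + cos (real (j - 1) * t) = 2 * cos t * cos (real j * t)"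
        using cos_plus_cos[of "real (j + 1) * t" "real (j - 1) * t"] False
        by (simp add: of_nat_diff algebra_simps add_divide_distrib)
      then show ?thesis by (simp flip: distrib_left)
    qed
    ultimately show ?thesis by simp
  qed
qed

text \<open>By Weierstrass, h o arccos is uniformly close to a polynomial g, and h is orthogonal to
  g(cos t). So the integral of h^2 equals that of h (h - g o cos), which is arbitrarily
  small.\<close>

lemma cos_system_complete:
  assumes h: "continuous_on {0..pi} h"
    and z: "\<And>j. integral {0..pi} (\<lambda>t. h t * cos (real j * t)) = 0"
    and t: "t \<in> {0..pi}"
  shows "h t = 0"
proof -
  obtain M where M: "\<And>t. t \<in> {0..pi} \<Longrightarrow> \<bar>h t\<bar> \<le> M"
    using compact_imp_bounded[OF compact_continuous_image[OF h compact_Icc]]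
    by (force simp: bounded_iff)
  have M0: "M \<ge> 0" using M[of 0] by auto
  let ?J = "integral {0..pi} (\<lambda>t. h t * h t)"
  have hh: "(\<lambda>t. h t * h t) integrable_on {0..pi}"
    by (intro integrable_continuous_interval continuous_intros h)
  have le: "?J \<le> e * (pi * M)" if e: "e > 0" for e
  proof -
    have "continuous_on {-1..1} (\<lambda>x. h (arccos x))"
      by (rule continuous_on_compose2[OF h continuous_on_arccos'])
        (auto simp: arccos_lbound arccos_ubound)
    then obtain g where g: "real_polynomial_function g"
        "\<And>x. x \<in> {-1..1} \<Longrightarrow> \<bar>h (arccos x) - g x\<bar> < e"
      using Stone_Weierstrass_real_polynomial_function[OF compact_Icc _ e] by metis
    then obtain a n where an: "g = (\<lambda>x. \<Sum>i\<le>n. a i * x ^ i)"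
      by (auto simp: real_polynomial_function_iff_sum)
    have "((\<lambda>t. \<Sum>i\<le>n. a i * (h t * cos t ^ i * cos (real 0 * t))) has_integral (\<Sum>i\<le>n. a i * 0)) {0..pi}"
      by (intro has_integral_sum has_integral_mult_right integral_cos_power_zero h z) auto
    then have "((\<lambda>t. h t * g (cos t)) has_integral 0) {0..pi}"
      by (simp add: an sum_distrib_left mult_ac)
    from has_integral_diff[OF integrable_integral[OF hh] this]
    have hg: "((\<lambda>t. h t * (h t - g (cos t))) has_integral ?J) {0..pi}"
      by (simp add: algebra_simps)
    have "?J \<le> integral {0..pi} (\<lambda>t. e * M)"
    proof (rule has_integral_le[OF hg])
      show "((\<lambda>t. e * M) has_integral integral {0..pi} (\<lambda>t. e * M)) {0..pi}"
        by (intro integrable_integral) auto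
      fix t assume t: "t \<in> {0..pi}"
      have "\<bar>h t - g (cos t)\<bar> \<le> e"
        using g(2)[of "cos t"] t arccos_cos[of t] by auto
      then have "\<bar>h t * (h t - g (cos t))\<bar> \<le> M * e"
        unfolding abs_mult using M[OF t] M0 by (intro mult_mono) auto
      then show "h t * (h t - g (cos t)) \<le> e * M" by (simp add: mult.commute)
    qed
    then show ?thesis by (simp add: mult_ac)
  qed
  have "?J \<le> 0"
  proof (rule field_le_epsilon)
    fix e :: real assume "e > 0"
    then have "?J \<le> e / (pi * M + 1) * (pi * M)"
      using M0 by (intro le) (auto intro!: divide_pos_pos add_nonneg_pos)
    also have "\<dots> \<le> e"
      using M0 \<open>e > 0\<close> add_nonneg_pos[of "pi * M" 1] by (simp add: pos_divide_le_eq algebra_simps)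
    finally show "?J \<le> 0 + e" by simp
  qed
  moreover have "?J \<ge> 0" by (intro integral_nonneg hh) auto
  ultimately have "?J = 0" by simp
  moreover have "continuous_on {0..pi} (\<lambda>t. h t * h t)"
    by (intro continuous_intros h)
  ultimately have "h t * h t = 0"
    using integral_eq_0_iff[OF _ pi_gt_zero zero_le_square, of h] t by metis
  then show ?thesis by simp
qed

text \<open>In the product formula the frequency k - j vanishes on the diagonal, while k + j
  vanishes only for k = j = 0; the second constant term there is what the smaller weight 1/pi
  compensates.\<close>

lemma cos_orthogonal:
  "((\<lambda>t. (if k = 0 then 1 / pi else 2 / pi) * cos (real k * t) * cos (real j * t))
      has_integral (if k = j then 1 else 0)) {0..pi}"
proof -
  have 1: "((\<lambda>t. cos (c * t)) has_integral (if c = 0 then pi else 0)) {0..pi}" if "c \<in> \<int>" for c :: real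
  proof (cases "c = 0")
    case True
    then show ?thesis using has_integral_const_real[of "1::real" 0 pi] by simp
  next
    case False
    have "((\<lambda>t. cos (c * t)) has_integral sin (c * pi) / c - sin (c * 0) / c) {0..pi}"
      using False
      by (intro fundamental_theorem_of_calculus)
        (auto simp flip: has_real_derivative_iff_has_vector_derivative intro!: derivative_eq_intros)
    moreover have "sin (c * pi) = 0"
      using that sin_integer_2pi by (auto simp: sin_zero_iff_int2 Ints_def)
    ultimately show ?thesis using False by simp
  qed
  have "((\<lambda>t. (if k = 0 then 1 / pi else 2 / pi) * ((cos ((real k - real j) * t) + cos ((real k + real j) * t)) / 2))
      has_integral (if k = 0 then 1 / pi else 2 / pi) *
        (((if real k - real j = 0 then pi else 0) + (if real k + real j = 0 then pi else 0)) / 2)) {0..pi}"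
    by (intro has_integral_mult_right has_integral_divide has_integral_add 1) auto
  moreover have "(cos ((real k - real j) * t) + cos ((real k + real j) * t)) / 2
      = cos (real k * t) * cos (real j * t)" for t
    using cos_times_cos[of "real k * t" "real j * t"] by (simp add: left_diff_distrib distrib_right)
  ultimately show ?thesis
    by (auto simp: mult.assoc split: if_splits)
qed

text \<open>The geometric bound makes the cosine series converge uniformly, so its sum has the same
  cosine coefficients as F(cos t), and both agree by completeness. What remains is the tail of a
  geometric series.\<close>

lemma cheb_series_error:
  assumes F: "continuous_on {-1..1} F"
    and B: "\<And>k. \<bar>cheb_coeff F k\<bar> \<le> B * r ^ k" and r: "0 < r" "r < 1"
    and x: "x \<in> {-1..1}"
  shows "\<bar>F x - (\<Sum>k<n. (if k = 0 then 1 / pi else 2 / pi) * cheb_coeff F k * poly (cheb k) x)\<bar>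
    \<le> B * r ^ n / (1 - r)"
proof -
  define a where "a k = (if k = 0 then 1 / pi else 2 / pi) * cheb_coeff F k" for k
  have B0: "B \<ge> 0" using B[of 0] by simp
  have ab: "\<bar>a k\<bar> \<le> B * r ^ k" for k
  proof -
    have "\<bar>a k\<bar> \<le> 1 * \<bar>cheb_coeff F k\<bar>"
      unfolding a_def abs_mult using pi_ge_two by (intro mult_right_mono) auto
    with B[of k] show ?thesis by simp
  qed
  have tb: "norm (a k * cos (real k * t)) \<le> B * r ^ k" for k t
  proof -
    have "\<bar>a k\<bar> * \<bar>cos (real k * t)\<bar> \<le> B * r ^ k * 1"
      using ab[of k] by (intro mult_mono) (auto intro: order_trans)
    then show ?thesis by (simp add: abs_mult)
  qed
  have sumr: "summable (\<lambda>k. B * r ^ k)"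
    using r by (intro summable_mult summable_geometric) auto
  define S where "S t = (\<Sum>k. a k * cos (real k * t))" for t
  have ul: "uniform_limit {0..pi} (\<lambda>n t. \<Sum>k<n. a k * cos (real k * t)) S sequentially"
    unfolding S_def by (rule Weierstrass_m_test[OF tb sumr])
  have S: "continuous_on {0..pi} S"
    by (rule uniform_limit_theorem[OF _ ul]) (auto intro!: continuous_intros always_eventually)
  have "F (cos t) - S t = 0" if t: "t \<in> {0..pi}" for t
  proof (rule cos_system_complete[OF _ _ t])
    show "continuous_on {0..pi} (\<lambda>t. F (cos t) - S t)"
      by (intro continuous_intros continuous_on_comp_cos F S)
    fix j
    have ulj: "uniform_limit {0..pi} (\<lambda>n t. (\<Sum>k<n. a k * cos (real k * t)) * cos (real j * t))
        (\<lambda>t. S t * cos (real j * t)) sequentially"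
    proof (rule uniform_lim_mult[OF ul uniform_limit_const])
      show "bounded (S ` {0..pi})"
        by (intro compact_imp_bounded compact_continuous_image S) auto
      show "bounded ((\<lambda>t. cos (real j * t)) ` {0..pi})"
        by (auto simp: bounded_iff intro!: exI[of _ 1])
    qed
    obtain I J where I: "\<And>n. ((\<lambda>t. (\<Sum>k<n. a k * cos (real k * t)) * cos (real j * t)) has_integral I n) {0..pi}"
      and J: "((\<lambda>t. S t * cos (real j * t)) has_integral J) {0..pi}" and lim: "I \<longlonglongrightarrow> J"
      by (rule uniform_limit_integral[OF ulj]) (auto intro!: continuous_intros)
    \<comment> \<open>By orthogonality the coefficient of frequency j no longer changes once the
      partial sum contains that frequency.\<close>
    have "I n = cheb_coeff F j" if "n > j" for n
    proof -
      have "((\<lambda>t. \<Sum>k<n. cheb_coeff F k * ((if k = 0 then 1 / pi else 2 / pi) * cos (real k * t) * cos (real j * t)))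
          has_integral (\<Sum>k<n. cheb_coeff F k * (if k = j then 1 else 0))) {0..pi}"
        by (intro has_integral_sum has_integral_mult_right cos_orthogonal) auto
      moreover have "(\<Sum>k<n. cheb_coeff F k * (if k = j then 1 else 0)) = cheb_coeff F j"
        using that by (simp add: if_distrib cong: if_cong)
      moreover have "(\<Sum>k<n. cheb_coeff F k * ((if k = 0 then 1 / pi else 2 / pi) * cos (real k * t) * cos (real j * t)))
        = (\<Sum>k<n. a k * cos (real k * t)) * cos (real j * t)" for t
        unfolding sum_distrib_right by (intro sum.cong) (auto simp: a_def)
      ultimately show ?thesis using has_integral_unique[OF I] by simp
    qed
    then have "I \<longlonglongrightarrow> cheb_coeff F j"
      by (intro tendsto_eventually eventually_mono[OF eventually_gt_at_top[of j]])
    with lim have Jc: "J = cheb_coeff F j" by (rule LIMSEQ_unique)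
    have "((\<lambda>t. F (cos t) * cos (real j * t)) has_integral cheb_coeff F j) {0..pi}"
      unfolding cheb_coeff_def
      by (intro integrable_integral integrable_continuous_interval continuous_intros continuous_on_comp_cos F)
    from has_integral_diff[OF this J]
    show "integral {0..pi} (\<lambda>t. (F (cos t) - S t) * cos (real j * t)) = 0"
      by (simp add: Jc left_diff_distrib integral_unique)
  qed
  from this[of "arccos x"] have Fx: "F x = S (arccos x)"
    using x by (simp add: arccos_lbound arccos_ubound)
  define t where "t = arccos x"
  have xt: "cos t = x" using x by (simp add: t_def)
  have sm: "summable (\<lambda>k. a k * cos (real k * t))"
    by (rule summable_comparison_test'[OF sumr]) (rule tb)
  have "S t = (\<Sum>k. a (k + n) * cos (real (k + n) * t)) + (\<Sum>k<n. a k * cos (real k * t))"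
    unfolding S_def by (rule suminf_split_initial_segment[OF sm])
  moreover have "norm (\<Sum>k. a (k + n) * cos (real (k + n) * t)) \<le> (\<Sum>k. B * r ^ (k + n))"
    by (rule norm_suminf_le[OF tb summable_ignore_initial_segment[OF sumr]])
  moreover have "(\<Sum>k. B * r ^ (k + n)) = B * r ^ n / (1 - r)"
    using suminf_geometric[of r] r suminf_mult[of "\<lambda>k. r ^ k" "B * r ^ n"] summable_geometric[of r]
    by (simp add: power_add mult_ac)
  moreover have "(\<Sum>k<n. a k * cos (real k * t)) = (\<Sum>k<n. a k * poly (cheb k) x)"
    by (simp add: poly_cheb_cos flip: xt)
  ultimately show ?thesis
    using Fx by (simp add: t_def flip: a_def)
qed

text \<open>\<open>m\<close>-fold integration by parts bounds the \<open>k\<close>-th coefficient by \<open>\<pi> C K\<^sup>m / (k choose m)\<close>;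
  the choice \<open>m \<approx> k / (2 K)\<close> makes this exponentially small in \<open>k\<close>.\<close>

lemma cheb_coeff_decay:
  fixes F :: "nat \<Rightarrow> real \<Rightarrow> real"
  assumes F: "\<And>n. continuous_on {-1..1} (F n)"
    and d: "\<And>n x. x \<in> {-1<..<1} \<Longrightarrow> (F n has_field_derivative F (Suc n) x) (at x)"
    and M: "\<And>n x. x \<in> {-1..1} \<Longrightarrow> \<bar>F n x\<bar> \<le> C * K ^ n * fact n"
    and K: "K \<ge> 1"
  shows "\<bar>cheb_coeff (F 0) k\<bar> \<le> 2 * pi * C * ((1 / 2) powr (1 / (2 * K))) ^ k"
proof -
  have C0: "C \<ge> 0" using M[of 0 0] by auto
  define m where "m = nat \<lfloor>real k / (2 * K)\<rfloor>"
  have m1: "real m \<le> real k / (2 * K)"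
    unfolding m_def using K by (intro of_nat_floor) auto
  have m2: "real k / (2 * K) - 1 \<le> real m"
    unfolding m_def by linarith
  have "real k / (2 * K) \<le> real k / 1" using K by (intro divide_left_mono) auto
  then have mk: "m \<le> k" using m1 by linarith
  have "\<bar>cheb_coeff (F 0) k\<bar> \<le> pi * (C * K ^ m * fact m) * (fact (k - m) / fact k)"
    using abs_cheb_coeff_le_derivs[of F "\<lambda>n. C * K ^ n * fact n" m k 0, OF F d M mk] by simp
  also have "\<dots> = pi * C * (K ^ m / real (k choose m))"
    using mk by (simp add: binomial_fact)
  also have "\<dots> \<le> pi * C * ((1 / 2) ^ m)"
  proof (intro mult_left_mono)
    show "K ^ m / real (k choose m) \<le> (1 / 2) ^ m"
    proof (cases "m = 0")
      case False
      then have k0: "k > 0" using mk by simp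
      \<comment> \<open>m <= k/(2K) reads 2K <= k/m, and (k/m)^m is a lower bound for the binomial
        coefficient.\<close>
      have "(2 * K) ^ m \<le> (real k / real m) ^ m"
        using m1 K False by (intro power_mono) (auto simp: field_simps)
      also have "\<dots> \<le> real (k choose m)"
        by (rule binomial_ge_n_over_k_pow_k[OF mk])
      finally show ?thesis using mk by (simp add: field_simps power_mult_distrib)
    qed simp
  qed (use C0 in auto)
  also have "\<dots> \<le> pi * C * (2 * ((1 / 2) powr (1 / (2 * K))) ^ k)"
  proof (intro mult_left_mono)
    have "(1 / 2 :: real) ^ m = (1 / 2) powr real m"
      by (simp add: powr_realpow)
    \<comment> \<open>Rounding down loses at most one in the exponent; this is the factor 2 of the
      bound.\<close>
    also have "\<dots> \<le> (1 / 2) powr (real k / (2 * K) - 1)"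
      using m2 by (intro powr_mono') auto
    also have "\<dots> = 2 * ((1 / 2) powr (1 / (2 * K))) ^ k"
      by (simp add: powr_diff powr_powr flip: powr_realpow)
    finally show "(1 / 2) ^ m \<le> 2 * ((1 / 2) powr (1 / (2 * K))) ^ k" .
  qed (use C0 in auto)
  finally show ?thesis by (simp add: mult_ac)
qed

section \<open>Smooth functions and test functions\<close>

definition smooth :: "(real \<Rightarrow> real) \<Rightarrow> bool" where
  "smooth f \<longleftrightarrow> (\<forall>n x. ((deriv ^^ n) f) differentiable (at x))"

text \<open>Recursion on \<open>deriv f\<close> instead of iterates of \<open>deriv\<close>:
  derivatives of sums, products and affine substitutions are built from the same operations, so the
  closure lemmas follow by induction with \<open>f\<close> generalized.\<close>

fun k_times_diff :: "nat \<Rightarrow> (real \<Rightarrow> real) \<Rightarrow> bool" where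
  "k_times_diff 0 f \<longleftrightarrow> True"
| "k_times_diff (Suc n) f \<longleftrightarrow> (\<forall>x. f differentiable (at x)) \<and> k_times_diff n (deriv f)"

lemma k_times_diff_iff: "k_times_diff n f \<longleftrightarrow> (\<forall>k<n. \<forall>x. ((deriv ^^ k) f) differentiable (at x))"
proof (induction n arbitrary: f)
  case (Suc n)
  show ?case
    by (auto simp: Suc All_less_Suc2 funpow_Suc_right simp del: funpow.simps(2))
qed simp

lemma smooth_iff: "smooth f \<longleftrightarrow> (\<forall>n. k_times_diff n f)"
  unfolding smooth_def k_times_diff_iff by blast

lemma k_times_diff_mono: "k_times_diff (Suc n) f \<Longrightarrow> k_times_diff n f"
  unfolding k_times_diff_iff by auto

lemma k_times_diff_const: "k_times_diff n (\<lambda>x. c)"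
proof (induction n arbitrary: c)
  case (Suc n)
  then show ?case by (simp add: fun_eq_iff)
qed simp

lemma k_times_diff_add:
  "k_times_diff n f \<Longrightarrow> k_times_diff n g \<Longrightarrow> k_times_diff n (\<lambda>x. f x + g x)"
proof (induction n arbitrary: f g)
  case (Suc n)
  have "deriv (\<lambda>x. f x + g x) = (\<lambda>x. deriv f x + deriv g x)"
    using Suc.prems by (intro ext DERIV_imp_deriv DERIV_add) (auto simp: DERIV_deriv_iff_real_differentiable)
  then show ?case using Suc by (auto intro!: derivative_intros)
qed simp

lemma k_times_diff_mult:
  "k_times_diff n f \<Longrightarrow> k_times_diff n g \<Longrightarrow> k_times_diff n (\<lambda>x. f x * g x)"
proof (induction n arbitrary: f g)
  case (Suc n)
  have "deriv (\<lambda>x. f x * g x) = (\<lambda>x. deriv f x * g x + deriv g x * f x)"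
    using Suc.prems by (intro ext DERIV_imp_deriv DERIV_mult) (auto simp: DERIV_deriv_iff_real_differentiable)
  moreover have "k_times_diff n (\<lambda>x. deriv f x * g x + deriv g x * f x)"
    using Suc.prems Suc.prems[THEN k_times_diff_mono] by (intro k_times_diff_add Suc.IH) simp_all
  ultimately show ?case using Suc.prems by (auto intro!: derivative_intros)
qed simp

lemma k_times_diff_affine:
  "k_times_diff n f \<Longrightarrow> k_times_diff n (\<lambda>x. f (a * x + b))"
proof (induction n arbitrary: f)
  case (Suc n)
  have d: "((\<lambda>x. f (a * x + b)) has_field_derivative deriv f (a * x + b) * a) (at x)" for x
    using Suc.prems
    by (intro DERIV_chain2[where f = f]) (auto simp: DERIV_deriv_iff_real_differentiable intro!: derivative_eq_intros)
  then have "deriv (\<lambda>x. f (a * x + b)) = (\<lambda>x. deriv f (a * x + b) * a)"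
    by (intro ext DERIV_imp_deriv)
  moreover have "k_times_diff n (\<lambda>x. deriv f (a * x + b) * a)"
    using Suc.prems by (intro k_times_diff_mult k_times_diff_const Suc.IH) auto
  ultimately show ?case using d by (auto simp: real_differentiable_def)
qed simp

lemma smooth_const: "smooth (\<lambda>x. c)"
  and smooth_add: "smooth f \<Longrightarrow> smooth g \<Longrightarrow> smooth (\<lambda>x. f x + g x)"
  and smooth_mult: "smooth f \<Longrightarrow> smooth g \<Longrightarrow> smooth (\<lambda>x. f x * g x)"
  and smooth_affine: "smooth f \<Longrightarrow> smooth (\<lambda>x. f (a * x + b))"
  by (auto simp: smooth_iff k_times_diff_const k_times_diff_add k_times_diff_mult k_times_diff_affine)

lemma smooth_antideriv:
  assumes g: "smooth g" and d: "\<And>x. (f has_field_derivative g x) (at x)"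
  shows "smooth f"
proof -
  have "deriv f = g" by (intro ext DERIV_imp_deriv d)
  then have "k_times_diff n f" for n
    using g d by (cases n) (auto simp: smooth_iff real_differentiable_def)
  then show ?thesis by (simp add: smooth_iff)
qed

lemma smooth_ident: "smooth (\<lambda>x. x)"
  by (rule smooth_antideriv[OF smooth_const[of 1]]) auto

lemma smooth_power: "smooth f \<Longrightarrow> smooth (\<lambda>x. f x ^ n)"
  by (induction n) (auto intro: smooth_const smooth_mult)

lemma smooth_sum: "(\<And>i. i \<in> A \<Longrightarrow> smooth (f i)) \<Longrightarrow> smooth (\<lambda>x. \<Sum>i\<in>A. f i x)"
  by (induction A rule: infinite_finite_induct) (auto intro: smooth_const smooth_add)

lemma smooth_imp_has_deriv: "smooth f \<Longrightarrow> (f has_field_derivative deriv f x) (at x)"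
  unfolding smooth_def DERIV_deriv_iff_real_differentiable by (metis funpow_0)

lemma smooth_deriv: "smooth f \<Longrightarrow> smooth (deriv f)"
  unfolding smooth_iff by (metis k_times_diff.simps(2))

lemma smooth_continuous: "smooth f \<Longrightarrow> continuous_on S f"
  by (meson DERIV_isCont continuous_at_imp_continuous_on smooth_imp_has_deriv)

text \<open>The family is closed under differentiation, which is why all its members are smooth.\<close>

definition exp_bump :: "real poly \<Rightarrow> real \<Rightarrow> real" where
  "exp_bump p t = (if t > 0 then poly p (1 / t) * exp (- (1 / t)) else 0)"

section \<open>The flat function exp(-1/t) and bumps of compact support\<close>

lemma poly_times_exp_minus_tendsto_0: "((\<lambda>y::real. poly p y * exp (- y)) \<longlongrightarrow> 0) at_top"
proof -
  have "((\<lambda>y::real. \<Sum>i\<le>degree p. coeff p i * (y ^ i / exp y)) \<longlongrightarrow> (\<Sum>i\<le>degree p. coeff p i * 0)) at_top"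
    by (intro tendsto_intros tendsto_power_div_exp_0)
  then show ?thesis
    by (simp add: poly_altdef exp_minus divide_inverse sum_distrib_right mult.assoc)
qed

text \<open>With y = 1/t the derivative of p(y) exp(-y) with respect to t is y^2 (p(y) - p'(y))
  exp(-y). At 0 the difference quotient from the right is y p(y) exp(-y), which tends to 0; the
  factor y is the \<open>pCons 0\<close> below.\<close>

lemma exp_bump_has_deriv:
  "(exp_bump p has_field_derivative exp_bump (monom 1 2 * (p - pderiv p)) t) (at t)"
proof -
  consider "t > 0" | "t < 0" | "t = 0" by linarith
  then show ?thesis
  proof cases
    case 1
    have "((\<lambda>t. poly p (1 / t) * exp (- (1 / t))) has_field_derivative
        exp_bump (monom 1 2 * (p - pderiv p)) t) (at t)"
      using 1 by (auto intro!: derivative_eq_intros DERIV_chain2[OF poly_DERIV]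
          simp: exp_bump_def poly_monom field_simps power2_eq_square)
    then show ?thesis
      by (rule has_field_derivative_transform_within_open[where S = "{0<..}"])
        (use 1 in \<open>auto simp: exp_bump_def\<close>)
  next
    case 2
    have "((\<lambda>t. 0) has_field_derivative exp_bump (monom 1 2 * (p - pderiv p)) t) (at t)"
      using 2 by (auto simp: exp_bump_def)
    then show ?thesis
      by (rule has_field_derivative_transform_within_open[where S = "{..<0}"])
        (use 2 in \<open>auto simp: exp_bump_def\<close>)
  next
    case 3
    have "((\<lambda>h. exp_bump p h / h) \<longlongrightarrow> 0) (at_right 0)"
      unfolding filterlim_at_right_to_top
    proof (rule Lim_transform_eventually[OF poly_times_exp_minus_tendsto_0[of "pCons 0 p"]])
      show "\<forall>\<^sub>F y in at_top. poly (pCons 0 p) y * exp (- y) = exp_bump p (inverse y) / inverse y"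
        using eventually_gt_at_top[of 0] by eventually_elim (simp add: exp_bump_def field_simps)
    qed
    moreover have "((\<lambda>h. exp_bump p h / h) \<longlongrightarrow> 0) (at_left 0)"
    proof (rule tendsto_eventually)
      show "\<forall>\<^sub>F h in at_left 0. exp_bump p h / h = 0"
        by (simp add: eventually_at_filter exp_bump_def)
    qed
    ultimately have "((\<lambda>h. exp_bump p h / h) \<longlongrightarrow> 0) (at 0)"
      by (rule filterlim_split_at[rotated])
    then show ?thesis using 3 by (simp add: has_field_derivative_iff exp_bump_def)
  qed
qed

lemma smooth_exp_bump: "smooth (exp_bump p)"
proof -
  have "k_times_diff n (exp_bump p)" for n
  proof (induction n arbitrary: p)
    case (Suc n)
    have "deriv (exp_bump p) = exp_bump (monom 1 2 * (p - pderiv p))"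
      by (intro ext DERIV_imp_deriv exp_bump_has_deriv)
    with Suc show ?case using exp_bump_has_deriv by (auto simp: real_differentiable_def)
  qed simp
  then show ?thesis by (simp add: smooth_iff)
qed

text \<open>N steepens the flanks while the support stays in [a, b]. For N to infinity the bumps
  converge pointwise to the indicator of the open interval, which lets test functions stand in for
  intervals.\<close>

definition bump :: "real \<Rightarrow> real \<Rightarrow> nat \<Rightarrow> real \<Rightarrow> real" where
  "bump a b N x = exp_bump 1 (real N * (x - a)) * exp_bump 1 (real N * (b - x))"

lemma smooth_bump: "smooth (bump a b N)"
proof -
  have "smooth (\<lambda>x. exp_bump 1 (real N * x + (- real N * a)) * exp_bump 1 ((- real N) * x + real N * b))"
    by (intro smooth_mult smooth_affine smooth_exp_bump)
  then show ?thesis by (simp add: bump_def[abs_def] algebra_simps)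
qed

lemma bump_bounds: "0 \<le> bump a b N x" "bump a b N x \<le> 1"
  by (auto simp: bump_def exp_bump_def intro!: mult_le_one)

lemma bump_outside: "x \<notin> {a<..<b} \<Longrightarrow> bump a b N x = 0"
  by (auto simp: bump_def exp_bump_def zero_less_mult_iff)

lemma exp_bump_tendsto:
  assumes "filterlim y at_top F"
  shows "((\<lambda>n. exp_bump 1 (y n)) \<longlongrightarrow> 1) F"
proof -
  have "((\<lambda>n. exp (- (inverse (y n)))) \<longlongrightarrow> exp (- 0)) F"
    using assms by (intro tendsto_intros tendsto_inverse_0_at_top)
  moreover have "\<forall>\<^sub>F n in F. exp (- (inverse (y n))) = exp_bump 1 (y n)"
    using assms by (auto simp: filterlim_at_top_dense exp_bump_def inverse_eq_divide elim: eventually_mono dest!: spec[of _ 0])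
  ultimately show ?thesis by (simp add: Lim_transform_eventually)
qed

lemma bump_tendsto: "(\<lambda>N. bump a b N x) \<longlonglongrightarrow> indicator {a<..<b} x"
proof (cases "x \<in> {a<..<b}")
  case True
  then have "(\<lambda>N. bump a b N x) \<longlonglongrightarrow> 1 * 1"
    unfolding bump_def
    by (intro tendsto_mult exp_bump_tendsto filterlim_at_top_mult_tendsto_pos[OF tendsto_const] filterlim_real_sequentially) auto
  then show ?thesis using True by simp
next
  case False
  then show ?thesis by (simp add: bump_outside)
qed

lemma test_functionI:
  assumes "smooth \<phi>" and "\<And>x. x \<notin> {a..b} \<Longrightarrow> \<phi> x = 0" and "{a..b} \<subseteq> I"
  shows "test_function_on \<phi> I"
proof -
  have "{x. \<phi> x \<noteq> 0} \<subseteq> {a..b}" using assms(2) by blast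
  then have "closure {x. \<phi> x \<noteq> 0} \<subseteq> {a..b}" by (simp add: closure_minimal)
  moreover have "compact (closure {x. \<phi> x \<noteq> 0})"
    using \<open>{x. \<phi> x \<noteq> 0} \<subseteq> {a..b}\<close> by (meson bounded_closed_interval bounded_subset compact_closure)
  ultimately show ?thesis
    using assms by (auto simp: test_function_on_def smooth_def)
qed

lemma test_functionE:
  assumes "test_function_on \<phi> {-1<..<1}"
  obtains a b where "smooth \<phi>" "-1 < a" "b < 1" "a \<le> b" "\<And>x. x \<notin> {a..b} \<Longrightarrow> \<phi> x = 0"
proof -
  let ?K = "closure {x. \<phi> x \<noteq> 0}"
  have s: "smooth \<phi>" and K: "compact ?K" "?K \<subseteq> {-1<..<1}"
    using assms by (auto simp: test_function_on_def smooth_def)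
  have z: "\<phi> x = 0" if "x \<notin> ?K" for x
    using that subsetD[OF closure_subset, of x "{x. \<phi> x \<noteq> 0}"] by blast
  show thesis
  proof (cases "?K = {}")
    case True
    then have "\<phi> x = 0" for x using z[of x] by blast
    then show ?thesis by (intro that[of 0 0] s) auto
  next
    case False
    obtain m M where m: "m \<in> ?K" "\<And>x. x \<in> ?K \<Longrightarrow> m \<le> x" and M: "M \<in> ?K" "\<And>x. x \<in> ?K \<Longrightarrow> x \<le> M"
      using compact_attains_inf[OF K(1) False] compact_attains_sup[OF K(1) False] by blast
    show ?thesis
    proof (rule that[of m M])
      show "-1 < m" "M < 1" "m \<le> M" using m M K(2) by auto
      show "\<phi> x = 0" if "x \<notin> {m..M}" for x
        using that m(2) M(2) by (intro z) auto
    qed (rule s)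
  qed
qed

section \<open>Weak derivatives\<close>

abbreviation J :: "real set" where "J \<equiv> {-1<..<1}"

text \<open>The positive and the negative part of d are densities of two finite measures that agree
  on all rays, hence on all Borel sets, and densities are unique almost everywhere. A Borel
  representative \<open>e\<close> is used because the rays generate only the Borel sets.\<close>

lemma AE_zero_if_integral_Ioi_zero:
  fixes d :: "real \<Rightarrow> real"
  assumes d: "integrable lebesgue d" and z: "\<And>x. (LINT t|lebesgue. indicator {x<..} t * d t) = 0"
  shows "AE x in lebesgue. d x = 0"
proof -
  obtain e where e[measurable]: "e \<in> borel_measurable lborel" and ae: "AE x in lborel. d x = e x"
    using completion_ex_borel_measurable_real[of d lborel] borel_measurable_integrable[OF d] by blast
  have ael: "AE x in lebesgue. d x = e x"
    using ae by (rule AE_completion)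
  have el: "e \<in> borel_measurable lebesgue"
    by (rule measurable_completion) (rule e)
  have "integrable lebesgue e"
    using d by (rule Bochner_Integration.integrable_cong_AE_imp) (use el ael in auto)
  then have ei: "integrable lborel e" using e integrable_completion by blast
  have ez: "(LINT t|lborel. indicator {x<..} t * e t) = 0" for x
  proof -
    have "(LINT t|lborel. indicator {x<..} t * e t) = (LINT t|lebesgue. indicator {x<..} t * e t)"
      by (rule integral_completion[symmetric]) measurable
    also have "\<dots> = (LINT t|lebesgue. indicator {x<..} t * d t)"
    proof (rule integral_cong_AE)
      show "(\<lambda>t. indicator {x<..} t * e t) \<in> borel_measurable lebesgue"
        by (rule measurable_completion) measurable
      show "(\<lambda>t. indicator {x<..} t * d t) \<in> borel_measurable lebesgue"
        using borel_measurable_integrable[OF d]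
        by (intro borel_measurable_times borel_measurable_indicator) auto
    qed (use ael in auto)
    finally show ?thesis using z by simp
  qed
  \<comment> \<open>\<open>ennreal\<close> cuts off negative values, so these densities are the
    positive and the negative part of \<open>e\<close>.\<close>
  let ?M = "density lborel (\<lambda>x. ennreal (e x))" and ?N = "density lborel (\<lambda>x. ennreal (- e x))"
  have em: "emeasure ?M {x<..} = ennreal (LINT t|lborel. indicator {x<..} t * max 0 (e t))"
    and en: "emeasure ?N {x<..} = ennreal (LINT t|lborel. indicator {x<..} t * max 0 (- e t))" for x
  proof -
    have i: "integrable lborel (\<lambda>t. indicator {x<..} t * max 0 (e t))"
      "integrable lborel (\<lambda>t. indicator {x<..} t * max 0 (- e t))"
      by (rule Bochner_Integration.integrable_bound[OF ei]; auto simp: indicator_def)+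
    have "emeasure ?M {x<..} = (\<integral>\<^sup>+ t. ennreal (indicator {x<..} t * max 0 (e t)) \<partial>lborel)"
      by (subst emeasure_density) (auto intro!: nn_integral_cong simp: indicator_def ennreal_neg max_def)
    also have "\<dots> = ennreal (LINT t|lborel. indicator {x<..} t * max 0 (e t))"
      by (rule nn_integral_eq_integral[OF i(1)]) auto
    finally show "emeasure ?M {x<..} = \<dots>" .
    have "emeasure ?N {x<..} = (\<integral>\<^sup>+ t. ennreal (indicator {x<..} t * max 0 (- e t)) \<partial>lborel)"
      by (subst emeasure_density) (auto intro!: nn_integral_cong simp: indicator_def ennreal_neg max_def)
    also have "\<dots> = ennreal (LINT t|lborel. indicator {x<..} t * max 0 (- e t))"
      by (rule nn_integral_eq_integral[OF i(2)]) auto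
    finally show "emeasure ?N {x<..} = \<dots>" .
  qed
  have "?M = ?N"
  proof (rule measure_eqI_lessThan)
    fix x :: real
    have "(LINT t|lborel. indicator {x<..} t * max 0 (e t)) - (LINT t|lborel. indicator {x<..} t * max 0 (- e t))
       = (LINT t|lborel. indicator {x<..} t * max 0 (e t) - indicator {x<..} t * max 0 (- e t))"
      by (rule Bochner_Integration.integral_diff[symmetric];
          rule Bochner_Integration.integrable_bound[OF ei]; auto simp: indicator_def)
    also have "\<dots> = (LINT t|lborel. indicator {x<..} t * e t)"
      by (intro Bochner_Integration.integral_cong) (auto simp: indicator_def)
    finally show "emeasure ?M {x<..} = emeasure ?N {x<..}"
      using ez[of x] by (simp add: em en)
    show "emeasure ?M {x<..} < \<infinity>" by (simp add: em)
  qed auto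
  then have "AE x in lborel. ennreal (e x) = ennreal (- e x)"
    by (subst (asm) sigma_finite_measure.density_unique_iff[OF sigma_finite_lborel]) auto
  moreover have "r = 0" if "ennreal r = ennreal (- r)" for r :: real
    using that by (cases "r \<ge> 0") (auto simp: ennreal_neg ennreal_eq_0_iff dest!: sym[of "ennreal r"])
  ultimately have "AE x in lborel. e x = 0" by auto
  then have "AE x in lebesgue. e x = 0" by (rule AE_completion)
  with ael show ?thesis by auto
qed

section \<open>Fundamental lemma of the calculus of variations, uniqueness of weak
  derivatives\<close>

lemma integrable_lebesgue_onD:
  fixes a b :: real
  assumes "integrable (lebesgue_on {a..b}) g"
  shows "integrable lebesgue (\<lambda>x. indicator {a..b} x * g x :: real)"
  using assms by (simp add: integrable_restrict_space)

lemma bounded_if_compact_support: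
  fixes \<psi> :: "real \<Rightarrow> real"
  assumes "continuous_on UNIV \<psi>" and "\<And>x. x \<notin> {a..b} \<Longrightarrow> \<psi> x = 0"
  obtains B where "\<And>x. \<bar>\<psi> x\<bar> \<le> B" "B \<ge> 0"
proof -
  have "compact (\<psi> ` {a..b})"
    by (intro compact_continuous_image continuous_on_subset[OF assms(1)]) auto
  then obtain B where B: "\<And>x. x \<in> {a..b} \<Longrightarrow> \<bar>\<psi> x\<bar> \<le> B"
    by (force simp: bounded_iff dest!: compact_imp_bounded)
  have "\<bar>\<psi> x\<bar> \<le> \<bar>B\<bar>" for x
    using B[of x] assms(2)[of x] by (cases "x \<in> {a..b}") auto
  then show thesis using that[of "\<bar>B\<bar>"] by auto
qed

lemma integrable_mult_compact_support:
  assumes g: "locally_integrable_on g J" and \<psi>: "continuous_on UNIV \<psi>"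
    and ab: "-1 < a" "b < 1" and z: "\<And>x. x \<notin> {a..b} \<Longrightarrow> \<psi> x = 0"
  shows "integrable (lebesgue_on J) (\<lambda>x. g x * \<psi> x)"
proof -
  have gi: "integrable lebesgue (\<lambda>x. indicator {a..b} x * g x)"
    using g ab unfolding locally_integrable_on_def
    by (intro integrable_lebesgue_onD) (auto dest!: spec[of _ "{a..b}"])
  obtain B where B: "\<And>x. \<bar>\<psi> x\<bar> \<le> B" "B \<ge> 0"
    using bounded_if_compact_support[OF \<psi> z] by metis
  have "integrable lebesgue (\<lambda>x. (indicator {a..b} x * g x) * \<psi> x)"
  proof (rule Bochner_Integration.integrable_bound[OF integrable_mult_left[OF gi, of B]])
    have "\<psi> \<in> borel_measurable lebesgue"
      using borel_measurable_continuous_onI[OF \<psi>] by (simp add: measurable_completion)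
    then show "(\<lambda>x. (indicator {a..b} x * g x) * \<psi> x) \<in> borel_measurable lebesgue"
      using borel_measurable_integrable[OF gi] by (rule borel_measurable_times[rotated])
    show "AE x in lebesgue. norm ((indicator {a..b} x * g x) * \<psi> x) \<le> norm (indicator {a..b} x * g x * B)"
      using B by (auto simp: abs_mult intro!: mult_left_mono)
  qed
  moreover have "(indicator {a..b} x * g x) * \<psi> x = indicator J x *\<^sub>R (g x * \<psi> x)" for x
    using z[of x] ab by (auto simp: indicator_def)
  ultimately show ?thesis by (simp add: integrable_restrict_space)
qed

lemma integrable_mult_test:
  assumes "locally_integrable_on g J" "test_function_on \<phi> J"
  shows "integrable (lebesgue_on J) (\<lambda>x. g x * \<phi> x)"
    and "integrable (lebesgue_on J) (\<lambda>x. g x * deriv \<phi> x)"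
proof -
  obtain a b where s: "smooth \<phi>" and ab: "-1 < a" "b < 1" and z: "\<And>x. x \<notin> {a..b} \<Longrightarrow> \<phi> x = 0"
    using test_functionE[OF assms(2)] by metis
  show "integrable (lebesgue_on J) (\<lambda>x. g x * \<phi> x)"
    by (rule integrable_mult_compact_support[OF assms(1) smooth_continuous[OF s] ab z])
  \<comment> \<open>The complement of the support interval is open, so \<phi> vanishes in a whole
    neighbourhood of x.\<close>
  have "deriv \<phi> x = 0" if x: "x \<notin> {a..b}" for x
  proof -
    have "((\<lambda>x. 0) has_field_derivative 0) (at x)" by simp
    then have "(\<phi> has_field_derivative 0) (at x)"
      by (rule has_field_derivative_transform_within_open[where S = "- {a..b}"]) (use x z in auto)
    then show ?thesis by (rule DERIV_imp_deriv)
  qed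
  then show "integrable (lebesgue_on J) (\<lambda>x. g x * deriv \<phi> x)"
    by (rule integrable_mult_compact_support[OF assms(1) smooth_continuous[OF smooth_deriv[OF s]] ab])
qed

lemma locally_integrable_diff:
  "locally_integrable_on f I \<Longrightarrow> locally_integrable_on g I \<Longrightarrow> locally_integrable_on (\<lambda>x. f x - g x) I"
  by (auto simp: locally_integrable_on_def)

lemma has_weak_deriv_diff:
  assumes u: "has_weak_deriv_on u g J" and v: "has_weak_deriv_on v h J"
  shows "has_weak_deriv_on (\<lambda>x. u x - v x) (\<lambda>x. g x - h x) J"
  unfolding has_weak_deriv_on_def
proof (intro conjI allI impI locally_integrable_diff)
  show l: "locally_integrable_on u J" "locally_integrable_on v J" "locally_integrable_on g J" "locally_integrable_on h J"
    using u v by (auto simp: has_weak_deriv_on_def)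
  fix \<phi> assume t: "test_function_on \<phi> J"
  show "(LINT x|lebesgue_on J. (u x - v x) * deriv \<phi> x) = - (LINT x|lebesgue_on J. (g x - h x) * \<phi> x)"
    using u v t l[THEN integrable_mult_test(1)] l[THEN integrable_mult_test(2)]
    by (simp add: left_diff_distrib has_weak_deriv_on_def)
qed

text \<open>Bumps converge boundedly to indicators, so the integrals of d over intervals well inside
  \<open>J\<close> vanish, and \<open>AE_zero_if_integral_Ioi_zero\<close> applies to d restricted
  to such an interval.\<close>

lemma AE_zero_if_test_zero:
  assumes d: "locally_integrable_on d J"
    and z: "\<And>\<phi>. test_function_on \<phi> J \<Longrightarrow> (LINT x|lebesgue_on J. d x * \<phi> x) = 0"
  shows "AE x in lebesgue_on J. d x = 0"
proof -
  have int0: "(LINT t|lebesgue. indicator {a<..<b} t * d t) = 0" if ab: "-1 < a" "b < 1" for a b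
  proof -
    let ?h = "\<lambda>t. indicator {a..b} t * d t"
    have hi: "integrable lebesgue ?h"
      using d ab unfolding locally_integrable_on_def
      by (intro integrable_lebesgue_onD) (auto dest!: spec[of _ "{a..b}"])
    have bm: "bump a b N \<in> borel_measurable lebesgue" for N
      using borel_measurable_continuous_onI[OF smooth_continuous[OF smooth_bump]]
      by (simp add: measurable_completion)
    have "(\<lambda>N. LINT t|lebesgue. ?h t * bump a b N t) \<longlonglongrightarrow> (LINT t|lebesgue. indicator {a<..<b} t * d t)"
    proof (rule integral_dominated_convergence[where w = "\<lambda>t. norm (?h t)"])
      have "(\<lambda>t. indicator {a<..<b} t * ?h t) \<in> borel_measurable lebesgue"
        by (rule borel_measurable_times[OF borel_measurable_indicator borel_measurable_integrable[OF hi]]) auto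
      moreover have "indicator {a<..<b} t * ?h t = indicator {a<..<b} t * d t" for t
        by (auto simp: indicator_def)
      ultimately show "(\<lambda>t. indicator {a<..<b} t * d t) \<in> borel_measurable lebesgue" by simp
      show "(\<lambda>t. ?h t * bump a b N t) \<in> borel_measurable lebesgue" for N
        by (rule borel_measurable_times[OF borel_measurable_integrable[OF hi] bm])
      show "integrable lebesgue (\<lambda>t. norm (?h t))" using hi by simp
      show "AE t in lebesgue. (\<lambda>N. ?h t * bump a b N t) \<longlonglongrightarrow> indicator {a<..<b} t * d t"
      proof (rule AE_I2)
        fix t
        have "(\<lambda>N. ?h t * bump a b N t) \<longlonglongrightarrow> ?h t * indicator {a<..<b} t"
          by (intro tendsto_mult tendsto_const bump_tendsto)
        then show "(\<lambda>N. ?h t * bump a b N t) \<longlonglongrightarrow> indicator {a<..<b} t * d t"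
          by (auto simp: indicator_def split: if_splits)
      qed
      show "AE t in lebesgue. norm (?h t * bump a b N t) \<le> norm (?h t)" for N
        using bump_bounds[of a b N] by (auto simp: abs_mult intro!: mult_left_le)
    qed
    moreover have "(LINT t|lebesgue. ?h t * bump a b N t) = 0" for N
    proof -
      have "test_function_on (bump a b N) J"
        using ab by (intro test_functionI[OF smooth_bump, of a b] bump_outside) auto
      from z[OF this] have "(LINT t|lebesgue. indicator J t *\<^sub>R (d t * bump a b N t)) = 0"
        by (simp add: integral_restrict_space)
      moreover have "indicator J t *\<^sub>R (d t * bump a b N t) = ?h t * bump a b N t" for t
        using ab bump_outside[of t a b N] by (auto simp: indicator_def)
      ultimately show ?thesis by (simp only:)
    qed
    ultimately show ?thesis by (simp add: LIMSEQ_const_iff)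
  qed
  \<comment> \<open>d is only locally integrable, so it is cut off to countably many intervals that
    exhaust \<open>J\<close> and have their closure in \<open>J\<close>.\<close>
  define \<beta> where "\<beta> n = 1 - inverse (real (Suc n))" for n
  have \<beta>: "\<beta> n < 1" "0 \<le> \<beta> n" for n by (auto simp: \<beta>_def inverse_le_1_iff)
  have "AE x in lebesgue. indicator {- \<beta> n<..<\<beta> n} x * d x = 0" for n
  proof (rule AE_zero_if_integral_Ioi_zero)
    let ?h = "\<lambda>t. indicator {- \<beta> n..\<beta> n} t * d t"
    have "integrable lebesgue ?h"
      using d \<beta>[of n] unfolding locally_integrable_on_def
      by (intro integrable_lebesgue_onD) (auto dest!: spec[of _ "{- \<beta> n..\<beta> n}"])
    then have "integrable lebesgue (\<lambda>t. indicator {- \<beta> n<..<\<beta> n} t *\<^sub>R ?h t)"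
      by (intro integrable_mult_indicator) auto
    moreover have "indicator {- \<beta> n<..<\<beta> n} t *\<^sub>R ?h t = indicator {- \<beta> n<..<\<beta> n} t * d t" for t
      by (auto simp: indicator_def)
    ultimately show "integrable lebesgue (\<lambda>t. indicator {- \<beta> n<..<\<beta> n} t * d t)" by (simp only:)
    fix x
    have eq: "indicator {x<..} t * (indicator {- \<beta> n<..<\<beta> n} t * d t) = indicator {max x (- \<beta> n)<..<\<beta> n} t * d t" for t
      by (auto simp: indicator_def)
    have "-1 < max x (- \<beta> n)" using \<beta>[of n] by (simp add: less_max_iff_disj)
    then show "(LINT t|lebesgue. indicator {x<..} t * (indicator {- \<beta> n<..<\<beta> n} t * d t)) = 0"
      unfolding eq using \<beta>[of n] by (intro int0) auto
  qed
  then have "AE x in lebesgue. \<forall>n. indicator {- \<beta> n<..<\<beta> n} x * d x = 0"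
    by (subst AE_all_countable) blast
  moreover have "d x = 0" if "\<forall>n. indicator {- \<beta> n<..<\<beta> n} x * d x = 0" "x \<in> J" for x
  proof -
    obtain n where "inverse (real (Suc n)) < 1 - \<bar>x\<bar>"
      using \<open>x \<in> J\<close> reals_Archimedean[of "1 - \<bar>x\<bar>"] by (auto simp: abs_less_iff)
    then have "x \<in> {- \<beta> n<..<\<beta> n}" by (auto simp: \<beta>_def)
    with that(1)[rule_format, of n] show ?thesis by simp
  qed
  ultimately have "AE x in lebesgue. x \<in> J \<longrightarrow> d x = 0" by auto
  then show ?thesis by (simp add: AE_restrict_space_iff)
qed

lemma weak_deriv_unique:
  assumes g: "has_weak_deriv_on u g J" and h: "has_weak_deriv_on u h J"
  shows "AE x in lebesgue_on J. g x = h x"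
proof -
  have "AE x in lebesgue_on J. g x - h x = 0"
  proof (rule AE_zero_if_test_zero)
    show l: "locally_integrable_on (\<lambda>x. g x - h x) J"
      using has_weak_deriv_diff[OF g h] by (simp add: has_weak_deriv_on_def)
    show "(LINT x|lebesgue_on J. (g x - h x) * \<phi> x) = 0" if "test_function_on \<phi> J" for \<phi>
      using has_weak_deriv_diff[OF g h] that by (simp add: has_weak_deriv_on_def)
  qed
  then show ?thesis by simp
qed

lemma weak_deriv_AE:
  assumes "has_weak_deriv_on u g J"
  shows "AE x in lebesgue_on J. weak_deriv J u x = g x" "has_weak_deriv_on u (weak_deriv J u) J"
proof -
  show "has_weak_deriv_on u (weak_deriv J u) J"
    unfolding weak_deriv_def by (rule someI[of "\<lambda>g. has_weak_deriv_on u g J", OF assms])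
  then show "AE x in lebesgue_on J. weak_deriv J u x = g x"
    by (rule weak_deriv_unique) (rule assms)
qed

text \<open>A pointwise limit of the restrictions to compact intervals exhausting
  \<open>J\<close>.\<close>

lemma locally_integrable_measurable:
  assumes "locally_integrable_on g J"
  shows "g \<in> borel_measurable (lebesgue_on J)"
proof -
  define \<beta> where "\<beta> n = 1 - inverse (real (Suc n))" for n
  have \<beta>: "\<beta> n < 1" "0 \<le> \<beta> n" for n by (auto simp: \<beta>_def inverse_le_1_iff)
  have "(\<lambda>x. indicator J x * g x) \<in> borel_measurable lebesgue"
  proof (rule borel_measurable_LIMSEQ_real)
    show "(\<lambda>t. indicator {- \<beta> n..\<beta> n} t * g t) \<in> borel_measurable lebesgue" for n
      using assms \<beta>[of n] unfolding locally_integrable_on_def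
      by (intro borel_measurable_integrable integrable_lebesgue_onD) (auto dest!: spec[of _ "{- \<beta> n..\<beta> n}"])
    fix x
    have "\<forall>\<^sub>F n in sequentially. indicator {- \<beta> n..\<beta> n} x * g x = indicator J x * g x"
    proof (cases "x \<in> J")
      case True
      have "\<forall>\<^sub>F n in sequentially. inverse (real (Suc n)) < 1 - \<bar>x\<bar>"
        using LIMSEQ_inverse_real_of_nat True by (intro order_tendstoD) auto
      then show ?thesis by eventually_elim (use True in \<open>auto simp: \<beta>_def indicator_def\<close>)
    next
      case False
      then have "x \<notin> {- \<beta> n..\<beta> n}" for n using \<beta>[of n] by auto
      then show ?thesis using False by simp
    qed
    then show "(\<lambda>n. indicator {- \<beta> n..\<beta> n} x * g x) \<longlonglongrightarrow> indicator J x * g x"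
      by (rule tendsto_eventually)
  qed
  then show ?thesis by (simp add: borel_measurable_restrict_space_iff)
qed

section \<open>Square integrable functions and classical derivatives\<close>

lemma continuous_integrable_J:
  fixes G :: "real \<Rightarrow> real"
  assumes "continuous_on {-1..1} G"
  shows "integrable (lebesgue_on J) G" and "(LINT x|lebesgue_on J. G x) = integral {-1..1} G"
proof -
  have "integrable lebesgue (\<lambda>x. indicator {-1..1} x * G x)"
    by (rule integrable_lebesgue_onD[OF continuous_imp_integrable_real[OF assms]])
  then have "integrable lebesgue (\<lambda>x. indicator J x *\<^sub>R (indicator {-1..1} x * G x))"
    by (rule integrable_mult_indicator[rotated]) auto
  moreover have "indicator J x *\<^sub>R (indicator {-1..1} x * G x) = indicator J x *\<^sub>R G x" for x
    by (auto simp: indicator_def)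
  ultimately have "integrable lebesgue (\<lambda>x. indicator J x *\<^sub>R G x)" by (simp only:)
  then show i: "integrable (lebesgue_on J) G" by (simp add: integrable_restrict_space)
  show "(LINT x|lebesgue_on J. G x) = integral {-1..1} G"
    using lebesgue_integral_eq_integral[OF i] by (simp add: integral_open_interval_real)
qed

lemma square_integrable_mult:
  assumes "square_integrable_on f J" "square_integrable_on g J"
  shows "integrable (lebesgue_on J) (\<lambda>x. f x * g x)"
proof (rule Bochner_Integration.integrable_bound)
  show "integrable (lebesgue_on J) (\<lambda>x. (f x)\<^sup>2 + (g x)\<^sup>2)"
    using assms by (auto simp: square_integrable_on_def)
  show "(\<lambda>x. f x * g x) \<in> borel_measurable (lebesgue_on J)"
    using assms by (intro borel_measurable_times) (auto simp: square_integrable_on_def)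
  have "\<bar>a * b\<bar> \<le> a\<^sup>2 + b\<^sup>2" for a b :: real
  proof -
    have "2 * (\<bar>a\<bar> * \<bar>b\<bar>) \<le> a\<^sup>2 + b\<^sup>2"
      using sum_squares_bound[of "\<bar>a\<bar>" "\<bar>b\<bar>"] by (simp add: mult.assoc)
    moreover have "0 \<le> \<bar>a\<bar> * \<bar>b\<bar>" by simp
    ultimately show ?thesis unfolding abs_mult by linarith
  qed
  then show "AE x in lebesgue_on J. norm (f x * g x) \<le> norm ((f x)\<^sup>2 + (g x)\<^sup>2)"
    by (intro AE_I2) simp
qed

lemma square_integrable_diff:
  assumes "square_integrable_on f J" "square_integrable_on g J"
  shows "square_integrable_on (\<lambda>x. f x - g x) J"
proof -
  have "integrable (lebesgue_on J) (\<lambda>x. (f x)\<^sup>2 + (g x)\<^sup>2 - 2 * (f x * g x))"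
    using assms square_integrable_mult[OF assms]
    by (intro Bochner_Integration.integrable_diff Bochner_Integration.integrable_add integrable_mult_right)
      (auto simp: square_integrable_on_def)
  then show ?thesis using assms by (auto simp: square_integrable_on_def power2_diff algebra_simps)
qed

lemma continuous_square_integrable:
  assumes "continuous_on {-1..1} G"
  shows "square_integrable_on G J"
  unfolding square_integrable_on_def
  using continuous_integrable_J(1)[OF assms] continuous_integrable_J(1)[OF continuous_on_power[OF assms]]
  by auto

lemma square_integrable_cong_AE:
  assumes "square_integrable_on f J" "g \<in> borel_measurable (lebesgue_on J)" "AE x in lebesgue_on J. f x = g x"
  shows "square_integrable_on g J"
    and "(LINT x|lebesgue_on J. (g x)\<^sup>2) = (LINT x|lebesgue_on J. (f x)\<^sup>2)"
  using assms unfolding square_integrable_on_def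
  by (auto intro!: integral_cong_AE elim!: Bochner_Integration.integrable_cong_AE_imp)

lemma L2_norm_tendsto_0D:
  assumes "(\<lambda>n. L2_norm J (h n)) \<longlonglongrightarrow> 0" and "d > 0"
  shows "\<forall>\<^sub>F n in sequentially. square_integrable_on (h n) J \<and> (LINT x|lebesgue_on J. (h n x)\<^sup>2) < d"
proof -
  have "\<forall>\<^sub>F n in sequentially. L2_norm J (h n) < ereal (sqrt d)"
    using assms by (intro order_tendstoD(2)) auto
  then show ?thesis
    by eventually_elim (auto simp: L2_norm_def split: if_splits)
qed

text \<open>The Young inequality |G h| <= (d G^2 + h^2 / d) / 2 with a free weight d takes the place
  of the Cauchy-Schwarz inequality.\<close>

lemma L2_tendsto_imp_inner_tendsto:
  assumes G: "square_integrable_on G J" and v: "square_integrable_on v J"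
    and lim: "(\<lambda>n. L2_norm J (\<lambda>x. v x - \<phi> n x)) \<longlonglongrightarrow> 0"
  shows "(\<lambda>n. LINT x|lebesgue_on J. G x * \<phi> n x) \<longlonglongrightarrow> (LINT x|lebesgue_on J. G x * v x)"
proof (rule metric_LIMSEQ_I)
  fix r :: real assume r: "r > 0"
  let ?A = "LINT x|lebesgue_on J. (G x)\<^sup>2"
  have A0: "?A \<ge> 0" by simp
  \<comment> \<open>Makes d times the integral of G^2 smaller than r; the other term is smaller than
    r once the integral of h^2 is below r d. The added 1 covers the case that G vanishes almost
    everywhere.\<close>
  define d where "d = r / (?A + 1)"
  have d: "d > 0" "d * ?A < r"
    using r A0 by (auto simp: d_def pos_divide_less_eq add_nonneg_pos intro!: divide_pos_pos)
  have "\<forall>\<^sub>F n in sequentially. dist (LINT x|lebesgue_on J. G x * \<phi> n x) (LINT x|lebesgue_on J. G x * v x) < r"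
  proof (rule eventually_mono[OF L2_norm_tendsto_0D[OF lim, of "r * d"]])
    show "0 < r * d" using r d(1) by simp
    fix n
    assume 2: "square_integrable_on (\<lambda>x. v x - \<phi> n x) J \<and> (LINT x|lebesgue_on J. (v x - \<phi> n x)\<^sup>2) < r * d"
    let ?h = "\<lambda>x. v x - \<phi> n x"
    have h: "square_integrable_on ?h J" and hd: "(LINT x|lebesgue_on J. (?h x)\<^sup>2) < r * d"
      using 2 by auto
    have ph: "square_integrable_on (\<phi> n) J"
      using square_integrable_diff[OF v h] by simp
    have "(LINT x|lebesgue_on J. G x * v x) - (LINT x|lebesgue_on J. G x * \<phi> n x)
        = (LINT x|lebesgue_on J. G x * ?h x)"
      using Bochner_Integration.integral_diff[OF square_integrable_mult[OF G v] square_integrable_mult[OF G ph]]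
      by (simp add: right_diff_distrib)
    moreover have "\<bar>LINT x|lebesgue_on J. G x * ?h x\<bar> \<le> (LINT x|lebesgue_on J. (d * (G x)\<^sup>2 + (?h x)\<^sup>2 / d) / 2)"
    proof (rule integral_abs_bound_integral[OF square_integrable_mult[OF G h]])
      show "integrable (lebesgue_on J) (\<lambda>x. (d * (G x)\<^sup>2 + (?h x)\<^sup>2 / d) / 2)"
        using G h by (auto simp: square_integrable_on_def)
      show "\<bar>G x * ?h x\<bar> \<le> (d * (G x)\<^sup>2 + (?h x)\<^sup>2 / d) / 2" for x
      proof -
        have "0 \<le> (d * \<bar>G x\<bar> - \<bar>?h x\<bar>)\<^sup>2" by simp
        then have "2 * d * (\<bar>G x\<bar> * \<bar>?h x\<bar>) \<le> d * (d * (G x)\<^sup>2) + (?h x)\<^sup>2"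
          by (simp add: power2_diff power_mult_distrib power2_eq_square algebra_simps)
        then show ?thesis using d(1) unfolding abs_mult by (simp add: field_simps)
      qed
    qed
    moreover have "(LINT x|lebesgue_on J. (d * (G x)\<^sup>2 + (?h x)\<^sup>2 / d) / 2)
        = (d * ?A + (LINT x|lebesgue_on J. (?h x)\<^sup>2) / d) / 2"
      using G h by (simp add: square_integrable_on_def)
    moreover have "(LINT x|lebesgue_on J. (?h x)\<^sup>2) / d < r"
      using hd d(1) by (simp add: pos_divide_less_eq)
    moreover have "\<bar>b - a\<bar> < r" if "a - b = w" "\<bar>w\<bar> \<le> i" "i = (p + q) / 2" "q < r" "p < r" for a b w i p q :: real
    proof -
      have "i < r" using that(3-5) by simp
      then show ?thesis using that(1,2) by (simp add: abs_minus_commute[of b])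
    qed
    ultimately show "dist (LINT x|lebesgue_on J. G x * \<phi> n x) (LINT x|lebesgue_on J. G x * v x) < r"
      using d(2) unfolding dist_real_def by blast
  qed
  then show "\<exists>no. \<forall>n\<ge>no. dist (LINT x|lebesgue_on J. G x * \<phi> n x) (LINT x|lebesgue_on J. G x * v x) < r"
    by (simp add: eventually_sequentially)
qed

text \<open>Integration by parts: G \<phi> vanishes at -1 and 1 because \<phi> does. Continuity on
  the closed interval supplies the integrability.\<close>

lemma classical_has_weak_deriv:
  assumes G: "continuous_on {-1..1} G" and g: "continuous_on {-1..1} g"
    and d: "\<And>x. x \<in> J \<Longrightarrow> (G has_field_derivative g x) (at x)"
  shows "has_weak_deriv_on G g J"
  unfolding has_weak_deriv_on_def
proof (intro conjI allI impI)
  have loc: "locally_integrable_on h J" if h: "continuous_on {-1..1} h" for h :: "real \<Rightarrow> real"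
    unfolding locally_integrable_on_def
  proof (intro allI impI)
    fix K :: "real set" assume K: "compact K \<and> K \<subseteq> J"
    then have K': "K \<in> sets lebesgue" by (intro fmeasurableD lmeasurable_compact) auto
    have "integrable lebesgue (\<lambda>x. indicator J x *\<^sub>R h x)"
      using continuous_integrable_J(1)[OF h] by (simp add: integrable_restrict_space)
    then have "integrable lebesgue (\<lambda>x. indicator K x *\<^sub>R (indicator J x *\<^sub>R h x))"
      by (rule integrable_mult_indicator[OF K'])
    moreover have "indicator K x *\<^sub>R (indicator J x *\<^sub>R h x) = indicator K x *\<^sub>R h x" for x
      using K by (auto simp: indicator_def)
    ultimately have "integrable lebesgue (\<lambda>x. indicator K x *\<^sub>R h x)" by (simp only:)
    then show "integrable (lebesgue_on K) h" using K' by (simp add: integrable_restrict_space)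
  qed
  show "locally_integrable_on G J" "locally_integrable_on g J"
    by (rule loc[OF G], rule loc[OF g])
  fix \<phi> assume t: "test_function_on \<phi> J"
  obtain a b where s: "smooth \<phi>" and ab: "-1 < a" "b < 1" and z: "\<And>x. x \<notin> {a..b} \<Longrightarrow> \<phi> x = 0"
    using test_functionE[OF t] by metis
  have c: "continuous_on {-1..1} (\<lambda>x. G x * deriv \<phi> x)" "continuous_on {-1..1} (\<lambda>x. g x * \<phi> x)"
    by (intro continuous_intros G g smooth_continuous s smooth_deriv)+
  have "((\<lambda>x. G x * deriv \<phi> x + g x * \<phi> x) has_integral G 1 * \<phi> 1 - G (-1) * \<phi> (-1)) {-1..1}"
  proof (rule fundamental_theorem_of_calculus_interior)
    show "continuous_on {-1..1} (\<lambda>x. G x * \<phi> x)"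
      by (intro continuous_intros G smooth_continuous s)
    fix x :: real assume "x \<in> {-1<..<1}"
    then have "((\<lambda>x. G x * \<phi> x) has_field_derivative g x * \<phi> x + deriv \<phi> x * G x) (at x)"
      by (intro DERIV_mult d smooth_imp_has_deriv s) auto
    then show "((\<lambda>x. G x * \<phi> x) has_vector_derivative G x * deriv \<phi> x + g x * \<phi> x) (at x)"
      by (simp add: has_real_derivative_iff_has_vector_derivative algebra_simps)
  qed simp
  moreover have "\<phi> 1 = 0" "\<phi> (-1) = 0" using z ab by auto
  ultimately have "integral {-1..1} (\<lambda>x. G x * deriv \<phi> x + g x * \<phi> x) = 0"
    by (simp add: integral_unique)
  moreover have "integral {-1..1} (\<lambda>x. G x * deriv \<phi> x + g x * \<phi> x)
      = integral {-1..1} (\<lambda>x. G x * deriv \<phi> x) + integral {-1..1} (\<lambda>x. g x * \<phi> x)"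
    by (intro Henstock_Kurzweil_Integration.integral_add integrable_continuous_interval c)
  ultimately show "(LINT x|lebesgue_on J. G x * deriv \<phi> x) = - (LINT x|lebesgue_on J. g x * \<phi> x)"
    by (simp add: continuous_integrable_J(2)[OF c(1)] continuous_integrable_J(2)[OF c(2)])
qed

section \<open>Density of test functions\<close>

text \<open>Test functions on \<open>J\<close> that tend to 1 pointwise. The shift to n + 2 keeps
  the margin at the endpoints at most 1/2.\<close>

definition cutoff :: "nat \<Rightarrow> real \<Rightarrow> real" where
  "cutoff n = bump (-1 + 1 / real (n + 2)) (1 - 1 / real (n + 2)) ((n + 2)\<^sup>2)"

lemma cutoff_tendsto: "x \<in> J \<Longrightarrow> (\<lambda>n. cutoff n x) \<longlonglongrightarrow> 1"
proof -
  assume x: "x \<in> J"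
  have lim: "filterlim (\<lambda>n. real ((n + 2)\<^sup>2) * (c - 1 / real (n + 2))) at_top sequentially" if "c > 0" for c
  proof -
    have "filterlim (\<lambda>n. real (n + 2)) at_top sequentially"
      using filterlim_subseq[of "\<lambda>n. n + 2"]
      by (intro filterlim_compose[OF filterlim_real_sequentially]) (auto simp: strict_mono_def)
    then have "filterlim (\<lambda>n. (- 1 + c * real (n + 2)) * real (n + 2)) at_top sequentially"
      using that by (intro filterlim_at_top_mult_at_top filterlim_tendsto_add_at_top[OF tendsto_const]
          filterlim_tendsto_pos_mult_at_top[OF tendsto_const])
    moreover have "(- 1 + c * real (n + 2)) * real (n + 2) = real ((n + 2)\<^sup>2) * (c - 1 / real (n + 2))" for n
      by (simp add: field_simps power2_eq_square)
    ultimately show ?thesis by simp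
  qed
  have "(\<lambda>n. exp_bump 1 (real ((n + 2)\<^sup>2) * ((x + 1) - 1 / real (n + 2))) * exp_bump 1 (real ((n + 2)\<^sup>2) * ((1 - x) - 1 / real (n + 2)))) \<longlonglongrightarrow> 1 * 1"
    using x by (intro tendsto_mult exp_bump_tendsto lim) auto
  then show ?thesis by (simp add: cutoff_def bump_def algebra_simps)
qed

lemma cutoff_bounds: "0 \<le> cutoff n x" "cutoff n x \<le> 1"
  by (simp_all add: cutoff_def bump_bounds)

lemma cutoff_outside: "x \<notin> {-1 + 1 / real (n + 2)<..<1 - 1 / real (n + 2)} \<Longrightarrow> cutoff n x = 0"
  unfolding cutoff_def by (rule bump_outside)

lemma smooth_cutoff: "smooth (cutoff n)"
  by (simp add: cutoff_def smooth_bump)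

lemma integral_cutoff_tendsto:
  assumes q: "continuous_on {-1..1} q"
  shows "(\<lambda>n. LINT x|lebesgue_on J. q x * cutoff n x) \<longlonglongrightarrow> (LINT x|lebesgue_on J. q x)"
    and "(\<lambda>n. LINT x|lebesgue_on J. (q x * (1 - cutoff n x))\<^sup>2) \<longlonglongrightarrow> 0"
proof -
  have c: "continuous_on {-1..1} (cutoff n)" for n by (rule smooth_continuous[OF smooth_cutoff])
  have m: "f \<in> borel_measurable (lebesgue_on J)" if "continuous_on {-1..1} f" for f :: "real \<Rightarrow> real"
    using continuous_integrable_J(1)[OF that] by (rule borel_measurable_integrable)
  show "(\<lambda>n. LINT x|lebesgue_on J. q x * cutoff n x) \<longlonglongrightarrow> (LINT x|lebesgue_on J. q x)"
  proof (rule integral_dominated_convergence[where w = "\<lambda>x. \<bar>q x\<bar>"])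
    show "integrable (lebesgue_on J) (\<lambda>x. \<bar>q x\<bar>)"
      by (intro continuous_integrable_J continuous_intros q)
    show "AE x in lebesgue_on J. (\<lambda>n. q x * cutoff n x) \<longlonglongrightarrow> q x"
    proof (rule AE_I2)
      fix x assume "x \<in> space (lebesgue_on J)"
      then have "(\<lambda>n. q x * cutoff n x) \<longlonglongrightarrow> q x * 1"
        by (intro tendsto_intros cutoff_tendsto) simp
      then show "(\<lambda>n. q x * cutoff n x) \<longlonglongrightarrow> q x" by simp
    qed
    show "AE x in lebesgue_on J. norm (q x * cutoff n x) \<le> \<bar>q x\<bar>" for n
      using cutoff_bounds[of n] by (intro AE_I2) (simp add: abs_mult mult_left_le)
  qed (intro m continuous_intros q c)+
  have "(\<lambda>n. LINT x|lebesgue_on J. (q x * (1 - cutoff n x))\<^sup>2) \<longlonglongrightarrow> (LINT x|lebesgue_on J. 0)"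
  proof (rule integral_dominated_convergence[where w = "\<lambda>x. (q x)\<^sup>2"])
    show "integrable (lebesgue_on J) (\<lambda>x. (q x)\<^sup>2)"
      by (intro continuous_integrable_J continuous_intros q)
    show "AE x in lebesgue_on J. (\<lambda>n. (q x * (1 - cutoff n x))\<^sup>2) \<longlonglongrightarrow> 0"
    proof (rule AE_I2)
      fix x assume "x \<in> space (lebesgue_on J)"
      then have "(\<lambda>n. (q x * (1 - cutoff n x))\<^sup>2) \<longlonglongrightarrow> (q x * (1 - 1))\<^sup>2"
        by (intro tendsto_intros cutoff_tendsto) simp
      then show "(\<lambda>n. (q x * (1 - cutoff n x))\<^sup>2) \<longlonglongrightarrow> 0" by simp
    qed
    have "(a * (1 - b))\<^sup>2 \<le> a\<^sup>2" if "0 \<le> b" "b \<le> 1" for a b :: real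
      using that mult_left_mono[OF power_le_one[of "1 - b" 2], of "a\<^sup>2"] by (simp add: power_mult_distrib)
    then show "AE x in lebesgue_on J. norm ((q x * (1 - cutoff n x))\<^sup>2) \<le> (q x)\<^sup>2" for n
      using cutoff_bounds[of n] by (intro AE_I2) simp
  qed (intro m continuous_intros q c)+
  then show "(\<lambda>n. LINT x|lebesgue_on J. (q x * (1 - cutoff n x))\<^sup>2) \<longlonglongrightarrow> 0" by simp
qed

text \<open>An antiderivative is constant on either side of the support of \<psi>. Mean zero makes
  the two constants equal, so subtracting the value at -1 gives compact support.\<close>

lemma test_function_antideriv:
  assumes s: "smooth \<psi>" and ab: "-1 < a" "a \<le> b" "b < 1"
    and z: "\<And>x. x \<notin> {a..b} \<Longrightarrow> \<psi> x = 0" and i: "integral {-1..1} \<psi> = 0"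
  obtains \<phi> where "test_function_on \<phi> J" "deriv \<phi> = \<psi>"
proof -
  have "\<exists>F. \<forall>x::real. - \<infinity> < ereal x \<longrightarrow> ereal x < \<infinity> \<longrightarrow> (F has_vector_derivative \<psi> x) (at x)"
    using smooth_imp_has_deriv[OF s] by (intro einterval_antiderivative) (auto intro: DERIV_isCont)
  then obtain F where F: "\<And>x. (F has_vector_derivative \<psi> x) (at x)" by auto
  define \<phi> where "\<phi> x = F x - F (-1)" for x
  have d: "(\<phi> has_field_derivative \<psi> x) (at x)" for x
  proof -
    have "(F has_field_derivative \<psi> x) (at x)"
      using F by (simp only: has_real_derivative_iff_has_vector_derivative)
    from DERIV_diff[OF this DERIV_const[of "F (-1)"]] show ?thesis
      unfolding \<phi>_def[abs_def] by (simp only: diff_0_right)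
  qed
  have ftc: "(\<psi> has_integral F y - F x) {x..y}" if "x \<le> y" for x y
    by (rule fundamental_theorem_of_calculus[OF that has_vector_derivative_at_within[OF F]])
  have eq: "F y = F x" if "x \<le> y" "\<And>t. t \<in> {x..y} \<Longrightarrow> \<psi> t = 0" for x y
    using has_integral_unique[OF ftc[OF that(1)] has_integral_is_0[of "{x..y}" \<psi>]] that(2) by simp
  have F1: "F 1 = F (-1)" using ftc[of "-1" 1] i by (simp add: integral_unique)
  have "\<phi> x = 0" if "x \<notin> {a..b}" for x
  proof -
    consider "x \<le> -1" | "-1 \<le> x" "x < a" | "b < x" "x \<le> 1" | "1 \<le> x" using \<open>x \<notin> {a..b}\<close> ab by force
    then show ?thesis
    proof cases
      case 1
      then show ?thesis using eq[of x "-1"] z ab by (auto simp: \<phi>_def)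
    next
      case 2
      then show ?thesis using eq[of "-1" x] z ab by (auto simp: \<phi>_def)
    next
      case 3
      then show ?thesis using eq[of x 1] z ab F1 by (auto simp: \<phi>_def)
    next
      case 4
      then show ?thesis using eq[of 1 x] z ab F1 by (auto simp: \<phi>_def)
    qed
  qed
  then have "test_function_on \<phi> J"
    using ab by (intro test_functionI[OF smooth_antideriv[OF s d]]) auto
  moreover have "deriv \<phi> = \<psi>" by (intro ext DERIV_imp_deriv d)
  ultimately show thesis by (rule that)
qed

text \<open>Integrating |h| <= h^2 / (2 \<kappa>) + \<kappa> / 2 over an interval of length 2 gives
  at most \<kappa> + \<kappa>.\<close>

lemma abs_integral_le_of_square:
  fixes h :: "real \<Rightarrow> real"
  assumes h: "continuous_on {-1..1} h" and le: "integral {-1..1} (\<lambda>x. (h x)\<^sup>2) \<le> 2 * \<kappa>\<^sup>2"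
    and "\<kappa> > 0" "x \<in> {-1..1}"
  shows "\<bar>integral {-1..x} h\<bar> \<le> 2 * \<kappa>"
proof -
  have i: "(\<lambda>x. \<bar>h x\<bar>) integrable_on {-1..1}" "(\<lambda>x. (h x)\<^sup>2) integrable_on {-1..1}"
    by (intro integrable_continuous_interval continuous_intros h)+
  have ix: "(\<lambda>x. \<bar>h x\<bar>) integrable_on {-1..x}" "h integrable_on {-1..x}"
    using assms(4) by (auto intro!: integrable_continuous_interval continuous_intros continuous_on_subset[OF h])
  have "\<bar>integral {-1..x} h\<bar> \<le> integral {-1..x} (\<lambda>x. \<bar>h x\<bar>)"
    using integral_norm_bound_integral[OF ix(2,1)] by simp
  also have "\<dots> \<le> integral {-1..1} (\<lambda>x. \<bar>h x\<bar>)"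
    using assms(4) by (intro integral_subset_le ix i) auto
  also have "\<dots> \<le> integral {-1..1} (\<lambda>x. (h x)\<^sup>2 * (1 / (2 * \<kappa>)) + \<kappa> / 2)"
  proof (rule integral_le[OF i(1)])
    show "(\<lambda>x. (h x)\<^sup>2 * (1 / (2 * \<kappa>)) + \<kappa> / 2) integrable_on {-1..1}"
      by (intro integrable_continuous_interval continuous_intros h)
    fix x
    have "0 \<le> (\<bar>h x\<bar> - \<kappa>)\<^sup>2" by simp
    then show "\<bar>h x\<bar> \<le> (h x)\<^sup>2 * (1 / (2 * \<kappa>)) + \<kappa> / 2"
      using \<open>\<kappa> > 0\<close> by (simp add: power2_diff field_simps power2_eq_square)
  qed
  also have "\<dots> = integral {-1..1} (\<lambda>x. (h x)\<^sup>2) * (1 / (2 * \<kappa>)) + \<kappa>"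
    using has_integral_add[OF has_integral_mult_left[OF integrable_integral[OF i(2)], of "1 / (2 * \<kappa>)"]
        has_integral_const_real[of "\<kappa> / 2" "-1" 1]] by (simp add: integral_unique)
  also have "\<dots> \<le> 2 * \<kappa>\<^sup>2 * (1 / (2 * \<kappa>)) + \<kappa>"
    using le \<open>\<kappa> > 0\<close> by (intro add_right_mono mult_right_mono) auto
  also have "\<dots> = 2 * \<kappa>" using \<open>\<kappa> > 0\<close> by (simp add: power2_eq_square)
  finally show ?thesis .
qed

lemma measure_J: "measure (lebesgue_on J) J = 2"
  using continuous_integrable_J(2)[of "\<lambda>x. 1"] by simp

text \<open>A polynomial near U' is multiplied by a cutoff, and a multiple of a fixed bump restores
  mean zero so that \<open>test_function_antideriv\<close> applies. The multiple is small because U'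
  itself has mean zero by the boundary values. Closeness of the derivatives gives closeness of the
  functions by integrating from -1.\<close>

lemma test_function_approx:
  assumes U: "continuous_on {-1..1} U" and U': "continuous_on {-1..1} U'"
    and d: "\<And>x. x \<in> J \<Longrightarrow> (U has_field_derivative U' x) (at x)"
    and bc: "U (-1) = 0" "U 1 = 0" and \<kappa>: "\<kappa> > 0"
  obtains \<phi> where "test_function_on \<phi> J" "(LINT x|lebesgue_on J. (U' x - deriv \<phi> x)\<^sup>2) \<le> 8 * \<kappa>\<^sup>2"
    "(LINT x|lebesgue_on J. (U x - \<phi> x)\<^sup>2) \<le> 8 * \<kappa>\<^sup>2"
proof -
  define \<theta> where "\<theta> = bump (-1/2) (1/2) 1"
  have \<theta>s: "smooth \<theta>" and \<theta>b: "\<And>x. 0 \<le> \<theta> x" "\<And>x. \<theta> x \<le> 1"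
    and \<theta>z: "\<And>x. x \<notin> {-1/2<..<1/2} \<Longrightarrow> \<theta> x = 0"
    unfolding \<theta>_def by (rule smooth_bump, rule bump_bounds, rule bump_bounds, rule bump_outside)
  have \<theta>c: "continuous_on {-1..1} \<theta>" by (rule smooth_continuous[OF \<theta>s])
  define m where "m = integral {-1..1} \<theta>"
  have "m \<noteq> 0"
  proof
    assume "m = 0"
    then have "\<theta> 0 = 0" using integral_eq_0_iff[OF \<theta>c] \<theta>b unfolding m_def by force
    then show False by (simp add: \<theta>_def bump_def exp_bump_def)
  qed
  \<comment> \<open>A \<eta>^2 = 3 (2 \<eta>^2 + 2 (4 \<eta>^2 / m^2)): the errors of the polynomial
    approximation and of the mean correction, in the limit where the cutoff error is gone.\<close>
  define A where "A = 6 + 24 / m\<^sup>2"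
  have A: "A > 0" unfolding A_def by (intro add_pos_nonneg) auto
  define \<eta> where "\<eta> = \<kappa> / sqrt A"
  have \<eta>: "\<eta> > 0" "A * \<eta>\<^sup>2 = \<kappa>\<^sup>2"
    using A \<kappa> by (auto simp: \<eta>_def power_divide)
  obtain q where qp: "real_polynomial_function q" and q: "\<And>x. x \<in> {-1..1} \<Longrightarrow> \<bar>U' x - q x\<bar> < \<eta>"
    using Stone_Weierstrass_real_polynomial_function[OF compact_Icc U' \<eta>(1)] by metis
  have qs: "smooth q"
    using qp by (auto simp: real_polynomial_function_iff_sum
        intro!: smooth_sum smooth_mult smooth_const smooth_power smooth_ident)
  have qc: "continuous_on {-1..1} q" by (rule smooth_continuous[OF qs])
  have \<chi>c: "continuous_on {-1..1} (cutoff n)" for n by (rule smooth_continuous[OF smooth_cutoff])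
  \<comment> \<open>The mean that has to be removed from the cut-off polynomial; its limit
    \<open>c0\<close> is the mean of q and of size at most 2 \<eta>.\<close>
  define c where "c n = (LINT x|lebesgue_on J. q x * cutoff n x)" for n
  define c0 where "c0 = (LINT x|lebesgue_on J. q x)"
  have "\<bar>c0\<bar> \<le> 2 * \<eta>"
  proof -
    have "(U' has_integral U 1 - U (-1)) {-1..1}"
      by (rule fundamental_theorem_of_calculus_interior)
        (use U d in \<open>auto simp: has_real_derivative_iff_has_vector_derivative\<close>)
    then have "(LINT x|lebesgue_on J. U' x) = 0"
      using bc by (simp add: continuous_integrable_J[OF U'] integral_unique)
    then have "c0 = (LINT x|lebesgue_on J. q x - U' x)"
      using Bochner_Integration.integral_diff[OF continuous_integrable_J(1)[OF qc] continuous_integrable_J(1)[OF U']]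
      by (simp add: c0_def)
    also have "\<bar>\<dots>\<bar> \<le> (LINT x|lebesgue_on J. \<eta>)"
    proof (rule integral_abs_bound_integral)
      show "integrable (lebesgue_on J) (\<lambda>x. q x - U' x)" "integrable (lebesgue_on J) (\<lambda>x. \<eta>)"
        by (intro continuous_integrable_J continuous_intros qc U')+
      show "\<bar>q x - U' x\<bar> \<le> \<eta>" if "x \<in> space (lebesgue_on J)" for x
        using q[of x] that by auto
    qed
    finally show ?thesis by (simp add: measure_J)
  qed
  then have c0: "c0\<^sup>2 \<le> 4 * \<eta>\<^sup>2"
    using power_mono[of "\<bar>c0\<bar>" "2 * \<eta>" 2] by (simp add: power_mult_distrib)
  define A1 where "A1 = (LINT x|lebesgue_on J. (U' x - q x)\<^sup>2)"
  define R where "R n = (LINT x|lebesgue_on J. (q x * (1 - cutoff n x))\<^sup>2)" for n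
  have "A1 \<le> (LINT x|lebesgue_on J. \<eta>\<^sup>2)"
    unfolding A1_def
  proof (rule Bochner_Integration.integral_mono)
    show "integrable (lebesgue_on J) (\<lambda>x. (U' x - q x)\<^sup>2)" "integrable (lebesgue_on J) (\<lambda>x. \<eta>\<^sup>2)"
      by (intro continuous_integrable_J continuous_intros qc U')+
    show "(U' x - q x)\<^sup>2 \<le> \<eta>\<^sup>2" if "x \<in> space (lebesgue_on J)" for x
      using power_mono[OF less_imp_le[OF q[of x]], of 2] that by simp
  qed
  then have A1: "A1 \<le> 2 * \<eta>\<^sup>2" by (simp add: measure_J)
  have "3 * (A1 + 0 + 2 * (c0 / m)\<^sup>2) \<le> 3 * (2 * \<eta>\<^sup>2 + 0 + 2 * (4 * \<eta>\<^sup>2 / m\<^sup>2))"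
    using A1 c0 by (intro mult_left_mono add_mono) (auto simp: power_divide intro!: divide_right_mono)
  also have "\<dots> = A * \<eta>\<^sup>2" by (simp add: A_def algebra_simps)
  also have "\<dots> < 2 * \<kappa>\<^sup>2" using \<eta> \<kappa> by simp
  finally have less: "3 * (A1 + 0 + 2 * (c0 / m)\<^sup>2) < 2 * \<kappa>\<^sup>2" .
  have "(\<lambda>n. 3 * (A1 + R n + 2 * (c n / m)\<^sup>2)) \<longlonglongrightarrow> 3 * (A1 + 0 + 2 * (c0 / m)\<^sup>2)"
    unfolding R_def c_def c0_def using \<open>m \<noteq> 0\<close> by (intro tendsto_intros integral_cutoff_tendsto qc)
  from order_tendstoD(2)[OF this less] obtain n where n: "3 * (A1 + R n + 2 * (c n / m)\<^sup>2) < 2 * \<kappa>\<^sup>2"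
    by (auto simp: eventually_sequentially)
  define \<psi> where "\<psi> x = q x * cutoff n x + (- (c n / m)) * \<theta> x" for x
  have \<psi>s: "smooth \<psi>"
    unfolding \<psi>_def by (intro smooth_add smooth_mult smooth_const qs \<theta>s smooth_cutoff)
  have \<psi>c: "continuous_on {-1..1} \<psi>" by (rule smooth_continuous[OF \<psi>s])
  \<comment> \<open>[a, b] contains the supports of both the cutoff and the fixed bump.\<close>
  define a where "a = min (-1 + 1 / real (n + 2)) (-1/2)"
  define b where "b = max (1 - 1 / real (n + 2)) (1/2)"
  have ab: "-1 < a" "b < 1" by (auto simp: a_def b_def)
  have "a \<le> -1/2" "1/2 \<le> b" by (auto simp: a_def b_def)
  then have "a \<le> b" by linarith
  have "\<psi> x = 0" if "x \<notin> {a..b}" for x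
  proof -
    have "a \<le> -1 + 1 / real (n + 2)" "a \<le> -1/2" "1 - 1 / real (n + 2) \<le> b" "1/2 \<le> b"
      by (auto simp: a_def b_def)
    moreover have "x < a \<or> b < x" using that by auto
    ultimately have "x \<notin> {-1 + 1 / real (n + 2)<..<1 - 1 / real (n + 2)}" "x \<notin> {-1/2<..<1/2}"
      by (auto simp del: of_nat_add)
    then show ?thesis using cutoff_outside[of x n] \<theta>z[of x] by (simp only: \<psi>_def) simp
  qed
  moreover have "integral {-1..1} \<psi> = 0"
  proof -
    have i: "(\<lambda>x. q x * cutoff n x) integrable_on {-1..1}" "\<theta> integrable_on {-1..1}"
      by (intro integrable_continuous_interval continuous_intros qc \<chi>c \<theta>c)+
    have "c n = integral {-1..1} (\<lambda>x. q x * cutoff n x)"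
      unfolding c_def by (intro continuous_integrable_J continuous_intros qc \<chi>c)
    then have "(\<psi> has_integral c n + (- (c n / m)) * m) {-1..1}"
      unfolding \<psi>_def m_def using i
      by (intro has_integral_add has_integral_mult_right integrable_integral) (auto intro: integrable_integral)
    then show ?thesis using \<open>m \<noteq> 0\<close> by (simp add: integral_unique)
  qed
  ultimately obtain \<phi> where \<phi>: "test_function_on \<phi> J" "deriv \<phi> = \<psi>"
    using test_function_antideriv[OF \<psi>s ab(1) \<open>a \<le> b\<close> ab(2)] by metis
  obtain a' b' where \<phi>s: "smooth \<phi>" and "-1 < a'" "\<And>x. x \<notin> {a'..b'} \<Longrightarrow> \<phi> x = 0"
    using test_functionE[OF \<phi>(1)] by metis
  then have \<phi>0: "\<phi> (-1) = 0" by simp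
  have h: "continuous_on {-1..1} (\<lambda>x. U' x - \<psi> x)"
    by (intro continuous_intros U' \<psi>c)
  have sq3: "(x + y + z)\<^sup>2 \<le> 3 * (x\<^sup>2 + y\<^sup>2 + z\<^sup>2)" for x y z :: real
    using sum_squares_bound[of x y] sum_squares_bound[of y z] sum_squares_bound[of x z]
    by (simp add: power2_eq_square algebra_simps)
  have "(LINT x|lebesgue_on J. (U' x - \<psi> x)\<^sup>2)
      \<le> (LINT x|lebesgue_on J. 3 * ((U' x - q x)\<^sup>2 + (q x * (1 - cutoff n x))\<^sup>2 + (c n / m)\<^sup>2))"
  proof (rule Bochner_Integration.integral_mono)
    show "integrable (lebesgue_on J) (\<lambda>x. (U' x - \<psi> x)\<^sup>2)"
      "integrable (lebesgue_on J) (\<lambda>x. 3 * ((U' x - q x)\<^sup>2 + (q x * (1 - cutoff n x))\<^sup>2 + (c n / m)\<^sup>2))"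
      by (intro continuous_integrable_J continuous_intros qc U' \<psi>c \<chi>c \<open>m \<noteq> 0\<close>)+
    fix x
    have "U' x - \<psi> x = (U' x - q x) + q x * (1 - cutoff n x) + (c n / m) * \<theta> x"
      by (simp add: \<psi>_def algebra_simps)
    then have s: "(U' x - \<psi> x)\<^sup>2 \<le> 3 * ((U' x - q x)\<^sup>2 + (q x * (1 - cutoff n x))\<^sup>2 + ((c n / m) * \<theta> x)\<^sup>2)"
      using sq3 by metis
    have t: "((c n / m) * \<theta> x)\<^sup>2 \<le> (c n / m)\<^sup>2"
      unfolding power_mult_distrib using \<theta>b[of x] by (intro mult_left_le power_le_one) auto
    show "(U' x - \<psi> x)\<^sup>2 \<le> 3 * ((U' x - q x)\<^sup>2 + (q x * (1 - cutoff n x))\<^sup>2 + (c n / m)\<^sup>2)"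
      by (rule order_trans[OF s]) (intro mult_left_mono add_left_mono t, simp)
  qed
  also have "\<dots> = 3 * (A1 + R n + 2 * (c n / m)\<^sup>2)"
  proof -
    have "integrable (lebesgue_on J) (\<lambda>x. (U' x - q x)\<^sup>2)" "integrable (lebesgue_on J) (\<lambda>x. (q x * (1 - cutoff n x))\<^sup>2)"
      "integrable (lebesgue_on J) (\<lambda>x. (c n / m)\<^sup>2)"
      by (intro continuous_integrable_J continuous_intros qc U' \<chi>c \<open>m \<noteq> 0\<close>)+
    then show ?thesis by (simp add: A1_def R_def measure_J del: distrib_left_numeral)
  qed
  also have "\<dots> \<le> 2 * \<kappa>\<^sup>2" using n by simp
  finally have b1: "(LINT x|lebesgue_on J. (U' x - \<psi> x)\<^sup>2) \<le> 2 * \<kappa>\<^sup>2" .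
  then have b1': "integral {-1..1} (\<lambda>x. (U' x - \<psi> x)\<^sup>2) \<le> 2 * \<kappa>\<^sup>2"
    using continuous_integrable_J(2)[OF continuous_on_power[OF h]] by simp
  have "\<bar>U x - \<phi> x\<bar> \<le> 2 * \<kappa>" if x: "x \<in> {-1..1}" for x
  proof -
    have "((\<lambda>x. U' x - \<psi> x) has_integral (U x - \<phi> x) - (U (-1) - \<phi> (-1))) {-1..x}"
    proof (rule fundamental_theorem_of_calculus_interior)
      show "continuous_on {-1..x} (\<lambda>x. U x - \<phi> x)"
        using x by (intro continuous_intros smooth_continuous \<phi>s continuous_on_subset[OF U]) auto
      show "((\<lambda>x. U x - \<phi> x) has_vector_derivative U' y - \<psi> y) (at y)" if "y \<in> {-1<..<x}" for y
        unfolding has_real_derivative_iff_has_vector_derivative[symmetric] \<phi>(2)[symmetric]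
        using that x by (intro DERIV_diff d smooth_imp_has_deriv \<phi>s) auto
    qed (use x in auto)
    then have "U x - \<phi> x = integral {-1..x} (\<lambda>x. U' x - \<psi> x)"
      by (simp add: bc \<phi>0 integral_unique)
    then show ?thesis using abs_integral_le_of_square[OF h b1' \<kappa> x] by simp
  qed
  then have sq: "(U x - \<phi> x)\<^sup>2 \<le> 4 * \<kappa>\<^sup>2" if "x \<in> {-1..1}" for x
    using power_mono[of "\<bar>U x - \<phi> x\<bar>" "2 * \<kappa>" 2] that by (simp add: power_mult_distrib)
  have "(LINT x|lebesgue_on J. (U x - \<phi> x)\<^sup>2) \<le> (LINT x|lebesgue_on J. 4 * \<kappa>\<^sup>2)"
  proof (rule Bochner_Integration.integral_mono)
    show "integrable (lebesgue_on J) (\<lambda>x. (U x - \<phi> x)\<^sup>2)" "integrable (lebesgue_on J) (\<lambda>x. 4 * \<kappa>\<^sup>2)"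
      by (intro continuous_integrable_J continuous_intros U smooth_continuous \<phi>s)+
  qed (use sq in auto)
  then have "(LINT x|lebesgue_on J. (U x - \<phi> x)\<^sup>2) \<le> 8 * \<kappa>\<^sup>2" by (simp add: measure_J)
  moreover have "2 * \<kappa>\<^sup>2 \<le> 8 * \<kappa>\<^sup>2" by simp
  ultimately show thesis using b1 by (intro that[OF \<phi>(1)]) (auto simp: \<phi>(2) intro: order_trans)
qed

section \<open>Uniqueness of weak solutions\<close>

lemma classical_weak_deriv_square_integrable:
  assumes "has_weak_deriv_on U U' J" and "continuous_on {-1..1} U'"
  shows "square_integrable_on (weak_deriv J U) J"
proof (rule square_integrable_cong_AE(1)[OF continuous_square_integrable[OF assms(2)]])
  show "weak_deriv J U \<in> borel_measurable (lebesgue_on J)"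
    using weak_deriv_AE(2)[OF assms(1)] by (intro locally_integrable_measurable) (auto simp: has_weak_deriv_on_def)
  show "AE x in lebesgue_on J. U' x = weak_deriv J U x"
    using weak_deriv_AE(1)[OF assms(1)] by (auto elim: AE_mp)
qed

text \<open>\<open>weak_deriv\<close> picks some representative, so the distances to test functions
  are estimated with U' and then transferred almost everywhere.\<close>

lemma classical_in_H10:
  assumes U: "continuous_on {-1..1} U" and U': "continuous_on {-1..1} U'"
    and d: "\<And>x. x \<in> J \<Longrightarrow> (U has_field_derivative U' x) (at x)"
    and bc: "U (-1) = 0" "U 1 = 0"
  shows "U \<in> H10_on J"
proof -
  have w: "has_weak_deriv_on U U' J" by (rule classical_has_weak_deriv[OF U U' d])
  have s: "square_integrable_on (weak_deriv J U) J"
    by (rule classical_weak_deriv_square_integrable[OF w U'])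
  have H1: "U \<in> H1_on J"
    using w s continuous_square_integrable[OF U] by (auto simp: H1_on_def)
  define \<kappa> where "\<kappa> n = inverse (real (Suc n))" for n
  have \<kappa>: "\<kappa> n > 0" for n by (simp add: \<kappa>_def)
  have "\<forall>n. \<exists>\<phi>. test_function_on \<phi> J \<and> (LINT x|lebesgue_on J. (U' x - deriv \<phi> x)\<^sup>2) \<le> 8 * (\<kappa> n)\<^sup>2 \<and>
    (LINT x|lebesgue_on J. (U x - \<phi> x)\<^sup>2) \<le> 8 * (\<kappa> n)\<^sup>2"
    by (rule allI, rule test_function_approx[OF U U' d bc \<kappa>]) blast+
  from choice[OF this] obtain \<phi>
    where "\<forall>n. test_function_on (\<phi> n) J \<and> (LINT x|lebesgue_on J. (U' x - deriv (\<phi> n) x)\<^sup>2) \<le> 8 * (\<kappa> n)\<^sup>2 \<and>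
      (LINT x|lebesgue_on J. (U x - \<phi> n x)\<^sup>2) \<le> 8 * (\<kappa> n)\<^sup>2"
    by (elim exE)
  then have t: "\<And>n. test_function_on (\<phi> n) J"
    and b: "\<And>n. (LINT x|lebesgue_on J. (U' x - deriv (\<phi> n) x)\<^sup>2) \<le> 8 * (\<kappa> n)\<^sup>2"
      "\<And>n. (LINT x|lebesgue_on J. (U x - \<phi> n x)\<^sup>2) \<le> 8 * (\<kappa> n)\<^sup>2"
    by simp_all
  have sm: "smooth (\<phi> n)" for n using t by (auto simp: test_function_on_def smooth_def)
  have c: "continuous_on {-1..1} (\<phi> n)" "continuous_on {-1..1} (deriv (\<phi> n))" for n
    by (intro smooth_continuous smooth_deriv sm)+
  have lim0: "(\<lambda>n. ereal (sqrt (8 * (\<kappa> n)\<^sup>2))) \<longlonglongrightarrow> 0"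
  proof -
    have "(\<lambda>n. sqrt (8 * (\<kappa> n)\<^sup>2)) \<longlonglongrightarrow> sqrt (8 * 0\<^sup>2)"
      unfolding \<kappa>_def by (intro tendsto_intros LIMSEQ_inverse_real_of_nat)
    then have "(\<lambda>n. ereal (sqrt (8 * (\<kappa> n)\<^sup>2))) \<longlonglongrightarrow> ereal (sqrt (8 * 0\<^sup>2))"
      by (rule tendsto_ereal)
    then show ?thesis by (simp add: zero_ereal_def)
  qed
  have sq: "(\<lambda>n. L2_norm J (h n)) \<longlonglongrightarrow> 0"
    if "\<And>n. square_integrable_on (h n) J" "\<And>n. (LINT x|lebesgue_on J. (h n x)\<^sup>2) \<le> 8 * (\<kappa> n)\<^sup>2" for h
  proof (rule tendsto_sandwich[OF _ _ tendsto_const lim0])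
    show "\<forall>\<^sub>F n in sequentially. 0 \<le> L2_norm J (h n)"
      using that(1) by (simp add: L2_norm_def)
    show "\<forall>\<^sub>F n in sequentially. L2_norm J (h n) \<le> ereal (sqrt (8 * (\<kappa> n)\<^sup>2))"
      unfolding L2_norm_def using that by (simp del: real_sqrt_mult)
  qed
  have "(\<lambda>n. L2_norm J (\<lambda>x. U x - \<phi> n x)) \<longlonglongrightarrow> 0"
    by (rule sq) (intro continuous_square_integrable continuous_intros U c, rule b)
  moreover have "(\<lambda>n. L2_norm J (\<lambda>x. weak_deriv J U x - deriv (\<phi> n) x)) \<longlonglongrightarrow> 0"
  proof (rule sq)
    fix n
    have s1: "square_integrable_on (\<lambda>x. U' x - deriv (\<phi> n) x) J"
      by (intro continuous_square_integrable continuous_intros U' c)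
    show s2: "square_integrable_on (\<lambda>x. weak_deriv J U x - deriv (\<phi> n) x) J"
      by (intro square_integrable_diff s continuous_square_integrable c)
    have "(LINT x|lebesgue_on J. (weak_deriv J U x - deriv (\<phi> n) x)\<^sup>2) = (LINT x|lebesgue_on J. (U' x - deriv (\<phi> n) x)\<^sup>2)"
      using s2 weak_deriv_AE(1)[OF w]
      by (intro square_integrable_cong_AE(2)[OF s1]) (auto simp: square_integrable_on_def)
    then show "(LINT x|lebesgue_on J. (weak_deriv J U x - deriv (\<phi> n) x)\<^sup>2) \<le> 8 * (\<kappa> n)\<^sup>2"
      using b(1) by simp
  qed
  ultimately show ?thesis using H1 t by (auto simp: H10_on_def)
qed

lemma H10D:
  assumes "v \<in> H10_on J"
  shows "square_integrable_on v J" "square_integrable_on (weak_deriv J v) J"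
    "has_weak_deriv_on v (weak_deriv J v) J"
  using assms weak_deriv_AE(2) by (auto simp: H10_on_def H1_on_def)

text \<open>For the test functions that approximate v this is integration by parts, and all the
  integrals are continuous under L^2 convergence of these functions and their derivatives.\<close>

lemma classical_solution_weak:
  assumes U: "continuous_on {-1..1} U" and U': "continuous_on {-1..1} U'" and U'': "continuous_on {-1..1} U''"
    and d': "\<And>x. x \<in> J \<Longrightarrow> (U' has_field_derivative U'' x) (at x)"
    and v: "v \<in> H10_on J"
  shows "(LINT x|lebesgue_on J. \<epsilon>\<^sup>2 * (U' x * weak_deriv J v x) + U x * v x)
    = (LINT x|lebesgue_on J. (U x - \<epsilon>\<^sup>2 * U'' x) * v x)"
proof -
  note H = H10D[OF v]
  define F where "F x = U x - \<epsilon>\<^sup>2 * U'' x" for x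
  have Fc: "continuous_on {-1..1} F" unfolding F_def by (intro continuous_intros U U'')
  note sq = continuous_square_integrable[OF U] continuous_square_integrable[OF U'] continuous_square_integrable[OF Fc]
  obtain \<phi> where t: "\<And>n. test_function_on (\<phi> n) J"
    and l0: "(\<lambda>n. L2_norm J (\<lambda>x. v x - \<phi> n x)) \<longlonglongrightarrow> 0"
    and l1: "(\<lambda>n. L2_norm J (\<lambda>x. weak_deriv J v x - deriv (\<phi> n) x)) \<longlonglongrightarrow> 0"
    using v by (auto simp: H10_on_def)
  note lim = L2_tendsto_imp_inner_tendsto
  have "(\<lambda>n. \<epsilon>\<^sup>2 * (LINT x|lebesgue_on J. U' x * deriv (\<phi> n) x) + (LINT x|lebesgue_on J. U x * \<phi> n x))
      \<longlonglongrightarrow> \<epsilon>\<^sup>2 * (LINT x|lebesgue_on J. U' x * weak_deriv J v x) + (LINT x|lebesgue_on J. U x * v x)"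
    by (intro tendsto_intros lim sq H l0 l1)
  moreover have "\<epsilon>\<^sup>2 * (LINT x|lebesgue_on J. U' x * deriv (\<phi> n) x) + (LINT x|lebesgue_on J. U x * \<phi> n x)
      = (LINT x|lebesgue_on J. F x * \<phi> n x)" for n
  proof -
    have "smooth (\<phi> n)" using t by (auto simp: test_function_on_def smooth_def)
    then have c: "continuous_on {-1..1} (\<phi> n)" by (rule smooth_continuous)
    have "(LINT x|lebesgue_on J. U' x * deriv (\<phi> n) x) = - (LINT x|lebesgue_on J. U'' x * \<phi> n x)"
      using classical_has_weak_deriv[OF U' U'' d'] t by (auto simp: has_weak_deriv_on_def)
    moreover have "integrable (lebesgue_on J) (\<lambda>x. U x * \<phi> n x)" "integrable (lebesgue_on J) (\<lambda>x. \<epsilon>\<^sup>2 * (U'' x * \<phi> n x))"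
      by (intro continuous_integrable_J continuous_intros U U'' c)+
    then have "(LINT x|lebesgue_on J. U x * \<phi> n x - \<epsilon>\<^sup>2 * (U'' x * \<phi> n x))
      = (LINT x|lebesgue_on J. U x * \<phi> n x) - \<epsilon>\<^sup>2 * (LINT x|lebesgue_on J. U'' x * \<phi> n x)"
      by simp
    ultimately show ?thesis by (simp add: F_def left_diff_distrib mult.assoc)
  qed
  moreover have "(\<lambda>n. LINT x|lebesgue_on J. F x * \<phi> n x) \<longlonglongrightarrow> (LINT x|lebesgue_on J. F x * v x)"
    by (intro lim sq H l0)
  ultimately have "\<epsilon>\<^sup>2 * (LINT x|lebesgue_on J. U' x * weak_deriv J v x) + (LINT x|lebesgue_on J. U x * v x)
    = (LINT x|lebesgue_on J. F x * v x)"
    by (simp add: LIMSEQ_unique)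
  moreover have "(LINT x|lebesgue_on J. \<epsilon>\<^sup>2 * (U' x * weak_deriv J v x) + U x * v x)
     = \<epsilon>\<^sup>2 * (LINT x|lebesgue_on J. U' x * weak_deriv J v x) + (LINT x|lebesgue_on J. U x * v x)"
    using square_integrable_mult[OF sq(2) H(2)] square_integrable_mult[OF sq(1) H(1)] by simp
  ultimately show ?thesis by (simp add: F_def)
qed

text \<open>Testing the difference of the two weak formulations with \<open>u\<close> and with \<open>U\<close> shows that the
  energy of \<open>u - U\<close> vanishes.\<close>

lemma reaction_diffusion_solution_unique:
  assumes sol: "reaction_diffusion_solution J \<epsilon> b f u" and b: "\<And>x. x \<in> J \<Longrightarrow> b x = 1" and e: "\<epsilon> > 0"
    and U: "continuous_on {-1..1} U" and U': "continuous_on {-1..1} U'" and U'': "continuous_on {-1..1} U''"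
    and d: "\<And>x. x \<in> J \<Longrightarrow> (U has_field_derivative U' x) (at x)"
    and d': "\<And>x. x \<in> J \<Longrightarrow> (U' has_field_derivative U'' x) (at x)"
    and bc: "U (-1) = 0" "U 1 = 0" and ode: "\<And>x. x \<in> J \<Longrightarrow> U x - \<epsilon>\<^sup>2 * U'' x = f x"
  shows "AE x in lebesgue_on J. u x = U x" "AE x in lebesgue_on J. weak_deriv J u x = U' x"
proof -
  let ?D = "weak_deriv J"
  have Uh: "U \<in> H10_on J" by (rule classical_in_H10[OF U U' d bc])
  have uh: "u \<in> H10_on J" using sol by (simp add: reaction_diffusion_solution_def)
  note Hu = H10D[OF uh] and HU = H10D[OF Uh]
  have sU': "square_integrable_on U' J" by (rule continuous_square_integrable[OF U'])
  have dU: "AE x in lebesgue_on J. ?D U x = U' x"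
    by (rule weak_deriv_AE(1)[OF classical_has_weak_deriv[OF U U' d]])
  have i: "integrable (lebesgue_on J) (\<lambda>x. \<epsilon>\<^sup>2 * ((?D u x - U' x) * ?D v x) + (u x - U x) * v x)"
    and E: "(LINT x|lebesgue_on J. \<epsilon>\<^sup>2 * ((?D u x - U' x) * ?D v x) + (u x - U x) * v x) = 0"
    if v: "v \<in> H10_on J" for v
  proof -
    note Hv = H10D[OF v]
    have i1: "integrable (lebesgue_on J) (\<lambda>x. \<epsilon>\<^sup>2 * (?D u x * ?D v x) + u x * v x)"
      using square_integrable_mult[OF Hu(2) Hv(2)] square_integrable_mult[OF Hu(1) Hv(1)] by simp
    have i2: "integrable (lebesgue_on J) (\<lambda>x. \<epsilon>\<^sup>2 * (U' x * ?D v x) + U x * v x)"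
      using square_integrable_mult[OF sU' Hv(2)] square_integrable_mult[OF HU(1) Hv(1)] by simp
    have eq: "(\<epsilon>\<^sup>2 * (?D u x * ?D v x) + u x * v x) - (\<epsilon>\<^sup>2 * (U' x * ?D v x) + U x * v x)
        = \<epsilon>\<^sup>2 * ((?D u x - U' x) * ?D v x) + (u x - U x) * v x" for x
      by (simp add: algebra_simps)
    show "integrable (lebesgue_on J) (\<lambda>x. \<epsilon>\<^sup>2 * ((?D u x - U' x) * ?D v x) + (u x - U x) * v x)"
      using Bochner_Integration.integrable_diff[OF i1 i2] unfolding eq .
    have "(LINT x|lebesgue_on J. \<epsilon>\<^sup>2 * (?D u x * ?D v x) + u x * v x)
        = (LINT x|lebesgue_on J. \<epsilon>\<^sup>2 * ?D u x * ?D v x + b x * u x * v x)"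
      by (intro Bochner_Integration.integral_cong) (simp_all add: b)
    also have "\<dots> = (LINT x|lebesgue_on J. f x * v x)"
      using sol v by (simp add: reaction_diffusion_solution_def)
    also have "\<dots> = (LINT x|lebesgue_on J. (U x - \<epsilon>\<^sup>2 * U'' x) * v x)"
      by (intro Bochner_Integration.integral_cong) (simp_all add: ode)
    also have "\<dots> = (LINT x|lebesgue_on J. \<epsilon>\<^sup>2 * (U' x * ?D v x) + U x * v x)"
      by (rule classical_solution_weak[OF U U' U'' d' v, symmetric])
    finally show "(LINT x|lebesgue_on J. \<epsilon>\<^sup>2 * ((?D u x - U' x) * ?D v x) + (u x - U x) * v x) = 0"
      using Bochner_Integration.integral_diff[OF i1 i2] unfolding eq by simp
  qed
  \<comment> \<open>The energy density of u - U. Its integral is the form tested with u minus the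
    form tested with U, after replacing \<open>weak_deriv J U\<close> by U' almost
    everywhere.\<close>
  define W where "W x = \<epsilon>\<^sup>2 * (?D u x - U' x)\<^sup>2 + (u x - U x)\<^sup>2" for x
  have Wi: "integrable (lebesgue_on J) W"
    using square_integrable_diff[OF Hu(2) sU'] square_integrable_diff[OF Hu(1) HU(1)]
    unfolding W_def square_integrable_on_def by simp
  have "(LINT x|lebesgue_on J. W x) = (LINT x|lebesgue_on J. (\<epsilon>\<^sup>2 * ((?D u x - U' x) * ?D u x) + (u x - U x) * u x)
      - (\<epsilon>\<^sup>2 * ((?D u x - U' x) * ?D U x) + (u x - U x) * U x))"
  proof (rule integral_cong_AE)
    show "W \<in> borel_measurable (lebesgue_on J)" using Wi by simp
    show "(\<lambda>x. (\<epsilon>\<^sup>2 * ((?D u x - U' x) * ?D u x) + (u x - U x) * u x)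
      - (\<epsilon>\<^sup>2 * ((?D u x - U' x) * ?D U x) + (u x - U x) * U x)) \<in> borel_measurable (lebesgue_on J)"
      using i[OF uh] i[OF Uh] by simp
    show "AE x in lebesgue_on J. W x = (\<epsilon>\<^sup>2 * ((?D u x - U' x) * ?D u x) + (u x - U x) * u x)
      - (\<epsilon>\<^sup>2 * ((?D u x - U' x) * ?D U x) + (u x - U x) * U x)"
      using dU by (rule AE_mp) (auto simp: W_def power2_eq_square algebra_simps)
  qed
  also have "\<dots> = 0"
    using Bochner_Integration.integral_diff[OF i[OF uh] i[OF Uh]] by (simp add: E uh Uh)
  finally have "(LINT x|lebesgue_on J. W x) = 0" .
  moreover have "AE x in lebesgue_on J. 0 \<le> W x" by (simp add: W_def)
  ultimately have "AE x in lebesgue_on J. W x = 0"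
    using integral_nonneg_eq_0_iff_AE[OF Wi] by simp
  moreover have "u x = U x \<and> ?D u x = U' x" if "W x = 0" for x
    using that e by (simp add: W_def add_nonneg_eq_0_iff)
  ultimately have "AE x in lebesgue_on J. u x = U x \<and> ?D u x = U' x" by auto
  then show "AE x in lebesgue_on J. u x = U x" "AE x in lebesgue_on J. ?D u x = U' x" by auto
qed

section \<open>Analytic data\<close>

lemma power_series_has_deriv:
  fixes f :: "real \<Rightarrow> real"
  assumes s: "\<And>y. \<bar>y - x\<bar> < r \<Longrightarrow> (\<lambda>n. a n * (y - x) ^ n) sums f y" and y: "\<bar>y - x\<bar> < r"
  shows "(f has_field_derivative deriv f y) (at y)" and "(\<lambda>n. diffs a n * (y - x) ^ n) sums deriv f y"
proof -
  have sm: "summable (\<lambda>n. a n * z ^ n)" if "norm z < r" for z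
    using s[of "x + z"] that by (auto intro: sums_summable)
  have "((\<lambda>z. \<Sum>n. a n * z ^ n) has_field_derivative (\<Sum>n. diffs a n * (y - x) ^ n)) (at (y - x))"
    using y by (intro termdiffs_strong'[of r]) (auto intro: sm)
  then have "((\<lambda>y. \<Sum>n. a n * (y - x) ^ n) has_field_derivative (\<Sum>n. diffs a n * (y - x) ^ n) * 1) (at y)"
    by (rule DERIV_chain2) (auto intro!: derivative_eq_intros)
  then have "(f has_field_derivative (\<Sum>n. diffs a n * (y - x) ^ n) * 1) (at y)"
  proof (rule has_field_derivative_transform_within_open[where S = "ball x r"])
    show "(\<Sum>n. a n * (z - x) ^ n) = f z" if "z \<in> ball x r" for z
      using s[of z] that by (intro sums_unique[symmetric]) (auto simp: dist_real_def abs_minus_commute)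
  qed (use y in \<open>auto simp: dist_real_def abs_minus_commute\<close>)
  then have d: "(f has_field_derivative (\<Sum>n. diffs a n * (y - x) ^ n)) (at y)" by simp
  then have e: "deriv f y = (\<Sum>n. diffs a n * (y - x) ^ n)" by (rule DERIV_imp_deriv)
  show "(f has_field_derivative deriv f y) (at y)" using d e by simp
  have "summable (\<lambda>n. diffs a n * (y - x) ^ n)"
    by (rule termdiff_converges[of _ r]) (use y sm in auto)
  then show "(\<lambda>n. diffs a n * (y - x) ^ n) sums deriv f y"
    unfolding e by (rule summable_sums)
qed

text \<open>Termwise differentiation of a power series keeps its centre and its interval of
  convergence, so one radius around x serves all orders.\<close>

lemma real_analytic_has_derivs:
  assumes "real_analytic_on f {-1..1}" and x: "x \<in> J"
  shows "((deriv ^^ n) f has_field_derivative (deriv ^^ Suc n) f x) (at x)"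
proof -
  obtain a r where r: "r > 0" and s: "\<And>y. y \<in> {-1..1} \<Longrightarrow> \<bar>y - x\<bar> < r \<Longrightarrow> (\<lambda>n. a n * (y - x) ^ n) sums f y"
  proof -
    have "x \<in> {-1..1}" using x by simp
    with assms(1) obtain a r where "r > 0" "\<forall>y\<in>{-1..1}. \<bar>y - x\<bar> < r \<longrightarrow> (\<lambda>n. a n * (y - x) ^ n) sums f y"
      unfolding real_analytic_on_def by blast
    then show thesis by (intro that[of r a]) blast+
  qed
  \<comment> \<open>The expansion is known only at points of [-1, 1]; the smaller radius keeps a
    full neighbourhood of x inside.\<close>
  define R where "R = min r (1 - \<bar>x\<bar>)"
  have R: "R > 0" using r x by (auto simp: R_def)
  have "\<exists>a. \<forall>y. \<bar>y - x\<bar> < R \<longrightarrow> (\<lambda>k. a k * (y - x) ^ k) sums (deriv ^^ n) f y" for n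
  proof (induction n)
    case 0
    have "(\<lambda>n. a n * (y - x) ^ n) sums f y" if "\<bar>y - x\<bar> < R" for y
      using that by (intro s) (auto simp: R_def)
    then show ?case by auto
  next
    case (Suc n)
    then obtain a where "\<And>y. \<bar>y - x\<bar> < R \<Longrightarrow> (\<lambda>k. a k * (y - x) ^ k) sums (deriv ^^ n) f y" by blast
    from power_series_has_deriv(2)[OF this] show ?case by (intro exI[of _ "diffs a"]) simp
  qed
  then obtain a where a: "\<And>y. \<bar>y - x\<bar> < R \<Longrightarrow> (\<lambda>k. a k * (y - x) ^ k) sums (deriv ^^ n) f y" by blast
  show ?thesis using power_series_has_deriv(1)[of x R a "(deriv ^^ n) f" x, OF a] R by simp
qed

text \<open>A continuous function that exceeds c at one point exceeds it on an interval, which is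
  not a null set.\<close>

lemma Linf_norm_bound:
  assumes le: "Linf_norm J g \<le> ereal c" and c: "continuous_on J g" and x: "x \<in> J"
  shows "\<bar>g x\<bar> \<le> c"
proof (rule ccontr)
  assume n: "\<not> \<bar>g x\<bar> \<le> c"
  have "AE x in lebesgue_on J. ereal \<bar>g x\<bar> \<le> Linf_norm J g"
    unfolding Linf_norm_def by (rule esssup_AE)
  then have "AE x in lebesgue_on J. \<bar>g x\<bar> \<le> c"
    by eventually_elim (use le in \<open>auto dest: order_trans\<close>)
  then have "AE x in lebesgue. x \<in> J \<longrightarrow> \<bar>g x\<bar> \<le> c"
    by (simp add: AE_restrict_space_iff)
  then obtain N where N: "N \<in> null_sets lebesgue" "{x. \<not> (x \<in> J \<longrightarrow> \<bar>g x\<bar> \<le> c)} \<subseteq> N"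
    by (auto simp: eventually_ae_filter)
  let ?S = "{x \<in> J. \<bar>g x\<bar> > c}"
  have "open ?S"
    using continuous_open_preimage[OF continuous_on_rabs[OF c], of "{c<..}"]
    by (auto simp: vimage_def Int_def conj_commute)
  moreover have "x \<in> ?S" using n x by auto
  ultimately obtain e where e: "e > 0" "cball x e \<subseteq> ?S"
    by (meson open_contains_cball)
  have "negligible (cbox (x - e) (x + e))"
  proof (rule negligible_subset)
    show "negligible N" using N by (simp add: negligible_iff_null_sets)
    have "?S \<subseteq> N" using N(2) by auto
    then show "cbox (x - e) (x + e) \<subseteq> N" using e(2) by (simp add: cball_eq_atLeastAtMost)
  qed
  then have "box (x - e) (x + e) = {}" by (simp only: negligible_interval)
  then show False using e(1) by (simp add: box_real)
qed

text \<open>At the endpoints \<open>deriv\<close> would see values of f outside the interval, so it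
  is used only on \<open>J\<close>. There each derivative is Lipschitz because the next one is
  bounded, hence it extends continuously to the closure, and the bounds extend with it.\<close>

lemma analytic_derivs_extension:
  assumes an: "real_analytic_on f {-1..1}" 
    and le: "\<And>n. Linf_norm J ((deriv ^^ n) f) \<le> ereal (M n)"
  obtains F where "\<And>n. continuous_on {-1..1} (F n)"
    "\<And>n x. x \<in> J \<Longrightarrow> (F n has_field_derivative F (Suc n) x) (at x)"
    "\<And>n x. x \<in> {-1..1} \<Longrightarrow> \<bar>F n x\<bar> \<le> M n" "\<And>x. x \<in> J \<Longrightarrow> F 0 x = f x"
proof -
  let ?D = "\<lambda>n. (deriv ^^ n) f"
  have d: "(?D n has_field_derivative ?D (Suc n) x) (at x)" if "x \<in> J" for n x
    by (rule real_analytic_has_derivs[OF an that])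
  have b: "\<bar>?D n x\<bar> \<le> M n" if "x \<in> J" for n x
    using d by (intro Linf_norm_bound[OF le _ that]) (meson DERIV_isCont continuous_at_imp_continuous_on)
  have "\<forall>n. \<exists>g. continuous_on {-1..1} g \<and> (\<forall>x\<in>J. ?D n x = g x)"
  proof
    fix n
    have "0 \<le> M (Suc n)" using b[of 0 "Suc n"] by (force intro: order_trans[OF abs_ge_zero])
    then have "(M (Suc n))-lipschitz_on J (?D n)"
    proof (intro lipschitz_onI)
      fix x y assume xy: "x \<in> J" "y \<in> J"
      show "dist (?D n x) (?D n y) \<le> M (Suc n) * dist x y"
        unfolding dist_norm
      proof (rule field_differentiable_bound[of J _ "?D (Suc n)"])
        show "(?D n has_field_derivative ?D (Suc n) z) (at z within J)" if "z \<in> J" for z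
          using d[OF that] by (rule has_field_derivative_at_within)
        show "norm (?D (Suc n) z) \<le> M (Suc n)" if "z \<in> J" for z
          using b[OF that, of "Suc n"] by (simp only: real_norm_def)
      qed (use xy in auto)
    qed
    from lipschitz_on_uniformly_continuous[OF this] obtain g
      where g: "uniformly_continuous_on (closure J) g" "\<And>x. x \<in> J \<Longrightarrow> ?D n x = g x"
      by (rule uniformly_continuous_on_extension_on_closure) blast
    have "closure J = {-1..1}" by simp
    with uniformly_continuous_imp_continuous[OF g(1)] g(2) show "\<exists>g. continuous_on {-1..1} g \<and> (\<forall>x\<in>J. ?D n x = g x)"
      by (intro exI[of _ g]) simp
  qed
  from choice[OF this] obtain F
    where "\<forall>n. continuous_on {-1..1} (F n) \<and> (\<forall>x\<in>J. ?D n x = F n x)" ..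
  then have Fc: "\<And>n. continuous_on {-1..1} (F n)" and F: "\<And>n x. x \<in> J \<Longrightarrow> ?D n x = F n x"
    by blast+
  show thesis
  proof (rule that[of F])
    show "(F n has_field_derivative F (Suc n) x) (at x)" if "x \<in> J" for n x
    proof (rule has_field_derivative_transform_within_open[where S = J and f = "?D n"])
      show "(?D n has_field_derivative F (Suc n) x) (at x)"
        using d[OF that, of n] F[OF that, of "Suc n"] by (simp only:)
    qed (use F that in auto)
    show "\<bar>F n x\<bar> \<le> M n" if "x \<in> {-1..1}" for n x
    proof (rule continuous_le_on_closure[where S = J and f = "\<lambda>x. \<bar>F n x\<bar>"])
      show "continuous_on (closure J) (\<lambda>x. \<bar>F n x\<bar>)" by (simp add: Fc continuous_on_rabs)
    qed (use that b F in auto)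
    show "F 0 x = f x" if "x \<in> J" for x using F[OF that, of 0] by simp
  qed (rule Fc)
qed

section \<open>Polynomial approximation and polynomial particular solutions\<close>

text \<open>The antiderivative that vanishes at 0, the point where all expansions are
  anchored.\<close>

definition poly_antideriv :: "real poly \<Rightarrow> real poly" where
  "poly_antideriv p = (\<Sum>j\<le>degree p. monom (coeff p j / real (Suc j)) (Suc j))"

lemma pderiv_poly_antideriv: "pderiv (poly_antideriv p) = p"
proof -
  have "pderiv (poly_antideriv p) = (\<Sum>j\<le>degree p. pderiv (monom (coeff p j / real (Suc j)) (Suc j)))"
    unfolding poly_antideriv_def using higher_pderiv_sum[of 1] by simp
  also have "\<dots> = (\<Sum>j\<le>degree p. monom (coeff p j) j)"
    by (intro sum.cong) (auto simp: pderiv_monom simp del: of_nat_Suc)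
  finally show ?thesis by (simp add: poly_as_sum_of_monoms)
qed

lemma poly_antideriv_0: "poly (poly_antideriv p) 0 = 0"
  by (simp add: poly_antideriv_def poly_sum poly_monom)

lemma degree_poly_antideriv: "degree (poly_antideriv p) \<le> Suc (degree p)"
  unfolding poly_antideriv_def
  by (rule degree_sum_le) (auto intro: order_trans[OF degree_monom_le])

text \<open>From index 2 on the second derivatives are the Chebyshev polynomials; 1 and x supply
  value and slope at 0. So the coefficients of an approximation are f(0), f'(0) and the normalized
  Chebyshev coefficients of f''.\<close>

fun approx_basis :: "nat \<Rightarrow> real poly" where
  "approx_basis 0 = 1"
| "approx_basis (Suc 0) = [:0, 1:]"
| "approx_basis (Suc (Suc k)) = poly_antideriv (poly_antideriv (cheb k))"

lemma degree_approx_basis: "degree (approx_basis k) \<le> k"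
proof (cases k rule: approx_basis.cases)
  case (3 j)
  have "degree (approx_basis k) \<le> Suc (Suc (degree (cheb j)))"
    unfolding 3 approx_basis.simps by (meson Suc_le_mono degree_poly_antideriv order_trans)
  with degree_cheb[of j] 3 show ?thesis by simp
qed auto

text \<open>Mean value theorem between 0 and x; since |x| <= 1, integrating an error from 0 does not
  enlarge its bound.\<close>

lemma abs_le_if_deriv_le:
  fixes G g :: "real \<Rightarrow> real"
  assumes c: "continuous_on {-1..1} G" and d: "\<And>x. x \<in> J \<Longrightarrow> (G has_field_derivative g x) (at x)"
    and b: "\<And>x. x \<in> J \<Longrightarrow> \<bar>g x\<bar> \<le> \<delta>" and 0: "G 0 = 0" and x: "x \<in> {-1..1}"
  shows "\<bar>G x\<bar> \<le> \<delta>"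
proof -
  have \<delta>: "0 \<le> \<delta>" using b[of 0] by (force intro: order_trans[OF abs_ge_zero])
  have "\<exists>z\<in>J. \<bar>G x\<bar> = \<bar>x\<bar> * \<bar>g z\<bar>"
  proof (cases "x = 0")
    case True
    then show ?thesis using 0 by (intro bexI[of _ 0]) auto
  next
    case False
    define a where "a = min x 0"
    define b where "b = max x 0"
    have ab: "a < b" "-1 \<le> a" "b \<le> 1" using False x by (auto simp: a_def b_def)
    have "\<exists>l z. a < z \<and> z < b \<and> (G has_field_derivative l) (at z) \<and> G b - G a = (b - a) * l"
    proof (rule MVT[OF ab(1)])
      show "continuous_on {a..b} G" using ab by (intro continuous_on_subset[OF c]) auto
      show "G differentiable (at y)" if "a < y" "y < b" for y
        using d[of y] that ab by (auto simp: real_differentiable_def)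
    qed
    then obtain l z where z: "a < z" "z < b" "(G has_field_derivative l) (at z)" "G b - G a = (b - a) * l" by blast
    have zJ: "z \<in> J" using z ab by auto
    have "l = g z" by (rule DERIV_unique[OF z(3) d[OF zJ]])
    moreover have "\<bar>G b - G a\<bar> = \<bar>G x\<bar>" "\<bar>b - a\<bar> = \<bar>x\<bar>" using 0 by (auto simp: a_def b_def min_def max_def)
    ultimately show ?thesis using z(4) zJ by (intro bexI[of _ z]) (auto simp: abs_mult)
  qed
  then obtain z where "z \<in> J" "\<bar>G x\<bar> = \<bar>x\<bar> * \<bar>g z\<bar>" by blast
  moreover have "\<bar>x\<bar> * \<bar>g z\<bar> \<le> 1 * \<delta>" using b[OF \<open>z \<in> J\<close>] x by (intro mult_mono) auto
  ultimately show ?thesis by simp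
qed

definition approx_poly :: "(nat \<Rightarrow> real) \<Rightarrow> nat \<Rightarrow> real poly" where
  "approx_poly a p = (\<Sum>i\<le>p. Polynomial.smult (a i) (approx_basis i))"

text \<open>The Chebyshev sum approximates the second derivative, and the two lower orders follow by
  integrating from 0. The sequence \<open>a\<close> does not depend on p and is bounded by A; this
  single bound is what later separates f from the hidden layers.\<close>

lemma poly_approx_W2inf:
  fixes F :: "nat \<Rightarrow> real \<Rightarrow> real"
  assumes F: "\<And>n. continuous_on {-1..1} (F n)"
    and d: "\<And>n x. x \<in> J \<Longrightarrow> (F n has_field_derivative F (Suc n) x) (at x)"
    and M: "\<And>n x. x \<in> {-1..1} \<Longrightarrow> \<bar>F n x\<bar> \<le> C * K ^ n * fact n"
    and K: "K > 0"
  obtains A D r a where "0 < r" "r < 1" "0 \<le> A" "0 \<le> D" "\<And>i. \<bar>a i :: real\<bar> \<le> A"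
    "\<And>p x. 2 \<le> p \<Longrightarrow> x \<in> {-1..1} \<Longrightarrow> \<bar>F 0 x - poly (approx_poly a p) x\<bar> \<le> D * r ^ p \<and>
      \<bar>F 1 x - poly (pderiv (approx_poly a p)) x\<bar> \<le> D * r ^ p \<and>
      \<bar>F 2 x - poly (pderiv (pderiv (approx_poly a p))) x\<bar> \<le> D * r ^ p"
proof -
  have C0: "C \<ge> 0" using M[of 0 0] by auto
  \<comment> \<open>From (n+2)! <= 2 * 4^n n! the derivatives of \<open>F 2\<close> obey a bound of
    the same form with 4 K and 2 C K^2; the maximum with 1 meets the hypothesis of
    \<open>cheb_coeff_decay\<close>.\<close>
  define K' where "K' = max 1 (4 * K)"
  define C' where "C' = 2 * C * K\<^sup>2"
  have K': "K' \<ge> 1" by (simp add: K'_def)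
  define r where "r = (1 / 2 :: real) powr (1 / (2 * K'))"
  have r: "0 < r" "r < 1"
  proof -
    show "0 < r" by (simp add: r_def)
    have "r < (1 / 2) powr 0" unfolding r_def using K' by (intro powr_less_mono') auto
    then show "r < 1" by simp
  qed
  define B where "B = 2 * pi * C'"
  have B0: "B \<ge> 0" using C0 by (simp add: B_def C'_def)
  have F2: "\<bar>F (n + 2) x\<bar> \<le> C' * K' ^ n * fact n" if x: "x \<in> {-1..1}" for n x
  proof -
    have "(real n + 2) * (real n + 1) \<le> 2 * 4 ^ n"
    proof (induction n)
      case (Suc n)
      have "(real (Suc n) + 2) * (real (Suc n) + 1) \<le> 4 * ((real n + 2) * (real n + 1))"
        by (simp add: algebra_simps)
      with Suc show ?case by simp
    qed simp
    then have "((real n + 2) * (real n + 1)) * fact n \<le> (2 * 4 ^ n) * (fact n :: real)"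
      by (rule mult_right_mono) simp
    moreover have "fact (n + 2) = ((real n + 2) * (real n + 1)) * (fact n :: real)"
      by (simp add: algebra_simps)
    ultimately have f: "fact (n + 2) \<le> (2 * 4 ^ n) * (fact n :: real)" by (simp only:)
    have "\<bar>F (n + 2) x\<bar> \<le> C * K ^ (n + 2) * fact (n + 2)" by (rule M[OF x])
    also have "\<dots> \<le> C * K ^ (n + 2) * ((2 * 4 ^ n) * fact n)"
      using f C0 K by (intro mult_left_mono) auto
    also have "\<dots> = C' * (4 * K) ^ n * fact n"
      by (simp add: C'_def power_add power_mult_distrib power2_eq_square)
    also have "\<dots> \<le> C' * K' ^ n * fact n"
      using C0 K by (intro mult_right_mono mult_left_mono power_mono) (auto simp: C'_def K'_def)
    finally show ?thesis .
  qed
  have cb: "\<bar>cheb_coeff (F 2) k\<bar> \<le> B * r ^ k" for k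
    using cheb_coeff_decay[of "\<lambda>n. F (n + 2)" C' K' k, OF F _ F2 K'] d
    by (simp add: B_def r_def numeral_2_eq_2)
  define w where "w k = (if k = 0 then 1 / pi else 2 / pi) * cheb_coeff (F 2) k" for k
  have wb: "\<bar>w k\<bar> \<le> B" for k
  proof -
    have "\<bar>w k\<bar> \<le> 1 * \<bar>cheb_coeff (F 2) k\<bar>"
      unfolding w_def abs_mult using pi_ge_two by (intro mult_right_mono) auto
    also have "\<dots> \<le> B * r ^ k" using cb by simp
    also have "\<dots> \<le> B * 1" using r B0 by (intro mult_left_mono power_le_one) auto
    finally show ?thesis by simp
  qed
  define a where "a i = (case i of 0 \<Rightarrow> F 0 0 | Suc j \<Rightarrow> (case j of 0 \<Rightarrow> F 1 0 | Suc k \<Rightarrow> w k))" for i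
  define A where "A = \<bar>F 0 0\<bar> + \<bar>F 1 0\<bar> + B"
  have aA: "\<bar>a i\<bar> \<le> A" for i
    using wb B0 by (auto simp: a_def A_def split: nat.splits intro: add_increasing)
  \<comment> \<open>The extra 1/r: up to degree p only the first p - 1 Chebyshev terms fit, so the
    series error is of order r^(p-1).\<close>
  define D where "D = B / (1 - r) / r"
  have D0: "D \<ge> 0" using B0 r by (simp add: D_def)
  have ap: "approx_poly a (n + 1) = [:F 0 0:] + Polynomial.smult (F 1 0) [:0, 1:]
      + (\<Sum>k<n. Polynomial.smult (w k) (poly_antideriv (poly_antideriv (cheb k))))" for n
    by (induction n) (simp_all add: approx_poly_def a_def one_pCons)
  have ap1: "pderiv (approx_poly a (n + 1)) = [:F 1 0:] + (\<Sum>k<n. Polynomial.smult (w k) (poly_antideriv (cheb k)))" for n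
    unfolding ap using higher_pderiv_sum[of 1 "\<lambda>k. Polynomial.smult (w k) (poly_antideriv (poly_antideriv (cheb k)))" "{..<n}"]
    by (simp add: pderiv_add pderiv_smult pderiv_pCons pderiv_poly_antideriv)
  have ap2: "pderiv (pderiv (approx_poly a (n + 1))) = (\<Sum>k<n. Polynomial.smult (w k) (cheb k))" for n
    unfolding ap1 using higher_pderiv_sum[of 1 "\<lambda>k. Polynomial.smult (w k) (poly_antideriv (cheb k))" "{..<n}"]
    by (simp add: pderiv_add pderiv_smult pderiv_pCons pderiv_poly_antideriv)
  show thesis
  proof (rule that[OF r _ D0 aA])
    show "0 \<le> A" using B0 by (simp add: A_def)
    fix p x assume p: "2 \<le> (p::nat)" and x: "(x::real) \<in> {-1..1}"
    obtain n where n: "p = n + 1" using p by (cases p) auto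
    let ?Q = "approx_poly a p"
    have e2: "\<bar>F 2 x - poly (pderiv (pderiv ?Q)) x\<bar> \<le> D * r ^ p" if "x \<in> {-1..1}" for x
    proof -
      have "\<bar>F 2 x - (\<Sum>k<n. w k * poly (cheb k) x)\<bar> \<le> B * r ^ n / (1 - r)"
        unfolding w_def by (rule cheb_series_error[OF F cb r that])
      moreover have "B * r ^ n / (1 - r) = D * r ^ p" using r by (simp add: D_def n)
      ultimately show ?thesis unfolding n ap2 by (simp add: poly_sum)
    qed
    have e1: "\<bar>F 1 x - poly (pderiv ?Q) x\<bar> \<le> D * r ^ p" if "x \<in> {-1..1}" for x
    proof (rule abs_le_if_deriv_le[OF _ _ _ _ that])
      show "continuous_on {-1..1} (\<lambda>x. F 1 x - poly (pderiv ?Q) x)" by (intro continuous_intros F)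
      show "((\<lambda>x. F 1 x - poly (pderiv ?Q) x) has_field_derivative F 2 x - poly (pderiv (pderiv ?Q)) x) (at x)"
        if "x \<in> J" for x using DERIV_diff[OF d[OF that, of 1] poly_DERIV] by (simp add: numeral_2_eq_2)
      show "F 1 0 - poly (pderiv ?Q) 0 = 0" unfolding n ap1 by (simp add: poly_sum poly_antideriv_0)
    qed (use e2 in auto)
    have e0: "\<bar>F 0 x - poly ?Q x\<bar> \<le> D * r ^ p" if "x \<in> {-1..1}" for x
    proof (rule abs_le_if_deriv_le[OF _ _ _ _ that])
      show "continuous_on {-1..1} (\<lambda>x. F 0 x - poly ?Q x)" by (intro continuous_intros F)
      show "((\<lambda>x. F 0 x - poly ?Q x) has_field_derivative F 1 x - poly (pderiv ?Q) x) (at x)"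
        if "x \<in> J" for x using DERIV_diff[OF d[OF that, of 0] poly_DERIV] by simp
      show "F 0 0 - poly ?Q 0 = 0" unfolding n ap by (simp add: poly_sum poly_antideriv_0)
    qed (use e1 in auto)
    show "\<bar>F 0 x - poly ?Q x\<bar> \<le> D * r ^ p \<and> \<bar>F 1 x - poly (pderiv ?Q) x\<bar> \<le> D * r ^ p \<and>
      \<bar>F 2 x - poly (pderiv (pderiv ?Q)) x\<bar> \<le> D * r ^ p"
      using e0 e1 e2 x by blast
  qed
qed

section \<open>Polynomial particular solutions\<close>

lemma smult_sum_right:
  fixes f :: "'b \<Rightarrow> real poly"
  shows "Polynomial.smult c (\<Sum>x\<in>A. f x) = (\<Sum>x\<in>A. Polynomial.smult c (f x))"
  by (rule poly_eqI) (simp add: coeff_sum sum_distrib_left)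

definition particular_solution :: "real \<Rightarrow> nat \<Rightarrow> real poly \<Rightarrow> real poly" where
  "particular_solution \<epsilon> p q = (\<Sum>i\<le>p. Polynomial.smult (\<epsilon> ^ (2 * i)) ((pderiv ^^ (2 * i)) q))"

lemma higher_pderiv_eq_0: "degree q < n \<Longrightarrow> (pderiv ^^ n) q = 0" for q :: "real poly"
proof (induction n arbitrary: q)
  case (Suc n)
  show ?case
  proof (cases "degree q = 0")
    case True
    then have "pderiv q = 0" by (simp add: pderiv_eq_0_iff)
    then show ?thesis by (simp add: funpow_Suc_right del: funpow.simps(2))
  next
    case False
    then have "degree (pderiv q) < n" using Suc.prems by (simp add: degree_pderiv)
    then show ?thesis using Suc.IH by (simp add: funpow_Suc_right del: funpow.simps(2))
  qed
qed simp

text \<open>The sum is the Neumann series for the inverse of 1 - \<epsilon>^2 D^2, finite on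
  polynomials. It telescopes, since \<epsilon>^2 times the second derivative of a summand is the
  next summand, and the last one involves 2 (p+1) derivatives, more than the degree.\<close>

lemma particular_solution_ode:
  assumes "degree q \<le> p"
  shows "particular_solution \<epsilon> p q - Polynomial.smult (\<epsilon>\<^sup>2) (pderiv (pderiv (particular_solution \<epsilon> p q))) = q"
proof -
  define h where "h i = Polynomial.smult (\<epsilon> ^ (2 * i)) ((pderiv ^^ (2 * i)) q)" for i
  have h2: "Polynomial.smult (\<epsilon>\<^sup>2) (pderiv (pderiv (h i))) = h (Suc i)" for i
    by (simp add: h_def pderiv_smult power2_eq_square mult_ac)
  have "Polynomial.smult (\<epsilon>\<^sup>2) (pderiv (pderiv (\<Sum>i\<le>p. h i))) = (\<Sum>i\<le>p. h (Suc i))"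
  proof -
    have "pderiv (pderiv (\<Sum>i\<le>p. h i)) = (\<Sum>i\<le>p. pderiv (pderiv (h i)))"
      using higher_pderiv_sum[of 2 h "{..p}"] by (simp add: numeral_2_eq_2)
    then show ?thesis by (simp only: smult_sum_right h2)
  qed
  then have "particular_solution \<epsilon> p q - Polynomial.smult (\<epsilon>\<^sup>2) (pderiv (pderiv (particular_solution \<epsilon> p q)))
      = (\<Sum>i\<le>p. h i - h (Suc i))"
    by (simp add: particular_solution_def sum_subtractf flip: h_def)
  also have "\<dots> = h 0 - h (Suc p)" by (rule sum_telescope)
  also have "h (Suc p) = 0" using assms by (simp add: h_def higher_pderiv_eq_0 del: funpow.simps)
  finally show ?thesis by (simp add: h_def)
qed

lemma degree_higher_pderiv: "degree ((pderiv ^^ n) q) \<le> degree q" for q :: "real poly"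
  by (induction n) (auto simp: degree_pderiv)

lemma degree_particular_solution: "degree q \<le> p \<Longrightarrow> degree (particular_solution \<epsilon> p q) \<le> p"
  unfolding particular_solution_def
  by (intro degree_sum_le) (auto intro: order_trans[OF degree_smult_le] order_trans[OF degree_higher_pderiv])

lemma higher_pderiv_smult: "(pderiv ^^ n) (Polynomial.smult c q) = Polynomial.smult c ((pderiv ^^ n) q)" for q :: "real poly"
  by (induction n) (auto simp: pderiv_smult)

lemma particular_solution_approx_poly:
  "particular_solution \<epsilon> p (approx_poly a p) = (\<Sum>i\<le>p. Polynomial.smult (a i) (particular_solution \<epsilon> p (approx_basis i)))"
  unfolding particular_solution_def approx_poly_def higher_pderiv_sum smult_sum_right higher_pderiv_smult
  by (subst sum.swap) (simp add: mult.commute)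

text \<open>Involves p and \<epsilon> but not f: by linearity the coefficients of a particular
  solution are bounded by this weight times a bound for the expansion coefficients.\<close>

definition basis_weight :: "real \<Rightarrow> nat \<Rightarrow> real" where
  "basis_weight \<epsilon> p = (\<Sum>i\<le>p. \<Sum>j\<le>p. \<bar>coeff (particular_solution \<epsilon> p (approx_basis i)) j\<bar>)"

lemma sum_coeff_particular_solution_le:
  assumes "\<And>i. \<bar>a i\<bar> \<le> A"
  shows "(\<Sum>j\<le>p. \<bar>coeff (particular_solution \<epsilon> p (approx_poly a p)) j\<bar>) \<le> A * basis_weight \<epsilon> p"
proof -
  let ?c = "\<lambda>i j. coeff (particular_solution \<epsilon> p (approx_basis i)) j"
  have "(\<Sum>j\<le>p. \<bar>coeff (particular_solution \<epsilon> p (approx_poly a p)) j\<bar>) \<le> (\<Sum>j\<le>p. \<Sum>i\<le>p. A * \<bar>?c i j\<bar>)"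
    unfolding particular_solution_approx_poly coeff_sum coeff_smult
    by (intro sum_mono order_trans[OF sum_abs]) (auto simp: abs_mult intro!: mult_right_mono assms)
  also have "\<dots> = A * basis_weight \<epsilon> p"
    unfolding basis_weight_def sum_distrib_left by (rule sum.swap)
  finally show ?thesis .
qed

lemma basis_weight_nonneg: "0 \<le> basis_weight \<epsilon> p"
  by (auto simp: basis_weight_def intro!: sum_nonneg)

section \<open>Tanh networks for polynomials and exponentials\<close>

text \<open>The zero bias keeps the cost of such a layer at one nonzero entry at most.\<close>

definition scalar_layer :: "real \<Rightarrow> layer" where
  "scalar_layer w = (mat 1 1 (\<lambda>_. w), vec 1 (\<lambda>_. 0))"

text \<open>The output layer is kept apart because it alone may depend on f.\<close>

definition hidden_net :: "nat \<Rightarrow> real \<Rightarrow> nat \<Rightarrow> (nat \<Rightarrow> real) \<Rightarrow> (nat \<Rightarrow> real) \<Rightarrow> layer list" where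
  "hidden_net k d m w t = replicate k (scalar_layer d) @ [(mat m 1 (\<lambda>(i, j). w i), vec m t)]"

definition output_layer :: "nat \<Rightarrow> (nat \<Rightarrow> real) \<Rightarrow> real \<Rightarrow> layer" where
  "output_layer m c c0 = (mat 1 m (\<lambda>(i, j). c j), vec 1 (\<lambda>_. c0))"

lemma realization_scalar_layers:
  "\<Phi> \<noteq> [] \<Longrightarrow> realization \<rho> (replicate k (scalar_layer d) @ \<Phi>) (vec 1 (\<lambda>_. x))
    = realization \<rho> \<Phi> (vec 1 (\<lambda>_. ((\<lambda>x. \<rho> (d * x)) ^^ k) x))"
proof (induction k arbitrary: x)
  case (Suc k)
  have 1: "map_vec \<rho> (fst (scalar_layer d) *\<^sub>v vec 1 (\<lambda>_. x) + snd (scalar_layer d)) = vec 1 (\<lambda>_. \<rho> (d * x))"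
    by (rule eq_vecI) (auto simp: scalar_layer_def scalar_prod_def)
  have 2: "realization \<rho> (L # \<Psi>) y = realization \<rho> \<Psi> (map_vec \<rho> (fst L *\<^sub>v y + snd L))" if "\<Psi> \<noteq> []" for L \<Psi> y
    using that by (cases L; cases \<Psi>) auto
  have "realization \<rho> (replicate (Suc k) (scalar_layer d) @ \<Phi>) (vec 1 (\<lambda>_. x))
      = realization \<rho> (replicate k (scalar_layer d) @ \<Phi>) (vec 1 (\<lambda>_. \<rho> (d * x)))"
    using Suc.prems by (simp add: 2 1[simplified])
  then show ?case using Suc by (simp add: funpow_Suc_right del: funpow.simps(2))
qed simp

lemma tanh_realization_hidden_output:
  "tanh_realization (hidden_net k d m w t @ [output_layer m c c0]) x
    = (\<Sum>i<m. c i * tanh (w i * ((\<lambda>x. tanh (d * x)) ^^ k) x + t i)) + c0"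
proof -
  have v: "vec_of_list [x] = vec 1 (\<lambda>_. x)"
    by (rule eq_vecI) (auto simp: less_Suc_eq)
  show ?thesis
    unfolding tanh_realization_def v hidden_net_def append_assoc
    by (subst realization_scalar_layers)
      (auto simp: output_layer_def scalar_prod_def lessThan_atLeast0)
qed

section \<open>Size and well-formedness of the networks\<close>

lemma nnz_mat_le: "nnz_mat A \<le> dim_row A * dim_col A"
proof -
  have "nnz_mat A \<le> card ({..<dim_row A} \<times> {..<dim_col A})"
    unfolding nnz_mat_def by (rule card_mono) auto
  then show ?thesis by simp
qed

lemma nnz_vec_le: "nnz_vec b \<le> dim_vec b"
proof -
  have "nnz_vec b \<le> card {..<dim_vec b}"
    unfolding nnz_vec_def by (rule card_mono) auto
  then show ?thesis by simp
qed

lemma nnz_vec_zero: "nnz_vec (vec n (\<lambda>_. 0)) = 0"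
proof -
  have "{i. i < dim_vec (vec n (\<lambda>_. 0 :: real)) \<and> vec n (\<lambda>_. 0 :: real) $ i \<noteq> 0} = {}" by auto
  then show ?thesis unfolding nnz_vec_def by (simp only: card.empty)
qed

lemma network_size_hidden_output:
  "network_size (hidden_net k d m w t @ [output_layer m c c0]) \<le> k + 3 * m + 1"
proof -
  let ?s = "\<lambda>(A, b). nnz_mat A + nnz_vec b"
  have "nnz_vec (vec 1 (\<lambda>_. 0)) = 0" by (rule nnz_vec_zero)
  then have 1: "?s (scalar_layer d) \<le> 1"
    using nnz_mat_le[of "mat 1 1 (\<lambda>_. d)"] by (simp add: scalar_layer_def)
  have 2: "?s (mat m 1 (\<lambda>(i, j). w i), vec m t) \<le> 2 * m"
    using nnz_mat_le[of "mat m 1 (\<lambda>(i, j). w i)"] nnz_vec_le[of "vec m t"] by simp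
  have 3: "?s (output_layer m c c0) \<le> m + 1"
    using nnz_mat_le[of "mat 1 m (\<lambda>(i, j). c j)"] nnz_vec_le[of "vec 1 (\<lambda>_. c0)"] by (simp add: output_layer_def)
  have "network_size (hidden_net k d m w t @ [output_layer m c c0])
      = k * ?s (scalar_layer d) + ?s (mat m 1 (\<lambda>(i, j). w i), vec m t) + ?s (output_layer m c c0)"
    by (simp add: network_size_def hidden_net_def sum_list_replicate)
  also have "\<dots> \<le> k * 1 + 2 * m + (m + 1)"
    by (intro add_mono mult_left_mono 1 2 3) simp
  finally show ?thesis by simp
qed

lemma is_network_hidden_output:
  assumes "m \<ge> 1"
  shows "is_network 1 1 (hidden_net k d m w t @ [output_layer m c c0])"
  unfolding is_network_def
proof (intro conjI exI[of _ "\<lambda>l. if l = k + 1 then m else 1"] allI impI)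
  let ?\<Phi> = "hidden_net k d m w t @ [output_layer m c c0]"
  fix l assume "l < length ?\<Phi>"
  then consider "l < k" | "l = k" | "l = k + 1" by (force simp: hidden_net_def)
  then have "?\<Phi> ! l = (if l < k then scalar_layer d else if l = k then (mat m 1 (\<lambda>(i, j). w i), vec m t) else output_layer m c c0)"
    by cases (auto simp: hidden_net_def nth_append)
  then show "fst (?\<Phi> ! l) \<in> carrier_mat (if Suc l = k + 1 then m else 1) (if l = k + 1 then m else 1)"
    "snd (?\<Phi> ! l) \<in> carrier_vec (if Suc l = k + 1 then m else 1)"
    using \<open>l < length ?\<Phi>\<close> by (auto simp: scalar_layer_def output_layer_def hidden_net_def)
qed (use assms in \<open>auto simp: hidden_net_def\<close>)

lemma abs_tanh_le: "\<bar>tanh x\<bar> \<le> \<bar>x\<bar>" for x :: real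
proof -
  have "\<exists>D. ((\<lambda>x. x - tanh x) has_field_derivative D) (at y) \<and> D \<ge> 0" for y :: real
  proof (intro exI conjI)
    show "((\<lambda>x. x - tanh x) has_field_derivative tanh y ^ 2) (at y)"
      by (auto intro!: derivative_eq_intros)
  qed simp
  then have m: "a - tanh a \<le> b - tanh b" if "a \<le> b" for a b :: real
    using DERIV_nonneg_imp_nondecreasing[OF that, of "\<lambda>x. x - tanh x"] by blast
  show ?thesis
  proof (cases "x \<ge> 0")
    case True
    then show ?thesis using m[of 0 x] by simp
  next
    case False
    then show ?thesis using m[of x 0] by simp
  qed
qed

text \<open>Each layer contributes a factor d (1 - tanh^2) with tanh^2 <= d^2. Pulling out d^k
  leaves a factor D that is close to 1 for small d. The induction also carries that the iterates map
  [-1, 1] into itself, on which the bound for tanh rests.\<close>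

lemma tanh_iterate_deriv:
  fixes d :: real
  assumes d: "0 < d" "d < 1"
  obtains D where "continuous_on UNIV D"
    "\<And>x. (((\<lambda>x. tanh (d * x)) ^^ k) has_field_derivative d ^ k * D x) (at x)"
    "\<And>x. \<bar>x\<bar> \<le> 1 \<Longrightarrow> (1 - d\<^sup>2) ^ k \<le> D x \<and> D x \<le> 1"
proof -
  let ?f = "\<lambda>x. tanh (d * x)"
  have "\<exists>D. continuous_on UNIV D \<and> (\<forall>x. ((?f ^^ k) has_field_derivative d ^ k * D x) (at x)) \<and>
    (\<forall>x. \<bar>x\<bar> \<le> 1 \<longrightarrow> (1 - d\<^sup>2) ^ k \<le> D x \<and> D x \<le> 1 \<and> \<bar>(?f ^^ k) x\<bar> \<le> 1)"
  proof (induction k)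
    case 0
    show ?case by (rule exI[of _ "\<lambda>x. 1"]) auto
  next
    case (Suc k)
    then obtain D where c: "continuous_on UNIV D"
      and D: "\<And>x. ((?f ^^ k) has_field_derivative d ^ k * D x) (at x)"
      and b: "\<And>x. \<bar>x\<bar> \<le> 1 \<Longrightarrow> (1 - d\<^sup>2) ^ k \<le> D x \<and> D x \<le> 1 \<and> \<bar>(?f ^^ k) x\<bar> \<le> 1"
      by blast
    let ?g = "?f ^^ k"
    let ?D = "\<lambda>x. (1 - (tanh (d * ?g x))\<^sup>2) * D x"
    have g: "continuous_on UNIV ?g"
      using D by (meson DERIV_isCont continuous_at_imp_continuous_on)
    have "continuous_on UNIV ?D"
      by (intro continuous_intros c g) (auto simp: less_imp_neq[OF cosh_real_pos, symmetric])
    moreover have "((?f ^^ Suc k) has_field_derivative d ^ Suc k * ?D x) (at x)" for x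
    proof -
      have "((\<lambda>x. tanh (d * ?g x)) has_field_derivative (1 - (tanh (d * ?g x))\<^sup>2) * (d * (d ^ k * D x))) (at x)"
        by (rule DERIV_chain2[where f = tanh]) (auto intro!: derivative_eq_intros D)
      moreover have "?f ^^ Suc k = (\<lambda>x. tanh (d * ?g x))" by (simp add: o_def)
      ultimately show ?thesis by (simp only: power_Suc mult_ac)
    qed
    moreover have "(1 - d\<^sup>2) ^ Suc k \<le> ?D x \<and> ?D x \<le> 1 \<and> \<bar>(?f ^^ Suc k) x\<bar> \<le> 1" if x: "\<bar>x\<bar> \<le> 1" for x
    proof -
      have bx: "(1 - d\<^sup>2) ^ k \<le> D x" "D x \<le> 1" "\<bar>?g x\<bar> \<le> 1" using b[OF x] by auto
      have "\<bar>tanh (d * ?g x)\<bar> \<le> d * \<bar>?g x\<bar>"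
        using abs_tanh_le[of "d * ?g x"] d by (simp add: abs_mult)
      also have "\<dots> \<le> d" using bx d by (simp add: mult_left_le)
      finally have t: "\<bar>tanh (d * ?g x)\<bar> \<le> d" .
      then have t2: "(tanh (d * ?g x))\<^sup>2 \<le> d\<^sup>2"
        using power_mono[OF t, of 2] by simp
      have d2: "d\<^sup>2 \<le> 1" using d by (simp add: power_le_one)
      have "0 \<le> (1 - d\<^sup>2) ^ k" using d2 by simp
      then have D0: "0 \<le> D x" using bx(1) by simp
      have "(1 - d\<^sup>2) * (1 - d\<^sup>2) ^ k \<le> ?D x"
        using t2 d2 bx \<open>0 \<le> (1 - d\<^sup>2) ^ k\<close> by (intro mult_mono) auto
      moreover have "?D x \<le> 1" using t2 d2 D0 bx(2) by (intro mult_le_one) auto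
      ultimately show ?thesis using t d by simp
    qed
    ultimately show ?case by blast
  qed
  then show thesis using that by blast
qed

section \<open>C^1 approximation of sums of exponentials\<close>

lemma abs_exp_diff_le:
  fixes a b :: real
  assumes "\<bar>a\<bar> \<le> M" "\<bar>b\<bar> \<le> M"
  shows "\<bar>exp a - exp b\<bar> \<le> exp M * \<bar>a - b\<bar>"
proof -
  have "exp a - exp b \<le> exp M * (a - b)" if "b \<le> a" "\<bar>a\<bar> \<le> M" for a b :: real
  proof -
    have "1 - exp (b - a) \<le> a - b" using exp_ge_add_one_self[of "b - a"] by linarith
    then have "exp a * (1 - exp (b - a)) \<le> exp a * (a - b)" by simp
    also have "\<dots> \<le> exp M * (a - b)" using that by (intro mult_right_mono) auto
    finally show ?thesis by (simp add: right_diff_distrib flip: exp_add)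
  qed
  from this[of a b] this[of b a] assms show ?thesis
    by (cases "b \<le> a") (auto simp: abs_if not_le)
qed

text \<open>For large \<open>s\<close>, the left tail \<open>exp (2 s) (1 + tanh (y / 2 - s)) / 2 = exp y / (1 + exp (y - 2 s))\<close>
  of a single neuron is close to \<open>exp y\<close>.\<close>

definition exp_neuron :: "real \<Rightarrow> real \<Rightarrow> real" where
  "exp_neuron s y = exp (2 * s) / 2 * (1 + tanh (y / 2 - s))"

lemma exp_neuron_eq: "exp_neuron s y = exp y / (1 + exp (y - 2 * s))"
proof -
  have e: "exp (- 2 * (y / 2 - s)) = exp (2 * s) / exp y"
    by (simp add: algebra_simps exp_diff)
  have pos: "exp y + exp (2 * s) > 0" by (simp add: add_pos_pos)
  have "1 - exp (2 * s) / exp y = (exp y - exp (2 * s)) / exp y" "1 + exp (2 * s) / exp y = (exp y + exp (2 * s)) / exp y"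
    by (simp_all add: field_simps)
  then have "tanh (y / 2 - s) = (exp y - exp (2 * s)) / (exp y + exp (2 * s))"
    unfolding tanh_real_altdef e by simp
  then have "1 + tanh (y / 2 - s) = 2 * exp y / (exp y + exp (2 * s))"
    using pos by (simp add: field_simps)
  moreover have "1 + exp (y - 2 * s) = (exp y + exp (2 * s)) / exp (2 * s)"
    by (simp add: exp_diff field_simps)
  ultimately show ?thesis by (simp add: exp_neuron_def)
qed

lemma exp_neuron_deriv:
  "(exp_neuron s has_field_derivative exp y / (1 + exp (y - 2 * s))\<^sup>2) (at y)"
proof -
  have pos: "1 + exp (y - 2 * s) \<noteq> 0" by (simp add: add_pos_pos less_imp_neq[symmetric])
  have "((\<lambda>y. exp y / (1 + exp (y - 2 * s))) has_field_derivative exp y / (1 + exp (y - 2 * s))\<^sup>2) (at y)"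
    using pos by (auto intro!: derivative_eq_intros simp: field_simps power2_eq_square)
  then show ?thesis by (simp add: exp_neuron_eq[abs_def])
qed

text \<open>With a = exp(y - 2 s) the relative errors are 1 - 1/(1+a) <= a and 1 - 1/(1+a)^2 <= 2 a,
  and exp(y) a = exp(2 y - 2 s).\<close>

lemma exp_neuron_bounds:
  assumes "\<bar>y\<bar> \<le> M"
  shows "\<bar>exp_neuron s y - exp y\<bar> \<le> exp (2 * M - 2 * s)"
    and "\<bar>exp y / (1 + exp (y - 2 * s))\<^sup>2 - exp y\<bar> \<le> 2 * exp (2 * M - 2 * s)"
proof -
  define a where "a = exp (y - 2 * s)"
  have a: "a > 0" by (simp add: a_def)
  have ya: "exp y * a \<le> exp (2 * M - 2 * s)"
    using assms by (simp add: a_def flip: exp_add)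
  have "exp y - exp y / (1 + a) = exp y * (a / (1 + a))" using a by (simp add: field_simps)
  moreover have "0 \<le> a / (1 + a)" "a / (1 + a) \<le> a" using a by (auto simp: field_simps)
  then have "exp y * (a / (1 + a)) \<le> exp y * a" "0 \<le> exp y * (a / (1 + a))"
    by (intro mult_left_mono mult_nonneg_nonneg; simp)+
  ultimately have "\<bar>exp y - exp y / (1 + a)\<bar> \<le> exp y * a"
    by (simp only: abs_of_nonneg)
  then show "\<bar>exp_neuron s y - exp y\<bar> \<le> exp (2 * M - 2 * s)"
    using ya unfolding exp_neuron_eq a_def[symmetric] by (simp add: abs_minus_commute)
  have "1 - 1 / (1 + a)\<^sup>2 \<le> 2 * a" "0 \<le> 1 - 1 / (1 + a)\<^sup>2"
  proof -
    define q where "q = 1 / (1 + a)"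
    have q: "0 \<le> q" "q \<le> 1" "1 - q \<le> a" using a by (auto simp: q_def field_simps)
    have "1 - q\<^sup>2 = (1 - q) * (1 + q)" by (simp add: power2_eq_square algebra_simps)
    also have "\<dots> \<le> a * 2" using q a by (intro mult_mono) auto
    finally show "1 - 1 / (1 + a)\<^sup>2 \<le> 2 * a" by (simp add: q_def power_divide mult.commute)
    show "0 \<le> 1 - 1 / (1 + a)\<^sup>2" using power_le_one[OF q(1,2), of 2] by (simp add: q_def power_divide)
  qed
  then have "\<bar>exp y * (1 - 1 / (1 + a)\<^sup>2)\<bar> \<le> exp y * (2 * a)"
    unfolding abs_mult by (intro mult_mono) auto
  then show "\<bar>exp y / (1 + exp (y - 2 * s))\<^sup>2 - exp y\<bar> \<le> 2 * exp (2 * M - 2 * s)"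
    using ya unfolding a_def[symmetric] by (simp add: right_diff_distrib abs_minus_commute)
qed

text \<open>z is the value that the narrow layers deliver in place of x, and D is its derivative.
  The errors of the neuron, of the slope and of the argument are separated by inserting exp(l
  z).\<close>

lemma exp_neuron_network_bounds:
  assumes L: "\<bar>l\<bar> \<le> L" and x: "\<bar>x\<bar> \<le> 1" and z: "\<bar>z\<bar> \<le> 1" "\<bar>z - x\<bar> \<le> \<tau>"
    and D: "1 - \<tau> \<le> D" "D \<le> 1" "0 \<le> D" and s: "exp (2 * L - 2 * s) \<le> \<tau>"
  shows "\<bar>exp_neuron s (l * z) - exp (l * x)\<bar> \<le> (1 + exp L * L) * \<tau>"
    and "\<bar>exp (l * z) / (1 + exp (l * z - 2 * s))\<^sup>2 * (l * D) - l * exp (l * x)\<bar> \<le> L * (2 + exp L + exp L * L) * \<tau>"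
proof -
  have L0: "L \<ge> 0" using L by simp
  have "\<tau> \<ge> 0" using z(2) by (meson abs_ge_zero order_trans)
  have lz: "\<bar>l * z\<bar> \<le> L" "\<bar>l * x\<bar> \<le> L"
    using mult_mono[OF L z(1)] mult_mono[OF L x] L0 by (auto simp: abs_mult)
  have "\<bar>l * z - l * x\<bar> \<le> L * \<tau>"
    unfolding right_diff_distrib[symmetric] abs_mult using L z L0 by (intro mult_mono) auto
  then have e: "\<bar>exp (l * z) - exp (l * x)\<bar> \<le> exp L * (L * \<tau>)"
    by (intro order_trans[OF abs_exp_diff_le[OF lz]] mult_left_mono) auto
  define E where "E = exp (l * z) / (1 + exp (l * z - 2 * s))\<^sup>2"
  have 1: "\<bar>exp_neuron s (l * z) - exp (l * z)\<bar> \<le> \<tau>" and 2: "\<bar>E - exp (l * z)\<bar> \<le> 2 * \<tau>"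
    using exp_neuron_bounds[OF lz(1), of s] s unfolding E_def by linarith+
  have "\<bar>exp_neuron s (l * z) - exp (l * x)\<bar> \<le> \<tau> + exp L * (L * \<tau>)"
    using abs_triangle_ineq[of "exp_neuron s (l * z) - exp (l * z)" "exp (l * z) - exp (l * x)"] 1 e by simp
  then show "\<bar>exp_neuron s (l * z) - exp (l * x)\<bar> \<le> (1 + exp L * L) * \<tau>"
    by (simp add: algebra_simps)
  have a: "\<bar>(E - exp (l * z)) * D\<bar> \<le> 2 * \<tau>"
    unfolding abs_mult using mult_mono[OF 2, of "\<bar>D\<bar>" 1] D \<open>\<tau> \<ge> 0\<close> by simp
  have b: "\<bar>exp (l * z) * (D - 1)\<bar> \<le> exp L * \<tau>"
    unfolding abs_mult using D lz by (intro mult_mono) (auto simp: abs_le_iff)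
  have eq: "E * (l * D) - l * exp (l * x)
      = l * ((E - exp (l * z)) * D + exp (l * z) * (D - 1) + (exp (l * z) - exp (l * x)))"
    by (simp add: algebra_simps)
  have "\<bar>(E - exp (l * z)) * D + exp (l * z) * (D - 1) + (exp (l * z) - exp (l * x))\<bar>
      \<le> 2 * \<tau> + exp L * \<tau> + exp L * (L * \<tau>)"
    by (intro order_trans[OF abs_triangle_ineq] add_mono a b e)
  then have "\<bar>E * (l * D) - l * exp (l * x)\<bar> \<le> L * (2 * \<tau> + exp L * \<tau> + exp L * (L * \<tau>))"
    unfolding eq abs_mult using L L0 by (intro mult_mono) auto
  then show "\<bar>exp (l * z) / (1 + exp (l * z - 2 * s))\<^sup>2 * (l * D) - l * exp (l * x)\<bar> \<le> L * (2 + exp L + exp L * L) * \<tau>"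
    by (simp add: E_def algebra_simps)
qed

definition network_shape :: "layer list \<Rightarrow> nat \<Rightarrow> nat \<Rightarrow> network \<Rightarrow> bool" where
  "network_shape hid k n \<Phi> \<longleftrightarrow>
    is_network 1 1 \<Phi> \<and> hidden_layers \<Phi> = hid \<and> network_depth \<Phi> = k + 2 \<and> network_size \<Phi> \<le> n"

text \<open>The derivative is exhibited as a continuous function because it later has to serve as
  the weak derivative of the realization.\<close>

definition C1_approximates :: "network \<Rightarrow> real \<Rightarrow> (real \<Rightarrow> real) \<Rightarrow> (real \<Rightarrow> real) \<Rightarrow> bool" where
  "C1_approximates \<Phi> c g g' \<longleftrightarrow> (\<exists>R'. continuous_on UNIV R' \<and>
    (\<forall>x. (tanh_realization \<Phi> has_field_derivative R' x) (at x)) \<and>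
    (\<forall>x. \<bar>x\<bar> \<le> 1 \<longrightarrow> \<bar>tanh_realization \<Phi> x - g x\<bar> \<le> c \<and> \<bar>R' x - g' x\<bar> \<le> c))"

text \<open>The hidden layers are fixed before the coefficients c: each wide neuron approximates one
  exponential uniformly in C^1, and c enters only through the output layer. Hence the error is
  proportional to the sum of the |c i|.\<close>

lemma tanh_network_exponential_sum:
  fixes l :: "nat \<Rightarrow> real"
  assumes m: "m \<ge> 1" and \<eta>: "\<eta> > 0"
  shows "\<exists>hid. \<forall>c. \<exists>\<Phi>. network_shape hid k (k + 3 * m + 1) \<Phi> \<and>
    C1_approximates \<Phi> (\<eta> * (\<Sum>i<m. \<bar>c i\<bar>)) (\<lambda>x. \<Sum>i<m. c i * exp (l i * x)) (\<lambda>x. \<Sum>i<m. c i * (l i * exp (l i * x)))"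
proof -
  define L where "L = (\<Sum>i<m. \<bar>l i\<bar>)"
  have L: "\<bar>l i\<bar> \<le> L" if "i < m" for i
    unfolding L_def using that by (intro member_le_sum) auto
  have L0: "L \<ge> 0" by (auto simp: L_def intro: sum_nonneg)
  define B where "B = (1 + exp L * L) + L * (2 + exp L + exp L * L)"
  have B: "B \<ge> 1" using L0 by (auto simp: B_def intro!: add_increasing2 mult_nonneg_nonneg add_nonneg_nonneg)
  define \<tau> where "\<tau> = \<eta> / B"
  have \<tau>: "\<tau> > 0" using \<eta> B by (simp add: \<tau>_def)
  have B1: "(1 + exp L * L) * \<tau> \<le> \<eta>" "L * (2 + exp L + exp L * L) * \<tau> \<le> \<eta>"
  proof -
    have "(1 + exp L * L) * \<tau> \<le> B * \<tau>" "L * (2 + exp L + exp L * L) * \<tau> \<le> B * \<tau>"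
      using \<tau> L0 by (auto simp: B_def intro!: mult_right_mono mult_nonneg_nonneg add_nonneg_nonneg)
    moreover have "B * \<tau> = \<eta>" using B by (simp add: \<tau>_def)
    ultimately show "(1 + exp L * L) * \<tau> \<le> \<eta>" "L * (2 + exp L + exp L * L) * \<tau> \<le> \<eta>" by simp_all
  qed
  \<comment> \<open>The shift for which the tail error exp(2 L - 2 s) equals \<tau>.\<close>
  define s where "s = L - ln \<tau> / 2"
  have s: "exp (2 * L - 2 * s) \<le> \<tau>" using \<tau> by (simp add: s_def algebra_simps)
  \<comment> \<open>Makes k d^2 <= \<tau>, so that (1 - d^2)^k >= 1 - \<tau> by Bernoulli; k + 1
    keeps d positive for k = 0.\<close>
  define d where "d = min (1 / 2) (sqrt (\<tau> / (k + 1)))"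
  have d: "0 < d" "d < 1" using \<tau> by (auto simp: d_def)
  have "d\<^sup>2 \<le> (sqrt (\<tau> / (k + 1)))\<^sup>2" using d by (intro power_mono) (auto simp: d_def)
  then have "d\<^sup>2 \<le> \<tau> / (k + 1)" using \<tau> by simp
  then have "(real k + 1) * d\<^sup>2 \<le> \<tau>" by (simp add: field_simps)
  then have kd: "real k * d\<^sup>2 \<le> \<tau>" by (rule order_trans[rotated]) (simp add: algebra_simps)
  have d2: "d\<^sup>2 \<le> 1" using d by (simp add: power_le_one)
  have dk: "1 - \<tau> \<le> (1 - d\<^sup>2) ^ k"
    using Bernoulli_inequality[of "- d\<^sup>2" k] d2 kd by simp
  have dk0: "0 \<le> (1 - d\<^sup>2) ^ k" using d2 by simp
  let ?g = "(\<lambda>x. tanh (d * x)) ^^ k"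
  obtain D where Dc: "continuous_on UNIV D"
    and D: "\<And>x. (?g has_field_derivative d ^ k * D x) (at x)"
    and Db: "\<And>x. \<bar>x\<bar> \<le> 1 \<Longrightarrow> (1 - d\<^sup>2) ^ k \<le> D x \<and> D x \<le> 1"
    using tanh_iterate_deriv[OF d, of k] by metis
  \<comment> \<open>Undoes the contraction by d^k; in the network this division sits in the weights
    of the wide layer.\<close>
  define z where "z x = ?g x / d ^ k" for x
  have zd: "(z has_field_derivative D x) (at x)" for x
    using DERIV_cdivide[OF D, of "d ^ k" x] d by (simp add: z_def[abs_def])
  have zc: "continuous_on S z" for S
    using zd by (meson DERIV_isCont continuous_at_imp_continuous_on)
  have g0: "?g 0 = 0" by (induction k) auto
  have zb: "\<bar>z x\<bar> \<le> 1 \<and> \<bar>z x - x\<bar> \<le> \<tau>" if x: "\<bar>x\<bar> \<le> 1" for x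
  proof (cases "x = 0")
    case True
    then show ?thesis using g0 \<tau> by (simp add: z_def)
  next
    case False
    have "\<exists>y. \<bar>y\<bar> \<le> 1 \<and> z x = x * D y"
    proof (cases "x > 0")
      case True
      obtain y where "0 < y" "y < x" "z x - z 0 = (x - 0) * D y"
        using MVT2[OF True, of z D] zd by blast
      then show ?thesis using x g0 by (intro exI[of _ y]) (auto simp: z_def)
    next
      case neg: False
      obtain y where "x < y" "y < 0" "z 0 - z x = (0 - x) * D y"
        using MVT2[of x 0 z D] zd neg False by force
      then show ?thesis using x g0 by (intro exI[of _ y]) (auto simp: z_def)
    qed
    then obtain y where y: "\<bar>y\<bar> \<le> 1" "z x = x * D y" by blast
    have D1: "1 - \<tau> \<le> D y" "D y \<le> 1" "0 \<le> D y"
      using Db[OF y(1)] order_trans[OF dk] order_trans[OF dk0] by blast+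
    have "\<bar>x\<bar> * \<bar>D y\<bar> \<le> 1 * 1" using x D1 by (intro mult_mono) auto
    moreover have "\<bar>x\<bar> * \<bar>D y - 1\<bar> \<le> 1 * \<tau>" using x D1 by (intro mult_mono) auto
    ultimately show ?thesis using y(2) by (simp add: abs_mult right_diff_distrib flip: abs_mult)
  qed
  define hid where "hid = hidden_net k d m (\<lambda>i. l i / 2 / d ^ k) (\<lambda>i. - s)"
  show ?thesis
  proof (rule exI[of _ hid], rule allI)
    fix c :: "nat \<Rightarrow> real"
    \<comment> \<open>The output bias collects the summands 1 of 1 + tanh in
      \<open>exp_neuron\<close>.\<close>
    define \<Phi> where "\<Phi> = hid @ [output_layer m (\<lambda>i. c i * (exp (2 * s) / 2)) (\<Sum>i<m. c i * (exp (2 * s) / 2))]"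
    have R: "tanh_realization \<Phi> = (\<lambda>x. \<Sum>i<m. c i * exp_neuron s (l i * z x))"
      unfolding \<Phi>_def hid_def tanh_realization_hidden_output fun_eq_iff exp_neuron_def z_def
      by (simp add: algebra_simps sum.distrib)
    define E where "E y = exp y / (1 + exp (y - 2 * s))\<^sup>2" for y
    have Ec: "continuous_on S E" for S
      unfolding E_def by (intro continuous_intros) (simp add: add_pos_pos less_imp_neq[symmetric])
    define R' where "R' x = (\<Sum>i<m. c i * (E (l i * z x) * (l i * D x)))" for x
    have "(tanh_realization \<Phi> has_field_derivative R' x) (at x)" for x
      unfolding R R'_def E_def
      by (intro DERIV_sum DERIV_cmult DERIV_chain2[OF exp_neuron_deriv] zd)
    moreover have "continuous_on UNIV R'"
      unfolding R'_def by (intro continuous_intros Dc zc continuous_on_compose2[OF Ec[of UNIV]]) auto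
    moreover have "\<bar>tanh_realization \<Phi> x - (\<Sum>i<m. c i * exp (l i * x))\<bar> \<le> \<eta> * (\<Sum>i<m. \<bar>c i\<bar>) \<and>
        \<bar>R' x - (\<Sum>i<m. c i * (l i * exp (l i * x)))\<bar> \<le> \<eta> * (\<Sum>i<m. \<bar>c i\<bar>)" if x: "\<bar>x\<bar> \<le> 1" for x
    proof -
      have D1: "1 - \<tau> \<le> D x" "D x \<le> 1" "0 \<le> D x"
        using Db[OF x] order_trans[OF dk] order_trans[OF dk0] by blast+
      have b: "\<bar>exp_neuron s (l i * z x) - exp (l i * x)\<bar> \<le> \<eta>"
        "\<bar>E (l i * z x) * (l i * D x) - l i * exp (l i * x)\<bar> \<le> \<eta>" if "i < m" for i
        using exp_neuron_network_bounds[OF L[OF that] x _ _ D1 s, of "z x"] zb[OF x] B1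
        unfolding E_def by (auto intro: order_trans)
      have diff: "\<bar>(\<Sum>i<m. c i * a i) - (\<Sum>i<m. c i * b i)\<bar> \<le> \<eta> * (\<Sum>i<m. \<bar>c i\<bar>)"
        if "\<And>i. i < m \<Longrightarrow> \<bar>a i - b i\<bar> \<le> \<eta>" for a b :: "nat \<Rightarrow> real"
      proof -
        have "\<bar>\<Sum>i<m. c i * (a i - b i)\<bar> \<le> (\<Sum>i<m. \<bar>c i\<bar> * \<eta>)"
          by (rule order_trans[OF sum_abs sum_mono]) (auto simp: abs_mult intro!: mult_left_mono that)
        then show ?thesis by (simp add: right_diff_distrib sum_subtractf sum_distrib_left mult.commute)
      qed
      show ?thesis unfolding R R'_def by (intro conjI diff b)
    qed
    moreover have "is_network 1 1 \<Phi>" "network_size \<Phi> \<le> k + 3 * m + 1"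
      unfolding \<Phi>_def hid_def by (rule is_network_hidden_output[OF m], rule network_size_hidden_output)
    moreover have "hidden_layers \<Phi> = hid" "network_depth \<Phi> = k + 2"
      unfolding \<Phi>_def hidden_layers_def network_depth_def
      by (rule butlast_snoc, simp add: hid_def hidden_net_def)
    ultimately show "\<exists>\<Phi>. network_shape hid k (k + 3 * m + 1) \<Phi> \<and>
      C1_approximates \<Phi> (\<eta> * (\<Sum>i<m. \<bar>c i\<bar>)) (\<lambda>x. \<Sum>i<m. c i * exp (l i * x)) (\<lambda>x. \<Sum>i<m. c i * (l i * exp (l i * x)))"
      unfolding network_shape_def C1_approximates_def
      by (intro exI[of _ \<Phi>] exI[of _ R'] conjI allI impI) auto
  qed
qed

section \<open>From exponentials to monomials and universal hidden layers\<close>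

lemma power_diff_le:
  fixes x y :: real
  assumes "\<bar>x\<bar> \<le> 1" "\<bar>y\<bar> \<le> 2"
  shows "\<bar>y ^ j - x ^ j\<bar> \<le> 3 ^ j * \<bar>y - x\<bar>"
proof (induction j)
  case (Suc j)
  have "y ^ Suc j - x ^ Suc j = y * (y ^ j - x ^ j) + x ^ j * (y - x)" by (simp add: algebra_simps)
  then have "\<bar>y ^ Suc j - x ^ Suc j\<bar> \<le> \<bar>y\<bar> * \<bar>y ^ j - x ^ j\<bar> + \<bar>x ^ j\<bar> * \<bar>y - x\<bar>"
    by (metis abs_mult abs_triangle_ineq)
  also have "\<dots> \<le> 2 * (3 ^ j * \<bar>y - x\<bar>) + 3 ^ j * \<bar>y - x\<bar>"
  proof (intro add_mono mult_mono Suc assms)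
    have "\<bar>x\<bar> ^ j \<le> 1" using assms by (intro power_le_one) auto
    moreover have "(1::real) \<le> 3 ^ j" by simp
    ultimately show "\<bar>x ^ j\<bar> \<le> 3 ^ j" unfolding power_abs by linarith
  qed auto
  finally show ?case by (simp add: mult_ac)
qed simp

text \<open>The quotient y differs from x by at most h, and its derivative is exp(h x) = 1 + h y. So
  powers of y and their derivatives differ from those of x by multiples of h.\<close>

lemma exp_difference_quotient_power:
  fixes x h :: real
  assumes h: "0 < h" "h \<le> 1" and x: "\<bar>x\<bar> \<le> 1"
  defines "y \<equiv> (exp (h * x) - 1) / h"
  shows "\<bar>y ^ j - x ^ j\<bar> \<le> 3 ^ j * h"
    and "\<bar>real j * (y ^ (j - 1) * exp (h * x)) - real j * x ^ (j - 1)\<bar> \<le> 2 * real j * 3 ^ j * h"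
proof -
  have hx: "\<bar>h * x\<bar> \<le> 1" using h x mult_mono[of h 1 "\<bar>x\<bar>" 1] by (simp add: abs_mult)
  have "\<bar>exp (h * x) - 1 - h * x\<bar> \<le> (h * x)\<^sup>2"
  proof -
    have "1 + h * x \<le> exp (h * x)" by (rule exp_ge_add_one_self)
    moreover have "exp (h * x) \<le> 1 + h * x + (h * x)\<^sup>2"
    proof (cases "h * x \<ge> 0")
      case True
      then show ?thesis using exp_bound[of "h * x"] hx by simp
    next
      case False
      define t where "t = - (h * x)"
      have t: "t > 0" "t \<le> 1" using False hx by (auto simp: t_def)
      \<comment> \<open>The product is 1 + t^3.\<close>
      have "1 \<le> (1 - t + t\<^sup>2) * (1 + t)"
        using t by (simp add: algebra_simps power2_eq_square)
      also have "\<dots> \<le> (1 - t + t\<^sup>2) * exp t"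
        using t exp_ge_add_one_self[of t] by (intro mult_left_mono) auto
      finally have "exp (- t) \<le> 1 - t + t\<^sup>2" by (simp add: exp_minus field_simps)
      then show ?thesis by (simp add: t_def)
    qed
    ultimately show ?thesis by linarith
  qed
  also have "(h * x)\<^sup>2 = h * h * (x\<^sup>2)" by (simp add: power2_eq_square)
  also have "\<dots> \<le> h * h * 1" using x h by (intro mult_left_mono) (auto simp: abs_square_le_1)
  finally have "\<bar>(exp (h * x) - 1 - h * x) / h\<bar> \<le> h" using h by (simp add: abs_divide field_simps)
  then have yx: "\<bar>y - x\<bar> \<le> h" using h by (simp add: y_def diff_divide_distrib)
  then have y2: "\<bar>y\<bar> \<le> 2" using x h by linarith
  have p: "\<bar>y ^ j - x ^ j\<bar> \<le> 3 ^ j * h" for j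
    by (rule order_trans[OF power_diff_le[OF x y2]]) (use yx in auto)
  then show "\<bar>y ^ j - x ^ j\<bar> \<le> 3 ^ j * h" .
  have e: "exp (h * x) - 1 = h * y" using h by (simp add: y_def)
  have "\<bar>y ^ (j - 1) * (exp (h * x) - 1)\<bar> \<le> 3 ^ j * h" if "j > 0"
  proof -
    have "\<bar>y ^ (j - 1) * (exp (h * x) - 1)\<bar> = \<bar>y\<bar> ^ j * h"
      using that h unfolding e by (cases j) (auto simp: abs_mult power_abs)
    also have "\<dots> \<le> 3 ^ j * h" using y2 h by (intro mult_right_mono power_mono) auto
    finally show ?thesis .
  qed
  moreover have "\<bar>y ^ (j - 1) - x ^ (j - 1)\<bar> \<le> 3 ^ j * h"
    by (rule order_trans[OF p]) (use h in \<open>auto intro!: mult_right_mono power_increasing\<close>)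
  ultimately have "\<bar>y ^ (j - 1) * (exp (h * x) - 1) + (y ^ (j - 1) - x ^ (j - 1))\<bar> \<le> 2 * 3 ^ j * h" if "j > 0"
    using that abs_triangle_ineq[of "y ^ (j - 1) * (exp (h * x) - 1)" "y ^ (j - 1) - x ^ (j - 1)"] by linarith
  then have "real j * \<bar>y ^ (j - 1) * (exp (h * x) - 1) + (y ^ (j - 1) - x ^ (j - 1))\<bar> \<le> real j * (2 * 3 ^ j * h)"
    by (cases "j = 0") (auto intro!: mult_left_mono)
  moreover have "real j * (y ^ (j - 1) * exp (h * x)) - real j * x ^ (j - 1)
    = real j * (y ^ (j - 1) * (exp (h * x) - 1) + (y ^ (j - 1) - x ^ (j - 1)))"
    by (simp add: algebra_simps)
  ultimately show "\<bar>real j * (y ^ (j - 1) * exp (h * x)) - real j * x ^ (j - 1)\<bar> \<le> 2 * real j * 3 ^ j * h"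
    by (simp add: abs_mult mult_ac)
qed

lemma poly_eq_sum_coeff:
  fixes P :: "real poly"
  assumes "degree P \<le> p"
  shows "poly P x = (\<Sum>j\<le>p. coeff P j * x ^ j)"
    and "poly (pderiv P) x = (\<Sum>j\<le>p. coeff P j * (real j * x ^ (j - 1)))"
proof -
  show eq: "poly P x = (\<Sum>j\<le>p. coeff P j * x ^ j)" for x
    unfolding poly_altdef using assms by (intro sum.mono_neutral_left) (auto simp: coeff_eq_0)
  have "((\<lambda>x. \<Sum>j\<le>p. coeff P j * x ^ j) has_field_derivative (\<Sum>j\<le>p. coeff P j * (real j * x ^ (j - 1)))) (at x)"
    by (intro DERIV_sum DERIV_cmult) (auto intro!: derivative_eq_intros)
  then show "poly (pderiv P) x = (\<Sum>j\<le>p. coeff P j * (real j * x ^ (j - 1)))"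
    using DERIV_unique[OF poly_DERIV[of P x]] by (simp flip: eq)
qed

text \<open>\<open>hid\<close> is fixed before P, \<alpha> and \<gamma>, and the error is relative
  to the size of these data. The exponentials are not normalized: the factor exp(-1/\<epsilon>) of
  the actual boundary layers goes into \<alpha> and \<gamma>.\<close>

definition universal_hidden :: "nat \<Rightarrow> nat \<Rightarrow> real \<Rightarrow> real \<Rightarrow> layer list \<Rightarrow> bool" where
  "universal_hidden k p \<epsilon> \<eta> hid \<longleftrightarrow> (\<forall>P \<alpha> \<gamma>. degree P \<le> p \<longrightarrow>
    (\<exists>\<Phi>. network_shape hid k (k + 3 * p + 10) \<Phi> \<and>
      C1_approximates \<Phi> (\<eta> * ((\<Sum>j\<le>p. \<bar>coeff P j\<bar>) + \<bar>\<alpha>\<bar> + \<bar>\<gamma>\<bar>))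
        (\<lambda>x. poly P x + \<alpha> * exp (- x / \<epsilon>) + \<gamma> * exp (x / \<epsilon>))
        (\<lambda>x. poly (pderiv P) x + \<alpha> * (- 1 / \<epsilon> * exp (- x / \<epsilon>)) + \<gamma> * (1 / \<epsilon> * exp (x / \<epsilon>)))))"

text \<open>Monomials are limits of the powers of \<open>(exp (h x) - 1) / h\<close> as \<open>h \<rightarrow> 0\<close>, hence of sums of the
  exponentials \<open>exp (i h x)\<close>.\<close>

lemma universal_hidden_exists:
  assumes \<eta>: "\<eta> > 0"
  shows "\<exists>hid. universal_hidden k p \<epsilon> \<eta> hid"
proof -
  \<comment> \<open>Half of \<eta> is spent on replacing monomials by exponentials; by
    \<open>exp_difference_quotient_power\<close> it is enough that 2 (p+1) 3^p h <= \<eta> /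
    2.\<close>
  define h where "h = min 1 (\<eta> / (4 * (real p + 1) * 3 ^ p))"
  have D: "4 * (real p + 1) * 3 ^ p > 0" by simp
  have h: "0 < h" "h \<le> 1" using \<eta> D by (auto simp: h_def)
  have "h * (4 * (real p + 1) * 3 ^ p) \<le> \<eta>"
    using D by (simp add: pos_le_divide_eq[symmetric] h_def)
  moreover have "2 * (real p + 1) * 3 ^ p * h = h * (4 * (real p + 1) * 3 ^ p) / 2" by (simp add: field_simps)
  ultimately have hb: "2 * (real p + 1) * 3 ^ p * h \<le> \<eta> / 2" by linarith
  have hb1: "3 ^ j * h \<le> \<eta> / 2" and hb2: "2 * real j * 3 ^ j * h \<le> \<eta> / 2" if "j \<le> p" for j
  proof -
    have "1 * 3 ^ j * h \<le> 2 * (real p + 1) * 3 ^ p * h"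
      using that h by (intro mult_mono power_increasing) auto
    with hb show "3 ^ j * h \<le> \<eta> / 2" by simp
    have "2 * real j * 3 ^ j * h \<le> 2 * (real p + 1) * 3 ^ p * h"
      using that h by (intro mult_mono power_increasing) auto
    with hb show "2 * real j * 3 ^ j * h \<le> \<eta> / 2" by simp
  qed
  \<comment> \<open>Coefficients of ((exp(h x) - 1) / h)^j as a sum of exponentials. They contain
    h^(-j), so the neurons get the finer precision \<eta> / (2 S), where S dominates every row
    sum.\<close>
  define M where "M j i = (if i \<le> j then real (j choose i) * (- 1) ^ (j - i) / h ^ j else 0)" for j i
  define S where "S = 1 + (\<Sum>j\<le>p. \<Sum>i\<le>p. \<bar>M j i\<bar>)"
  have S1: "S \<ge> 1" by (auto simp: S_def intro!: sum_nonneg)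
  have MS: "(\<Sum>i\<le>p. \<bar>M j i\<bar>) \<le> S" if "j \<le> p" for j
  proof -
    have "(\<Sum>i\<le>p. \<bar>M j i\<bar>) \<le> (\<Sum>j\<le>p. \<Sum>i\<le>p. \<bar>M j i\<bar>)"
      using that by (intro member_le_sum) (auto intro: sum_nonneg)
    then show ?thesis by (simp add: S_def)
  qed
  \<comment> \<open>The p + 1 grid exponents i h, followed by the two boundary layers: p + 3
    neurons.\<close>
  define l where "l i = (if i \<le> p then real i * h else if i = p + 1 then - 1 / \<epsilon> else 1 / \<epsilon>)" for i
  define y where "y x = (exp (h * x) - 1) / h" for x
  have binom: "y x ^ j = (\<Sum>i\<le>p. M j i * exp (l i * x))" if "j \<le> p" for j x
  proof -
    have "(exp (h * x) + (- 1)) ^ j = (\<Sum>i\<le>j. real (j choose i) * exp (h * x) ^ i * (- 1) ^ (j - i))"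
      by (rule binomial_ring)
    then have "y x ^ j = (\<Sum>i\<le>j. real (j choose i) * exp (h * x) ^ i * (- 1) ^ (j - i)) / h ^ j"
      by (simp add: y_def power_divide)
    also have "\<dots> = (\<Sum>i\<le>j. M j i * exp (l i * x))"
      unfolding sum_divide_distrib using that
      by (intro sum.cong) (auto simp: M_def l_def mult.assoc mult_ac simp flip: exp_of_nat_mult)
    also have "\<dots> = (\<Sum>i\<le>p. M j i * exp (l i * x))"
      using that by (intro sum.mono_neutral_left) (auto simp: M_def)
    finally show ?thesis .
  qed
  have binom': "(\<Sum>i\<le>p. M j i * (l i * exp (l i * x))) = real j * (y x ^ (j - 1) * exp (h * x))" if "j \<le> p" for j x
  proof -
    have "((\<lambda>x. y x ^ j) has_field_derivative real j * (y x ^ (j - 1) * exp (h * x))) (at x)"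
      unfolding y_def using h by (auto intro!: derivative_eq_intros)
    moreover have "((\<lambda>x. \<Sum>i\<le>p. M j i * exp (l i * x)) has_field_derivative (\<Sum>i\<le>p. M j i * (l i * exp (l i * x)))) (at x)"
      by (intro DERIV_sum DERIV_cmult) (auto intro!: derivative_eq_intros)
    ultimately show ?thesis
      unfolding binom[OF that] using DERIV_unique by blast
  qed
  have split: "(\<Sum>i<p + 3. g i) = (\<Sum>i\<le>p. g i) + g (p + 1) + g (p + 2)" for g :: "nat \<Rightarrow> real"
    by (simp add: eval_nat_numeral lessThan_Suc_atMost)
  define \<eta>1 where "\<eta>1 = \<eta> / (2 * S)"
  have \<eta>1: "\<eta>1 > 0" using \<eta> S1 by (simp add: \<eta>1_def)
  have m: "1 \<le> p + 3" by simp
  obtain hid where hid: "\<And>c. \<exists>\<Phi>. network_shape hid k (k + 3 * (p + 3) + 1) \<Phi> \<and>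
      C1_approximates \<Phi> (\<eta>1 * (\<Sum>i<p + 3. \<bar>c i\<bar>)) (\<lambda>x. \<Sum>i<p + 3. c i * exp (l i * x))
        (\<lambda>x. \<Sum>i<p + 3. c i * (l i * exp (l i * x)))"
    using tanh_network_exponential_sum[OF m \<eta>1, of k l] by blast
  show ?thesis
    unfolding universal_hidden_def
  proof (rule exI[of _ hid], intro allI impI)
    fix P :: "real poly" and \<alpha> \<gamma> :: real assume deg: "degree P \<le> p"
    define A where "A = (\<Sum>j\<le>p. \<bar>coeff P j\<bar>)"
    define c where "c i = (if i \<le> p then \<Sum>j\<le>p. coeff P j * M j i else if i = p + 1 then \<alpha> else \<gamma>)" for i
    have comb: "(\<Sum>i<p + 3. c i * g i) = (\<Sum>j\<le>p. coeff P j * (\<Sum>i\<le>p. M j i * g i)) + \<alpha> * g (p + 1) + \<gamma> * g (p + 2)" for g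
    proof -
      have "(\<Sum>i\<le>p. c i * g i) = (\<Sum>i\<le>p. \<Sum>j\<le>p. coeff P j * M j i * g i)"
        by (intro sum.cong) (auto simp: c_def sum_distrib_right)
      also have "\<dots> = (\<Sum>j\<le>p. coeff P j * (\<Sum>i\<le>p. M j i * g i))"
        unfolding sum_distrib_left by (subst sum.swap) (simp add: mult.assoc)
      finally show ?thesis unfolding split by (simp add: c_def)
    qed
    have "(\<Sum>i<p + 3. \<bar>c i\<bar>) \<le> (\<Sum>j\<le>p. \<bar>coeff P j\<bar> * S) + \<bar>\<alpha>\<bar> * S + \<bar>\<gamma>\<bar> * S"
    proof -
      have "(\<Sum>i\<le>p. \<bar>c i\<bar>) \<le> (\<Sum>i\<le>p. \<Sum>j\<le>p. \<bar>coeff P j\<bar> * \<bar>M j i\<bar>)"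
        by (intro sum_mono) (auto simp: c_def abs_mult intro!: order_trans[OF sum_abs])
      also have "\<dots> = (\<Sum>j\<le>p. \<bar>coeff P j\<bar> * (\<Sum>i\<le>p. \<bar>M j i\<bar>))"
        unfolding sum_distrib_left by (rule sum.swap)
      also have "\<dots> \<le> (\<Sum>j\<le>p. \<bar>coeff P j\<bar> * S)"
        by (intro sum_mono mult_left_mono MS) auto
      finally have "(\<Sum>i\<le>p. \<bar>c i\<bar>) \<le> (\<Sum>j\<le>p. \<bar>coeff P j\<bar> * S)" .
      moreover have "\<bar>\<alpha>\<bar> * 1 \<le> \<bar>\<alpha>\<bar> * S" "\<bar>\<gamma>\<bar> * 1 \<le> \<bar>\<gamma>\<bar> * S" by (rule mult_left_mono[OF S1 abs_ge_zero])+
      ultimately show ?thesis unfolding split by (simp add: c_def)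
    qed
    also have "\<dots> = (A + \<bar>\<alpha>\<bar> + \<bar>\<gamma>\<bar>) * S" by (simp add: A_def sum_distrib_right distrib_right)
    finally have "\<eta>1 * (\<Sum>i<p + 3. \<bar>c i\<bar>) \<le> \<eta>1 * ((A + \<bar>\<alpha>\<bar> + \<bar>\<gamma>\<bar>) * S)"
      using \<eta>1 by (intro mult_left_mono) auto
    also have "\<dots> = \<eta> / 2 * (A + \<bar>\<alpha>\<bar> + \<bar>\<gamma>\<bar>)" using S1 by (simp add: \<eta>1_def)
    finally have c1: "\<eta>1 * (\<Sum>i<p + 3. \<bar>c i\<bar>) \<le> \<eta> / 2 * (A + \<bar>\<alpha>\<bar> + \<bar>\<gamma>\<bar>)" .
    have cmp: "\<bar>(\<Sum>j\<le>p. coeff P j * a j) - (\<Sum>j\<le>p. coeff P j * b j)\<bar> \<le> \<eta> / 2 * A"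
      if "\<And>j. j \<le> p \<Longrightarrow> \<bar>a j - b j\<bar> \<le> \<eta> / 2" for a b
    proof -
      have "\<bar>\<Sum>j\<le>p. coeff P j * (a j - b j)\<bar> \<le> (\<Sum>j\<le>p. \<bar>coeff P j\<bar> * (\<eta> / 2))"
      proof (rule order_trans[OF sum_abs sum_mono])
        fix j assume "j \<in> {..p}"
        then show "\<bar>coeff P j * (a j - b j)\<bar> \<le> \<bar>coeff P j\<bar> * (\<eta> / 2)"
          unfolding abs_mult by (intro mult_left_mono that abs_ge_zero) simp
      qed
      also have "\<dots> = \<eta> / 2 * A" by (simp only: A_def sum_distrib_left mult.commute)
      finally show ?thesis by (simp add: right_diff_distrib sum_subtractf)
    qed
    have final: "\<bar>r - (u + a + b)\<bar> \<le> \<eta> * (A + \<bar>\<alpha>\<bar> + \<bar>\<gamma>\<bar>)"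
      if "\<bar>r - (v + a + b)\<bar> \<le> \<eta>1 * (\<Sum>i<p + 3. \<bar>c i\<bar>)" "\<bar>v - u\<bar> \<le> \<eta> / 2 * A" for r u v a b
    proof -
      have "\<bar>r - (u + a + b)\<bar> \<le> \<bar>r - (v + a + b)\<bar> + \<bar>v - u\<bar>"
        using abs_triangle_ineq[of "r - (v + a + b)" "v - u"] by simp
      also have "\<dots> \<le> \<eta> / 2 * (A + \<bar>\<alpha>\<bar> + \<bar>\<gamma>\<bar>) + \<eta> / 2 * A"
        by (intro add_mono order_trans[OF that(1) c1] that(2))
      also have "\<dots> \<le> \<eta> / 2 * (A + \<bar>\<alpha>\<bar> + \<bar>\<gamma>\<bar>) + \<eta> / 2 * (A + \<bar>\<alpha>\<bar> + \<bar>\<gamma>\<bar>)"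
        using \<eta> by (intro add_left_mono mult_left_mono) auto
      finally show ?thesis by simp
    qed
    obtain \<Phi> R' where \<Phi>: "network_shape hid k (k + 3 * (p + 3) + 1) \<Phi>" "continuous_on UNIV R'"
      "\<And>x. (tanh_realization \<Phi> has_field_derivative R' x) (at x)"
      and b: "\<And>x. \<bar>x\<bar> \<le> 1 \<Longrightarrow> \<bar>tanh_realization \<Phi> x - (\<Sum>i<p + 3. c i * exp (l i * x))\<bar> \<le> \<eta>1 * (\<Sum>i<p + 3. \<bar>c i\<bar>)"
        "\<And>x. \<bar>x\<bar> \<le> 1 \<Longrightarrow> \<bar>R' x - (\<Sum>i<p + 3. c i * (l i * exp (l i * x)))\<bar> \<le> \<eta>1 * (\<Sum>i<p + 3. \<bar>c i\<bar>)"
      using hid[of c] unfolding C1_approximates_def by blast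
    have "\<bar>tanh_realization \<Phi> x - (poly P x + \<alpha> * exp (- x / \<epsilon>) + \<gamma> * exp (x / \<epsilon>))\<bar> \<le> \<eta> * (A + \<bar>\<alpha>\<bar> + \<bar>\<gamma>\<bar>)" if x: "\<bar>x\<bar> \<le> 1" for x
    proof (rule final)
      show "\<bar>tanh_realization \<Phi> x - ((\<Sum>j\<le>p. coeff P j * y x ^ j) + \<alpha> * exp (- x / \<epsilon>) + \<gamma> * exp (x / \<epsilon>))\<bar>
          \<le> \<eta>1 * (\<Sum>i<p + 3. \<bar>c i\<bar>)"
        using b(1)[OF x] unfolding comb by (simp add: binom l_def)
      show "\<bar>(\<Sum>j\<le>p. coeff P j * y x ^ j) - poly P x\<bar> \<le> \<eta> / 2 * A"
        unfolding poly_eq_sum_coeff(1)[OF deg] y_def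
        by (intro cmp order_trans[OF exp_difference_quotient_power(1)[OF h x] hb1])
    qed
    moreover have "\<bar>R' x - (poly (pderiv P) x + \<alpha> * (- 1 / \<epsilon> * exp (- x / \<epsilon>)) + \<gamma> * (1 / \<epsilon> * exp (x / \<epsilon>)))\<bar>
        \<le> \<eta> * (A + \<bar>\<alpha>\<bar> + \<bar>\<gamma>\<bar>)" if x: "\<bar>x\<bar> \<le> 1" for x
    proof (rule final)
      have "(\<Sum>j\<le>p. coeff P j * (\<Sum>i\<le>p. M j i * (l i * exp (l i * x))))
          = (\<Sum>j\<le>p. coeff P j * (real j * (y x ^ (j - 1) * exp (h * x))))"
        by (rule sum.cong[OF refl], subst binom') auto
      moreover have "l (p + 1) * exp (l (p + 1) * x) = - 1 / \<epsilon> * exp (- x / \<epsilon>)"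
        "l (p + 2) * exp (l (p + 2) * x) = 1 / \<epsilon> * exp (x / \<epsilon>)"
        by (simp_all add: l_def)
      ultimately show "\<bar>R' x - ((\<Sum>j\<le>p. coeff P j * (real j * (y x ^ (j - 1) * exp (h * x))))
          + \<alpha> * (- 1 / \<epsilon> * exp (- x / \<epsilon>)) + \<gamma> * (1 / \<epsilon> * exp (x / \<epsilon>)))\<bar> \<le> \<eta>1 * (\<Sum>i<p + 3. \<bar>c i\<bar>)"
        using b(2)[OF x] unfolding comb by (simp only:)
      show "\<bar>(\<Sum>j\<le>p. coeff P j * (real j * (y x ^ (j - 1) * exp (h * x)))) - poly (pderiv P) x\<bar> \<le> \<eta> / 2 * A"
        unfolding poly_eq_sum_coeff(2)[OF deg] y_def
        by (intro cmp order_trans[OF exp_difference_quotient_power(2)[OF h x] hb2])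
    qed
    moreover have "network_shape hid k (k + 3 * p + 10) \<Phi>" using \<Phi>(1) by (simp add: network_shape_def)
    ultimately show "\<exists>\<Phi>. network_shape hid k (k + 3 * p + 10) \<Phi> \<and>
      C1_approximates \<Phi> (\<eta> * ((\<Sum>j\<le>p. \<bar>coeff P j\<bar>) + \<bar>\<alpha>\<bar> + \<bar>\<gamma>\<bar>))
        (\<lambda>x. poly P x + \<alpha> * exp (- x / \<epsilon>) + \<gamma> * exp (x / \<epsilon>))
        (\<lambda>x. poly (pderiv P) x + \<alpha> * (- 1 / \<epsilon> * exp (- x / \<epsilon>)) + \<gamma> * (1 / \<epsilon> * exp (x / \<epsilon>)))"
      unfolding A_def[symmetric] C1_approximates_def using \<Phi>(2,3)
      by (intro exI[of _ \<Phi>] exI[of _ R'] conjI allI impI)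
  qed
qed

section \<open>Decomposition of the solution\<close>

lemma exp_integral_bound:
  fixes h :: "real \<Rightarrow> real"
  assumes h: "continuous_on {a..b} h" and H: "\<And>t. t \<in> {a..b} \<Longrightarrow> \<bar>h t\<bar> \<le> H" and "a \<le> b" and c: "c \<noteq> 0"
  shows "\<bar>integral {a..b} (\<lambda>t. exp (c * t) * h t)\<bar> \<le> H * ((exp (c * b) - exp (c * a)) / c)"
proof -
  have i: "((\<lambda>t. exp (c * t) * H) has_integral (exp (c * b) / c * H - exp (c * a) / c * H)) {a..b}"
    using c \<open>a \<le> b\<close>
    by (intro fundamental_theorem_of_calculus)
      (auto simp flip: has_real_derivative_iff_has_vector_derivative intro!: derivative_eq_intros)
  have "norm (integral {a..b} (\<lambda>t. exp (c * t) * h t)) \<le> integral {a..b} (\<lambda>t. exp (c * t) * H)"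
  proof (rule integral_norm_bound_integral)
    show "(\<lambda>t. exp (c * t) * h t) integrable_on {a..b}"
      by (intro integrable_continuous_interval continuous_intros h)
    show "(\<lambda>t. exp (c * t) * H) integrable_on {a..b}" using i by blast
    show "norm (exp (c * t) * h t) \<le> exp (c * t) * H" if "t \<in> {a..b}" for t
      using H[OF that] by (simp add: abs_mult)
  qed
  also have "\<dots> = H * ((exp (c * b) - exp (c * a)) / c)"
    using integral_unique[OF i] by (simp add: algebra_simps diff_divide_distrib)
  finally show ?thesis by simp
qed

text \<open>Convolution with the Green function \<open>exp (- \<bar>x - t\<bar> / \<epsilon>) / (2 \<epsilon>)\<close> of the whole line.\<close>

lemma whole_line_solution:
  fixes h :: "real \<Rightarrow> real"
  assumes h: "continuous_on {-1..1} h" and H: "\<And>t. t \<in> {-1..1} \<Longrightarrow> \<bar>h t\<bar> \<le> H" and e: "\<epsilon> > 0"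
  obtains y y' where "continuous_on {-1..1} y" "continuous_on {-1..1} y'"
    "\<And>x. x \<in> J \<Longrightarrow> (y has_field_derivative y' x) (at x)"
    "\<And>x. x \<in> J \<Longrightarrow> (y' has_field_derivative (y x - h x) / \<epsilon>\<^sup>2) (at x)"
    "\<And>x. x \<in> {-1..1} \<Longrightarrow> \<bar>y x\<bar> \<le> H" "\<And>x. x \<in> {-1..1} \<Longrightarrow> \<bar>y' x\<bar> \<le> H / \<epsilon>"
proof -
  define k where "k = 1 / \<epsilon>"
  have k: "k > 0" using e by (simp add: k_def)
  \<comment> \<open>The two halves of the convolution, over [-1, x] and over [x, 1], with exp(- k x)
    and exp(k x) pulled out. The second one is written as the full integral minus the one over
    [-1, x], so that only an upper limit has to be differentiated.\<close>
  define a where "a x = integral {-1..x} (\<lambda>t. exp (k * t) * h t)" for x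
  define I where "I = integral {-1..1} (\<lambda>t. exp (- k * t) * h t)"
  define b where "b x = I - integral {-1..x} (\<lambda>t. exp (- k * t) * h t)" for x
  have hc: "continuous_on {-1..1} (\<lambda>t. exp (c * t) * h t)" for c by (intro continuous_intros h)
  have der: "((\<lambda>x. integral {-1..x} (\<lambda>t. exp (c * t) * h t)) has_field_derivative exp (c * x) * h x) (at x within {-1..1})"
    if "x \<in> {-1..1}" for c x
    by (rule integral_has_real_derivative[OF hc that])
  have within: "at x within {-1..1} = at x" if "x \<in> J" for x :: real
    using that by (intro at_within_interior) (simp add: interior_atLeastAtMost_real)
  have ad: "(a has_field_derivative exp (k * x) * h x) (at x)" if "x \<in> J" for x
    unfolding a_def[abs_def] using der[of x k] within[OF that] that by simp
  have bd: "(b has_field_derivative - (exp (- k * x) * h x)) (at x)" if "x \<in> J" for x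
  proof -
    have "((\<lambda>x. integral {-1..x} (\<lambda>t. exp (- k * t) * h t)) has_field_derivative exp (- k * x) * h x) (at x)"
      using der[of x "- k"] within[OF that] that by simp
    from DERIV_diff[OF DERIV_const[of I] this] show ?thesis unfolding b_def[abs_def] by simp
  qed
  have ci: "continuous_on {-1..1} (\<lambda>x. integral {-1..x} (\<lambda>t. exp (c * t) * h t))" for c
    by (intro indefinite_integral_continuous_1 integrable_continuous_interval hc)
  have ac: "continuous_on {-1..1} a" unfolding a_def[abs_def] by (rule ci)
  have bc: "continuous_on {-1..1} b" unfolding b_def[abs_def] by (intro continuous_intros ci)
  have H0: "H \<ge> 0" using H[of 0] by (force intro: order_trans[OF abs_ge_zero])
  have ab: "\<bar>exp (- k * x) * a x\<bar> \<le> H / k" if x: "x \<in> {-1..1}" for x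
  proof -
    have "\<bar>a x\<bar> \<le> H * ((exp (k * x) - exp (k * (-1))) / k)"
      unfolding a_def using x k H by (intro exp_integral_bound continuous_on_subset[OF h]) auto
    also have "\<dots> \<le> H * (exp (k * x) / k)"
      using H0 k by (intro mult_left_mono divide_right_mono) auto
    finally have "exp (- k * x) * \<bar>a x\<bar> \<le> exp (- k * x) * (H * (exp (k * x) / k))" by (rule mult_left_mono) simp
    also have "\<dots> = H / k" by (simp add: exp_minus field_simps)
    finally show ?thesis by (simp add: abs_mult)
  qed
  have bb: "\<bar>exp (k * x) * b x\<bar> \<le> H / k" if x: "x \<in> {-1..1}" for x
  proof -
    have "integral {-1..x} (\<lambda>t. exp (- k * t) * h t) + integral {x..1} (\<lambda>t. exp (- k * t) * h t) = I"
      unfolding I_def using x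
      by (intro Henstock_Kurzweil_Integration.integral_combine integrable_continuous_interval hc) auto
    then have "b x = integral {x..1} (\<lambda>t. exp (- k * t) * h t)" by (simp add: b_def)
    also have "\<bar>\<dots>\<bar> \<le> H * ((exp (- k * 1) - exp (- k * x)) / (- k))"
      using x k H by (intro exp_integral_bound continuous_on_subset[OF h]) auto
    also have "(exp (- k * 1) - exp (- k * x)) / (- k) = (exp (- k * x) - exp (- k * 1)) / k"
      using k by (simp add: field_simps)
    also have "H * \<dots> \<le> H * (exp (- k * x) / k)"
      using H0 k by (intro mult_left_mono divide_right_mono) auto
    finally have "exp (k * x) * \<bar>b x\<bar> \<le> exp (k * x) * (H * (exp (- k * x) / k))" by (intro mult_left_mono) auto
    also have "\<dots> = H / k" by (simp add: exp_minus field_simps)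
    finally show ?thesis by (simp add: abs_mult)
  qed
  define y where "y x = k / 2 * (exp (- k * x) * a x + exp (k * x) * b x)" for x
  define y' where "y' x = k\<^sup>2 / 2 * (exp (k * x) * b x - exp (- k * x) * a x)" for x
  have ea: "((\<lambda>x. exp (- k * x) * a x) has_field_derivative h x - k * (exp (- k * x) * a x)) (at x)" if "x \<in> J" for x
    using ad[OF that] by (auto intro!: derivative_eq_intros simp: exp_minus field_simps)
  have eb: "((\<lambda>x. exp (k * x) * b x) has_field_derivative k * (exp (k * x) * b x) - h x) (at x)" if "x \<in> J" for x
    using bd[OF that] by (auto intro!: derivative_eq_intros simp: exp_minus)
  show thesis
  proof (rule that[of y y'])
    show "continuous_on {-1..1} y" "continuous_on {-1..1} y'"
      unfolding y_def y'_def by (intro continuous_intros ac bc)+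
    fix x assume x: "x \<in> J"
    show "(y has_field_derivative y' x) (at x)"
      using DERIV_cmult[OF DERIV_add[OF ea[OF x] eb[OF x]], of "k / 2"]
      unfolding y_def[abs_def] y'_def by (simp add: algebra_simps power2_eq_square)
    have "(y' has_field_derivative k\<^sup>2 * (y x - h x)) (at x)"
      using DERIV_cmult[OF DERIV_diff[OF eb[OF x] ea[OF x]], of "k\<^sup>2 / 2"]
      unfolding y_def y'_def[abs_def] by (simp add: algebra_simps power2_eq_square)
    then show "(y' has_field_derivative (y x - h x) / \<epsilon>\<^sup>2) (at x)"
      by (simp add: k_def power_divide)
  next
    fix x :: real assume x: "x \<in> {-1..1}"
    have s: "\<bar>exp (- k * x) * a x + exp (k * x) * b x\<bar> \<le> 2 * (H / k)" "\<bar>exp (k * x) * b x - exp (- k * x) * a x\<bar> \<le> 2 * (H / k)"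
      using ab[OF x] bb[OF x] by (auto simp: abs_le_iff)
    have "\<bar>y x\<bar> \<le> k / 2 * (2 * (H / k))"
      unfolding y_def abs_mult using s k by (intro mult_mono) auto
    then show "\<bar>y x\<bar> \<le> H" using k by simp
    have "\<bar>y' x\<bar> \<le> k\<^sup>2 / 2 * (2 * (H / k))"
      unfolding y'_def abs_mult using s k by (intro mult_mono) auto
    then show "\<bar>y' x\<bar> \<le> H / \<epsilon>" using k by (simp add: power2_eq_square k_def)
  qed
qed

text \<open>Splitting off \<open>g = F 0 - Q\<close> before taking the Green potential (of \<open>\<epsilon>\<^sup>2 g''\<close> instead of \<open>g\<close>) keeps
  negative powers of \<open>\<epsilon>\<close> out of the derivative bound.\<close>

lemma reaction_diffusion_decomposition:
  fixes F :: "nat \<Rightarrow> real \<Rightarrow> real" and P Q :: "real poly"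
  assumes F: "\<And>n. continuous_on {-1..1} (F n)"
    and d: "\<And>n x. x \<in> J \<Longrightarrow> (F n has_field_derivative F (Suc n) x) (at x)"
    and PQ: "P - Polynomial.smult (\<epsilon>\<^sup>2) (pderiv (pderiv P)) = Q"
    and g0: "\<And>x. x \<in> {-1..1} \<Longrightarrow> \<bar>F 0 x - poly Q x\<bar> \<le> \<delta>"
    and g1: "\<And>x. x \<in> {-1..1} \<Longrightarrow> \<bar>F 1 x - poly (pderiv Q) x\<bar> \<le> \<delta>"
    and g2: "\<And>x. x \<in> {-1..1} \<Longrightarrow> \<bar>F 2 x - poly (pderiv (pderiv Q)) x\<bar> \<le> \<delta>"
    and e: "0 < \<epsilon>" "\<epsilon> \<le> 1"
  obtains U U' U'' \<alpha> \<gamma> where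
    "continuous_on {-1..1} U" "continuous_on {-1..1} U'" "continuous_on {-1..1} U''"
    "\<And>x. x \<in> J \<Longrightarrow> (U has_field_derivative U' x) (at x)"
    "\<And>x. x \<in> J \<Longrightarrow> (U' has_field_derivative U'' x) (at x)"
    "U (-1) = 0" "U 1 = 0" "\<And>x. x \<in> J \<Longrightarrow> U x - \<epsilon>\<^sup>2 * U'' x = F 0 x"
    "\<bar>\<alpha>\<bar> \<le> 2 * (\<bar>poly P (-1)\<bar> + \<bar>poly P 1\<bar> + 4 * \<delta>)" "\<bar>\<gamma>\<bar> \<le> 2 * (\<bar>poly P (-1)\<bar> + \<bar>poly P 1\<bar> + 4 * \<delta>)"
    "\<And>x. x \<in> {-1..1} \<Longrightarrow> \<bar>U x - (poly P x + \<alpha> * exp (- (1 + x) / \<epsilon>) + \<gamma> * exp (- (1 - x) / \<epsilon>))\<bar> \<le> 2 * \<delta>"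
    "\<And>x. x \<in> {-1..1} \<Longrightarrow> \<bar>U' x - (poly (pderiv P) x - \<alpha> / \<epsilon> * exp (- (1 + x) / \<epsilon>) + \<gamma> / \<epsilon> * exp (- (1 - x) / \<epsilon>))\<bar> \<le> 2 * \<delta>"
proof -
  have \<delta>0: "\<delta> \<ge> 0" using g0[of 0] by (force intro: order_trans[OF abs_ge_zero])
  define h where "h x = \<epsilon>\<^sup>2 * (F 2 x - poly (pderiv (pderiv Q)) x)" for x
  have h: "continuous_on {-1..1} h" unfolding h_def by (intro continuous_intros F)
  have H: "\<bar>h t\<bar> \<le> \<epsilon>\<^sup>2 * \<delta>" if "t \<in> {-1..1}" for t
    unfolding h_def abs_mult using g2[OF that] by (intro mult_mono) auto
  obtain y y' where yc: "continuous_on {-1..1} y" "continuous_on {-1..1} y'"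
    and yd: "\<And>x. x \<in> J \<Longrightarrow> (y has_field_derivative y' x) (at x)"
      "\<And>x. x \<in> J \<Longrightarrow> (y' has_field_derivative (y x - h x) / \<epsilon>\<^sup>2) (at x)"
    and yb: "\<And>x. x \<in> {-1..1} \<Longrightarrow> \<bar>y x\<bar> \<le> \<epsilon>\<^sup>2 * \<delta>" "\<And>x. x \<in> {-1..1} \<Longrightarrow> \<bar>y' x\<bar> \<le> \<epsilon>\<^sup>2 * \<delta> / \<epsilon>"
    using whole_line_solution[OF h H e(1)] by blast
  \<comment> \<open>The Green potential loses 1/\<epsilon> in the derivative; the factor
    \<epsilon>^2 of its source pays for that.\<close>
  have e2: "\<epsilon>\<^sup>2 * \<delta> \<le> \<delta>" "\<epsilon>\<^sup>2 * \<delta> / \<epsilon> \<le> \<delta>"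
  proof -
    show "\<epsilon>\<^sup>2 * \<delta> \<le> \<delta>" using e \<delta>0 by (intro mult_left_le_one_le) (auto simp: power_le_one)
    have "\<epsilon> * \<delta> \<le> \<delta>" using e \<delta>0 by (intro mult_left_le_one_le) auto
    then show "\<epsilon>\<^sup>2 * \<delta> / \<epsilon> \<le> \<delta>" using e by (simp add: power2_eq_square)
  qed
  have yb0: "\<bar>y x\<bar> \<le> \<delta>" and yb1: "\<bar>y' x\<bar> \<le> \<delta>" if "x \<in> {-1..1}" for x
    using yb[OF that] e2 by auto
  define E where "E x = exp (- (1 + x) / \<epsilon>)" for x
  define G where "G x = exp (- (1 - x) / \<epsilon>)" for x
  have Ed: "(E has_field_derivative - (1 / \<epsilon>) * E x) (at x)" and Gd: "(G has_field_derivative (1 / \<epsilon>) * G x) (at x)" for x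
    unfolding E_def G_def using e by (auto intro!: derivative_eq_intros)
  have EGc: "continuous_on A E" "continuous_on A G" for A
    unfolding E_def G_def using e by (auto intro!: continuous_intros)
  define s where "s x = poly P x + (F 0 x - poly Q x) + y x" for x
  \<comment> \<open>The value of each layer at the opposite endpoint. As \<epsilon> <= 1 it is at
    most 1/2, so the system for the boundary values has a determinant bounded away from 0 uniformly
    in \<epsilon>.\<close>
  define \<kappa> where "\<kappa> = exp (- 2 / \<epsilon>)"
  have \<kappa>: "0 < \<kappa>" "\<kappa> \<le> 1 / 2"
  proof -
    have "2 \<le> 2 / \<epsilon>" using e by (simp add: field_simps)
    then have "3 \<le> exp (2 / \<epsilon>)" using exp_ge_add_one_self[of "2 / \<epsilon>"] by linarith
    then show "0 < \<kappa>" "\<kappa> \<le> 1 / 2" by (auto simp: \<kappa>_def exp_minus field_simps)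
  qed
  then have \<kappa>2: "1 - \<kappa>\<^sup>2 \<ge> 1 / 2" using power_mono[of \<kappa> "1/2" 2] by (simp add: power_divide)
  \<comment> \<open>Cramer's rule for \<alpha> + \<kappa> \<gamma> = -s(-1) and \<kappa> \<alpha> +
    \<gamma> = -s(1).\<close>
  define \<alpha> where "\<alpha> = - (s (-1) - \<kappa> * s 1) / (1 - \<kappa>\<^sup>2)"
  define \<gamma> where "\<gamma> = - (s 1 - \<kappa> * s (-1)) / (1 - \<kappa>\<^sup>2)"
  have EG: "E (-1) = 1" "E 1 = \<kappa>" "G (-1) = \<kappa>" "G 1 = 1" by (auto simp: E_def G_def \<kappa>_def)
  have sb: "\<bar>s x\<bar> \<le> \<bar>poly P x\<bar> + 2 * \<delta>" if "x \<in> {-1..1}" for x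
  proof -
    have "\<bar>s x\<bar> \<le> \<bar>poly P x\<bar> + \<bar>F 0 x - poly Q x\<bar> + \<bar>y x\<bar>" unfolding s_def by (intro abs_triangle_ineq order_trans[OF abs_triangle_ineq] add_right_mono)
    also have "\<dots> \<le> \<bar>poly P x\<bar> + \<delta> + \<delta>" using g0[OF that] yb0[OF that] by (intro add_mono) auto
    finally show ?thesis by simp
  qed
  have coef: "\<bar>- (u - \<kappa> * v) / (1 - \<kappa>\<^sup>2)\<bar> \<le> 2 * (\<bar>u\<bar> + \<bar>v\<bar>)" for u v
  proof -
    have "\<bar>\<kappa> * v\<bar> \<le> 1 * \<bar>v\<bar>" unfolding abs_mult using \<kappa> by (intro mult_right_mono) auto
    then have "\<bar>- (u - \<kappa> * v)\<bar> \<le> \<bar>u\<bar> + \<bar>v\<bar>" using abs_triangle_ineq4[of u "\<kappa> * v"] by simp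
    then have "\<bar>- (u - \<kappa> * v)\<bar> / (1 - \<kappa>\<^sup>2) \<le> (\<bar>u\<bar> + \<bar>v\<bar>) / (1 / 2)"
      using \<kappa>2 by (intro frac_le) auto
    then show ?thesis using \<kappa>2 by (simp add: abs_divide)
  qed
  have s1: "\<bar>s (-1)\<bar> + \<bar>s 1\<bar> \<le> \<bar>poly P (-1)\<bar> + \<bar>poly P 1\<bar> + 4 * \<delta>" using sb[of "-1"] sb[of 1] by simp
  have \<alpha>b: "\<bar>\<alpha>\<bar> \<le> 2 * (\<bar>poly P (-1)\<bar> + \<bar>poly P 1\<bar> + 4 * \<delta>)"
    unfolding \<alpha>_def by (rule order_trans[OF coef mult_left_mono[OF s1]]) simp
  have \<gamma>b: "\<bar>\<gamma>\<bar> \<le> 2 * (\<bar>poly P (-1)\<bar> + \<bar>poly P 1\<bar> + 4 * \<delta>)"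
    unfolding \<gamma>_def by (rule order_trans[OF coef mult_left_mono]) (use s1 in \<open>simp_all add: add.commute\<close>)
  define U where "U x = poly P x + (F 0 x - poly Q x) + y x + \<alpha> * E x + \<gamma> * G x" for x
  define U' where "U' x = poly (pderiv P) x + (F 1 x - poly (pderiv Q) x) + y' x + \<alpha> * (- (1 / \<epsilon>) * E x) + \<gamma> * ((1 / \<epsilon>) * G x)" for x
  define U'' where "U'' x = poly (pderiv (pderiv P)) x + (F 2 x - poly (pderiv (pderiv Q)) x) + (y x - h x) / \<epsilon>\<^sup>2
     + \<alpha> * (- (1 / \<epsilon>) * (- (1 / \<epsilon>) * E x)) + \<gamma> * ((1 / \<epsilon>) * ((1 / \<epsilon>) * G x))" for x
  show thesis
  proof (rule that[of U U' U'' \<alpha> \<gamma>])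
    show "continuous_on {-1..1} U" "continuous_on {-1..1} U'" "continuous_on {-1..1} U''"
      unfolding U_def U'_def U''_def using e by (intro continuous_intros F yc EGc h; simp)+
    show "(U has_field_derivative U' x) (at x)" if "x \<in> J" for x
      unfolding U_def[abs_def] U'_def
      using d[OF that, of 0] by (intro DERIV_add DERIV_diff poly_DERIV DERIV_cmult Ed Gd yd that) simp
    show "(U' has_field_derivative U'' x) (at x)" if "x \<in> J" for x
      unfolding U'_def[abs_def] U''_def
      using d[OF that, of 1] by (intro DERIV_add DERIV_diff poly_DERIV DERIV_cmult Ed Gd yd that) (simp add: numeral_2_eq_2)
    have "1 - \<kappa>\<^sup>2 \<noteq> 0" using \<kappa>2 by simp
    then have "s (-1) + \<alpha> + \<gamma> * \<kappa> = 0" "s 1 + \<alpha> * \<kappa> + \<gamma> = 0"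
      by (simp_all add: \<alpha>_def \<gamma>_def divide_simps) (simp_all add: algebra_simps power2_eq_square)
    then show "U (-1) = 0" "U 1 = 0" unfolding U_def by (simp_all add: EG flip: s_def)
    show "U x - \<epsilon>\<^sup>2 * U'' x = F 0 x" for x
    proof -
      have "poly P x - \<epsilon>\<^sup>2 * poly (pderiv (pderiv P)) x = poly Q x" using arg_cong[OF PQ, of "\<lambda>p. poly p x"] by simp
      moreover have "\<epsilon>\<^sup>2 * U'' x = \<epsilon>\<^sup>2 * poly (pderiv (pderiv P)) x + h x + (y x - h x) + \<alpha> * E x + \<gamma> * G x"
        unfolding U''_def h_def using e by (simp add: field_simps power2_eq_square)
      ultimately show ?thesis unfolding U_def by simp
    qed
    show "\<bar>U x - (poly P x + \<alpha> * exp (- (1 + x) / \<epsilon>) + \<gamma> * exp (- (1 - x) / \<epsilon>))\<bar> \<le> 2 * \<delta>" if "x \<in> {-1..1}" for x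
    proof -
      have "U x - (poly P x + \<alpha> * exp (- (1 + x) / \<epsilon>) + \<gamma> * exp (- (1 - x) / \<epsilon>)) = (F 0 x - poly Q x) + y x"
        unfolding U_def E_def G_def by simp
      then show ?thesis using abs_triangle_ineq[of "F 0 x - poly Q x" "y x"] g0[OF that] yb0[OF that] by linarith
    qed
    show "\<bar>U' x - (poly (pderiv P) x - \<alpha> / \<epsilon> * exp (- (1 + x) / \<epsilon>) + \<gamma> / \<epsilon> * exp (- (1 - x) / \<epsilon>))\<bar> \<le> 2 * \<delta>" if "x \<in> {-1..1}" for x
    proof -
      have "U' x - (poly (pderiv P) x - \<alpha> / \<epsilon> * exp (- (1 + x) / \<epsilon>) + \<gamma> / \<epsilon> * exp (- (1 - x) / \<epsilon>)) = (F 1 x - poly (pderiv Q) x) + y' x"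
        unfolding U'_def E_def G_def by simp
      then show ?thesis using abs_triangle_ineq[of "F 1 x - poly (pderiv Q) x" "y' x"] g1[OF that] yb1[OF that] by linarith
    qed
  qed (rule \<alpha>b, rule \<gamma>b)
qed

section \<open>Error bounds\<close>

lemma Linf_norm_le:
  assumes "g \<in> borel_measurable (lebesgue_on J)" "AE x in lebesgue_on J. \<bar>g x\<bar> \<le> c"
  shows "Linf_norm J g \<le> ereal c"
  unfolding Linf_norm_def using assms by (intro esssup_I) auto

lemma L2_norm_le:
  assumes g: "square_integrable_on g J" and le: "(LINT x|lebesgue_on J. (g x)\<^sup>2) \<le> c\<^sup>2" and c: "0 \<le> c"
  shows "L2_norm J g \<le> ereal c"
  using g real_sqrt_le_mono[OF le] c by (simp add: L2_norm_def)

text \<open>An interval of length 2 contributes the factor sqrt 2, rounded up to 2.\<close>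

lemma L2_norm_le_of_bound:
  assumes g: "square_integrable_on g J" and b: "AE x in lebesgue_on J. \<bar>g x\<bar> \<le> c" and c: "0 \<le> c"
  shows "L2_norm J g \<le> ereal (2 * c)"
proof (rule L2_norm_le[OF g])
  have "(LINT x|lebesgue_on J. (g x)\<^sup>2) \<le> (LINT x|lebesgue_on J. c\<^sup>2)"
  proof (rule integral_mono_AE)
    show "integrable (lebesgue_on J) (\<lambda>x. (g x)\<^sup>2)" using g by (simp add: square_integrable_on_def)
    show "integrable (lebesgue_on J) (\<lambda>x. c\<^sup>2)" by (intro continuous_integrable_J continuous_intros)
    show "AE x in lebesgue_on J. (g x)\<^sup>2 \<le> c\<^sup>2"
      using b by eventually_elim (metis power2_abs power_mono abs_ge_zero)
  qed
  also have "\<dots> \<le> (2 * c)\<^sup>2" by (simp add: measure_J power_mult_distrib)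
  finally show "(LINT x|lebesgue_on J. (g x)\<^sup>2) \<le> (2 * c)\<^sup>2" .
qed (use c in simp)

text \<open>\<open>weak_deriv\<close> chooses representatives for u, R and u - R independently, so
  the derivative bounds are proved with the classical R' and carried over almost everywhere.\<close>

lemma sobolev_norms_le:
  assumes u: "u \<in> H10_on J" and U: "AE x in lebesgue_on J. u x = U x" "AE x in lebesgue_on J. weak_deriv J u x = U' x"
    and R: "\<And>x. (R has_field_derivative R' x) (at x)" "continuous_on UNIV R'"
    and b: "\<And>x. x \<in> J \<Longrightarrow> \<bar>U x - R x\<bar> \<le> c" "\<And>x. x \<in> J \<Longrightarrow> \<bar>U' x - R' x\<bar> \<le> c"
  shows "W1inf_norm J (\<lambda>x. u x - R x) \<le> ereal c" "Linf_norm J (\<lambda>x. u x - R x) \<le> ereal c"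
    "L2_norm J (\<lambda>x. u x - R x) \<le> ereal (2 * c)"
    "L2_norm J (\<lambda>x. weak_deriv J u x - weak_deriv J R x) \<le> ereal (2 * c)"
proof -
  note H = H10D[OF u]
  have c0: "0 \<le> c" using b(1)[of 0] by (force intro: order_trans[OF abs_ge_zero])
  have Rc: "continuous_on {-1..1} R" using R(1) by (meson DERIV_isCont continuous_at_imp_continuous_on)
  have R'c: "continuous_on {-1..1} R'" using R(2) by (rule continuous_on_subset) simp
  have wR: "has_weak_deriv_on R R' J" by (rule classical_has_weak_deriv[OF Rc R'c R(1)])
  have sR: "square_integrable_on (weak_deriv J R) J"
    by (rule classical_weak_deriv_square_integrable[OF wR R'c])
  have s0: "square_integrable_on (\<lambda>x. u x - R x) J"
    by (intro square_integrable_diff H continuous_square_integrable Rc)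
  have s1: "square_integrable_on (\<lambda>x. weak_deriv J u x - weak_deriv J R x) J"
    by (intro square_integrable_diff H sR)
  have J: "AE x in lebesgue_on J. x \<in> J" by (rule AE_I2) simp
  have b0: "AE x in lebesgue_on J. \<bar>u x - R x\<bar> \<le> c"
    using U(1) J by eventually_elim (use b in simp)
  have b1: "AE x in lebesgue_on J. \<bar>weak_deriv J u x - R' x\<bar> \<le> c"
    using U(2) J by eventually_elim (use b in simp)
  show L: "Linf_norm J (\<lambda>x. u x - R x) \<le> ereal c"
    using s0 b0 by (intro Linf_norm_le) (auto simp: square_integrable_on_def)
  show "L2_norm J (\<lambda>x. u x - R x) \<le> ereal (2 * c)" by (rule L2_norm_le_of_bound[OF s0 b0 c0])
  show "L2_norm J (\<lambda>x. weak_deriv J u x - weak_deriv J R x) \<le> ereal (2 * c)"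
  proof (rule L2_norm_le_of_bound[OF s1 _ c0])
    show "AE x in lebesgue_on J. \<bar>weak_deriv J u x - weak_deriv J R x\<bar> \<le> c"
      using b1 weak_deriv_AE(1)[OF wR] by eventually_elim simp
  qed
  have w: "has_weak_deriv_on (\<lambda>x. u x - R x) (\<lambda>x. weak_deriv J u x - R' x) J"
    by (rule has_weak_deriv_diff[OF H(3) wR])
  have "Linf_norm J (weak_deriv J (\<lambda>x. u x - R x)) \<le> ereal c"
  proof (rule Linf_norm_le)
    show "weak_deriv J (\<lambda>x. u x - R x) \<in> borel_measurable (lebesgue_on J)"
      using weak_deriv_AE(2)[OF w] by (intro locally_integrable_measurable) (simp add: has_weak_deriv_on_def)
    show "AE x in lebesgue_on J. \<bar>weak_deriv J (\<lambda>x. u x - R x) x\<bar> \<le> c"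
      using b1 weak_deriv_AE(1)[OF w] by eventually_elim simp
  qed
  then show "W1inf_norm J (\<lambda>x. u x - R x) \<le> ereal c"
    using L w by (auto simp: W1inf_norm_def)
qed

definition zero_network :: network where
  "zero_network = [(0\<^sub>m 1 1, 0\<^sub>v 1)]"

lemma zero_network:
  "is_network 1 1 zero_network" "tanh_realization zero_network = (\<lambda>x. 0)"
  "network_depth zero_network = 1" "network_size zero_network = 0" "hidden_layers zero_network = []"
proof -
  show "is_network 1 1 zero_network"
    unfolding is_network_def zero_network_def by (auto intro!: exI[of _ "\<lambda>_. 1"])
  show "tanh_realization zero_network = (\<lambda>x. 0)"
    by (auto simp: zero_network_def tanh_realization_def fun_eq_iff scalar_prod_def)
  have "nnz_vec (0\<^sub>v 1) = 0"
    unfolding zero_vec_def by (rule nnz_vec_zero)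
  moreover have "nnz_mat (0\<^sub>m 1 1) = 0"
    by (auto simp: nnz_mat_def card_eq_0_iff)
  ultimately show "network_size zero_network = 0" by (simp add: zero_network_def network_size_def)
qed (simp_all add: zero_network_def network_depth_def hidden_layers_def)

text \<open>A layer has a derivative of size 1/\<epsilon> on a strip of width \<epsilon>, so the
  integral of its square is of order 1/\<epsilon> and the factor \<epsilon> balances it. The
  constants come from (x + y + z)^2 <= 3 (x^2 + y^2 + z^2): the remainder c gives 6 c^2, and each
  layer gives half of 3 B^2.\<close>

lemma boundary_layer_L2:
  assumes e: "0 < \<epsilon>" "\<epsilon> \<le> 1" and U': "continuous_on {-1..1} U'" and AB: "\<bar>\<alpha>\<bar> \<le> B" "\<bar>\<gamma>\<bar> \<le> B"
    and b: "\<And>x. x \<in> {-1..1} \<Longrightarrow> \<bar>U' x - (- \<alpha> / \<epsilon> * exp (- (1 + x) / \<epsilon>) + \<gamma> / \<epsilon> * exp (- (1 - x) / \<epsilon>))\<bar> \<le> c"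
  shows "\<epsilon> * (LINT x|lebesgue_on J. (U' x)\<^sup>2) \<le> 6 * c\<^sup>2 + 3 * B\<^sup>2"
proof -
  define L where "L = B\<^sup>2 / \<epsilon>\<^sup>2"
  have L: "L \<ge> 0" "L * \<epsilon> = B\<^sup>2 / \<epsilon>" using e by (auto simp: L_def power2_eq_square)
  let ?f = "\<lambda>x. 3 * (c\<^sup>2 + L * exp (- 2 * (1 + x) / \<epsilon>) + L * exp (- 2 * (1 - x) / \<epsilon>))"
  let ?G = "\<lambda>x. 3 * (c\<^sup>2 * x + L * (- \<epsilon> / 2 * exp (- 2 * (1 + x) / \<epsilon>)) + L * (\<epsilon> / 2 * exp (- 2 * (1 - x) / \<epsilon>)))"
  have d: "(?G has_field_derivative ?f x) (at x within {-1..1})" for x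
    using e by (auto intro!: derivative_eq_intros)
  have "((?f) has_integral ?G 1 - ?G (-1)) {-1..1}"
  proof (rule fundamental_theorem_of_calculus)
    show "(?G has_vector_derivative ?f x) (at x within {-1..1})" for x
      using d[of x] by (simp only: has_real_derivative_iff_has_vector_derivative)
  qed simp
  moreover have fc: "continuous_on {-1..1} ?f" using e by (intro continuous_intros) auto
  ultimately have "(LINT x|lebesgue_on J. ?f x) = ?G 1 - ?G (-1)"
    by (simp only: continuous_integrable_J integral_unique)
  also have "\<dots> = 6 * c\<^sup>2 + 3 * (L * \<epsilon>) * (1 - exp (- 4 / \<epsilon>))"
    by (simp add: algebra_simps)
  also have "\<dots> \<le> 6 * c\<^sup>2 + 3 * (L * \<epsilon>) * 1"
    using L(1) e by (intro add_left_mono mult_left_mono) auto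
  also have "\<dots> = 6 * c\<^sup>2 + 3 * B\<^sup>2 / \<epsilon>" by (simp add: L)
  finally have I: "(LINT x|lebesgue_on J. ?f x) \<le> 6 * c\<^sup>2 + 3 * B\<^sup>2 / \<epsilon>" .
  have "(LINT x|lebesgue_on J. (U' x)\<^sup>2) \<le> (LINT x|lebesgue_on J. ?f x)"
  proof (rule Bochner_Integration.integral_mono)
    show "integrable (lebesgue_on J) (\<lambda>x. (U' x)\<^sup>2)" "integrable (lebesgue_on J) ?f"
      by (intro continuous_integrable_J continuous_intros U' fc)+
    fix x assume "x \<in> space (lebesgue_on J)"
    then have x: "x \<in> {-1..1}" by simp
    define r where "r = U' x - (- \<alpha> / \<epsilon> * exp (- (1 + x) / \<epsilon>) + \<gamma> / \<epsilon> * exp (- (1 - x) / \<epsilon>))"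
    have sq3: "(x + y + z)\<^sup>2 \<le> 3 * (x\<^sup>2 + y\<^sup>2 + z\<^sup>2)" for x y z :: real
      using sum_squares_bound[of x y] sum_squares_bound[of y z] sum_squares_bound[of x z]
      by (simp add: power2_eq_square algebra_simps)
    have "U' x = r + - \<alpha> / \<epsilon> * exp (- (1 + x) / \<epsilon>) + \<gamma> / \<epsilon> * exp (- (1 - x) / \<epsilon>)" by (simp add: r_def)
    then have "(U' x)\<^sup>2 \<le> 3 * (r\<^sup>2 + (- \<alpha> / \<epsilon> * exp (- (1 + x) / \<epsilon>))\<^sup>2 + (\<gamma> / \<epsilon> * exp (- (1 - x) / \<epsilon>))\<^sup>2)"
      using sq3 by metis
    also have "\<dots> \<le> ?f x"
    proof (intro mult_left_mono add_mono)
      show "r\<^sup>2 \<le> c\<^sup>2" using power_mono[OF b[OF x], of 2] by (simp add: r_def)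
      have ab: "\<alpha>\<^sup>2 \<le> B\<^sup>2" "\<gamma>\<^sup>2 \<le> B\<^sup>2" using power_mono[OF AB(1), of 2] power_mono[OF AB(2), of 2] by auto
      have ex: "(exp y)\<^sup>2 = exp (2 * y)" for y :: real by (simp add: exp_double)
      show "(- \<alpha> / \<epsilon> * exp (- (1 + x) / \<epsilon>))\<^sup>2 \<le> L * exp (- 2 * (1 + x) / \<epsilon>)"
        using ab(1) by (simp add: L_def power_mult_distrib power_divide ex divide_right_mono)
      show "(\<gamma> / \<epsilon> * exp (- (1 - x) / \<epsilon>))\<^sup>2 \<le> L * exp (- 2 * (1 - x) / \<epsilon>)"
        using ab(2) by (simp add: L_def power_mult_distrib power_divide ex divide_right_mono)
    qed simp
    finally show "(U' x)\<^sup>2 \<le> ?f x" .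
  qed
  with I have "(LINT x|lebesgue_on J. (U' x)\<^sup>2) \<le> 6 * c\<^sup>2 + 3 * B\<^sup>2 / \<epsilon>" by linarith
  then have "\<epsilon> * (LINT x|lebesgue_on J. (U' x)\<^sup>2) \<le> \<epsilon> * (6 * c\<^sup>2 + 3 * B\<^sup>2 / \<epsilon>)"
    using e by (intro mult_left_mono) auto
  also have "\<dots> = \<epsilon> * (6 * c\<^sup>2) + 3 * B\<^sup>2" using e by (simp add: distrib_left)
  also have "\<dots> \<le> 6 * c\<^sup>2 + 3 * B\<^sup>2" using e by (simp add: mult_left_le_one_le)
  finally show ?thesis .
qed

text \<open>The accuracy of the hidden layers depends on \<open>p\<close> and \<open>\<epsilon>\<close> only: the coefficients of the
  functions to be realized are bounded by a multiple of \<^const>\<open>basis_weight\<close>, whose factor depends on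
  \<open>f\<close> and goes into \<open>C\<close>.\<close>

definition chosen_hidden :: "nat \<Rightarrow> real \<Rightarrow> layer list" where
  "chosen_hidden p \<epsilon> = (if p \<le> 1 then []
    else SOME hid. universal_hidden (nat \<lceil>log 2 (real p)\<rceil> - 1) p \<epsilon> (exp (- real p) / (1 + basis_weight \<epsilon> p)) hid)"

section \<open>The approximations for p >= 2 and for p = 1\<close>

lemma abs_poly_endpoint_le:
  fixes P :: "real poly"
  assumes "degree P \<le> p" "\<bar>x\<bar> = 1"
  shows "\<bar>poly P x\<bar> \<le> (\<Sum>j\<le>p. \<bar>coeff P j\<bar>)"
  unfolding poly_eq_sum_coeff(1)[OF assms(1)]
  by (rule order_trans[OF sum_abs]) (simp add: abs_mult power_abs assms(2))

lemma network_approximates_solution: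
  fixes F :: "nat \<Rightarrow> real \<Rightarrow> real"
  assumes F: "\<And>n. continuous_on {-1..1} (F n)"
    and d: "\<And>n x. x \<in> J \<Longrightarrow> (F n has_field_derivative F (Suc n) x) (at x)"
    and aA: "\<And>i. \<bar>a i\<bar> \<le> A" and \<delta>D: "\<delta> \<le> D"
    and g0: "\<And>x. x \<in> {-1..1} \<Longrightarrow> \<bar>F 0 x - poly (approx_poly a p) x\<bar> \<le> \<delta>"
    and g1: "\<And>x. x \<in> {-1..1} \<Longrightarrow> \<bar>F 1 x - poly (pderiv (approx_poly a p)) x\<bar> \<le> \<delta>"
    and g2: "\<And>x. x \<in> {-1..1} \<Longrightarrow> \<bar>F 2 x - poly (pderiv (pderiv (approx_poly a p))) x\<bar> \<le> \<delta>"
    and e: "0 < \<epsilon>" "\<epsilon> \<le> 1" and p: "2 \<le> p"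
    and sol: "reaction_diffusion_solution J \<epsilon> b f u" and b: "\<And>x. x \<in> J \<Longrightarrow> b x = 1"
    and Ff: "\<And>x. x \<in> J \<Longrightarrow> F 0 x = f x"
  obtains \<Phi> where "is_network 1 1 \<Phi>" "hidden_layers \<Phi> = chosen_hidden p \<epsilon>"
    "int (network_depth \<Phi>) = \<lceil>log 2 (real p)\<rceil> + 1" "real (network_size \<Phi>) \<le> 14 * real p"
    "W1inf_norm J (\<lambda>x. u x - tanh_realization \<Phi> x) \<le> ereal (2 * \<delta> + exp (- real p) * (9 * A + 16 * D))"
    "Linf_norm J (\<lambda>x. u x - tanh_realization \<Phi> x) \<le> ereal (2 * \<delta> + exp (- real p) * (9 * A + 16 * D))"
    "L2_norm J (\<lambda>x. u x - tanh_realization \<Phi> x) \<le> ereal (2 * (2 * \<delta> + exp (- real p) * (9 * A + 16 * D)))"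
    "L2_norm J (\<lambda>x. weak_deriv J u x - weak_deriv J (tanh_realization \<Phi>) x)
      \<le> ereal (2 * (2 * \<delta> + exp (- real p) * (9 * A + 16 * D)))"
proof -
  define Q where "Q = approx_poly a p"
  define P where "P = particular_solution \<epsilon> p Q"
  define G where "G = basis_weight \<epsilon> p"
  define S where "S = (\<Sum>j\<le>p. \<bar>coeff P j\<bar>)"
  \<comment> \<open>k narrow layers, the wide layer and the output layer make k + 2, the prescribed
    depth; for p >= 2 the rounded logarithm is at least 1, so the subtraction is exact.\<close>
  define k where "k = nat \<lceil>log 2 (real p)\<rceil> - 1"
  define \<eta> where "\<eta> = exp (- real p) / (1 + G)"
  have G0: "G \<ge> 0" by (simp add: G_def basis_weight_nonneg)
  have A0: "A \<ge> 0" using aA[of 0] by (force intro: order_trans[OF abs_ge_zero])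
  have \<delta>0: "\<delta> \<ge> 0" using g0[of 0] by (force intro: order_trans[OF abs_ge_zero])
  have \<eta>0: "\<eta> > 0" using G0 by (simp add: \<eta>_def add_pos_nonneg)
  have degQ: "degree Q \<le> p"
    unfolding Q_def approx_poly_def
    by (rule degree_sum_le) (auto intro: order_trans[OF degree_smult_le] order_trans[OF degree_approx_basis])
  have degP: "degree P \<le> p" unfolding P_def by (rule degree_particular_solution[OF degQ])
  have S: "S \<le> A * G" unfolding S_def P_def Q_def G_def by (rule sum_coeff_particular_solution_le[OF aA])
  have ode: "P - Polynomial.smult (\<epsilon>\<^sup>2) (pderiv (pderiv P)) = Q"
    unfolding P_def by (rule particular_solution_ode[OF degQ])
  note gs = g0[folded Q_def] g1[folded Q_def] g2[folded Q_def]
  obtain U U' U'' \<alpha> \<gamma> where Uc: "continuous_on {-1..1} U" "continuous_on {-1..1} U'" "continuous_on {-1..1} U''"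
    and Ud: "\<And>x. x \<in> J \<Longrightarrow> (U has_field_derivative U' x) (at x)"
      "\<And>x. x \<in> J \<Longrightarrow> (U' has_field_derivative U'' x) (at x)"
    and bc: "U (-1) = 0" "U 1 = 0" and Uode: "\<And>x. x \<in> J \<Longrightarrow> U x - \<epsilon>\<^sup>2 * U'' x = F 0 x"
    and ab: "\<bar>\<alpha>\<bar> \<le> 2 * (\<bar>poly P (-1)\<bar> + \<bar>poly P 1\<bar> + 4 * \<delta>)" "\<bar>\<gamma>\<bar> \<le> 2 * (\<bar>poly P (-1)\<bar> + \<bar>poly P 1\<bar> + 4 * \<delta>)"
    and Ub: "\<And>x. x \<in> {-1..1} \<Longrightarrow> \<bar>U x - (poly P x + \<alpha> * exp (- (1 + x) / \<epsilon>) + \<gamma> * exp (- (1 - x) / \<epsilon>))\<bar> \<le> 2 * \<delta>"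
      "\<And>x. x \<in> {-1..1} \<Longrightarrow> \<bar>U' x - (poly (pderiv P) x - \<alpha> / \<epsilon> * exp (- (1 + x) / \<epsilon>) + \<gamma> / \<epsilon> * exp (- (1 - x) / \<epsilon>))\<bar> \<le> 2 * \<delta>"
    using reaction_diffusion_decomposition[OF F d ode gs e] by blast
  have ae: "AE x in lebesgue_on J. u x = U x" "AE x in lebesgue_on J. weak_deriv J u x = U' x"
    using reaction_diffusion_solution_unique[OF sol b e(1) Uc Ud bc] Uode Ff by auto
  \<comment> \<open>Moves the normalization of the boundary layers into the coefficients handed to
    \<open>universal_hidden\<close>; since c <= 1 it does not enlarge them.\<close>
  define c where "c = exp (- 1 / \<epsilon>)"
  have c: "0 < c" "c \<le> 1" using e by (auto simp: c_def)
  have "universal_hidden k p \<epsilon> \<eta> (chosen_hidden p \<epsilon>)"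
    using p someI_ex[OF universal_hidden_exists[OF \<eta>0]]
    by (simp add: chosen_hidden_def k_def \<eta>_def G_def)
  then obtain \<Phi> R' where shape: "network_shape (chosen_hidden p \<epsilon>) k (k + 3 * p + 10) \<Phi>"
    and R': "continuous_on UNIV R'" and R: "\<And>x. (tanh_realization \<Phi> has_field_derivative R' x) (at x)"
    and Rb: "\<And>x. \<bar>x\<bar> \<le> 1 \<Longrightarrow> \<bar>tanh_realization \<Phi> x - (poly P x + \<alpha> * c * exp (- x / \<epsilon>) + \<gamma> * c * exp (x / \<epsilon>))\<bar>
          \<le> \<eta> * (S + \<bar>\<alpha> * c\<bar> + \<bar>\<gamma> * c\<bar>)"
      "\<And>x. \<bar>x\<bar> \<le> 1 \<Longrightarrow> \<bar>R' x - (poly (pderiv P) x + \<alpha> * c * (- 1 / \<epsilon> * exp (- x / \<epsilon>)) + \<gamma> * c * (1 / \<epsilon> * exp (x / \<epsilon>)))\<bar>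
          \<le> \<eta> * (S + \<bar>\<alpha> * c\<bar> + \<bar>\<gamma> * c\<bar>)"
    unfolding universal_hidden_def C1_approximates_def S_def using degP by blast
  have net: "is_network 1 1 \<Phi>" "hidden_layers \<Phi> = chosen_hidden p \<epsilon>"
    and dep: "network_depth \<Phi> = k + 2" and size: "network_size \<Phi> \<le> k + 3 * p + 10"
    using shape by (auto simp: network_shape_def)
  have "\<bar>poly P (-1)\<bar> \<le> S" "\<bar>poly P 1\<bar> \<le> S"
    unfolding S_def by (rule abs_poly_endpoint_le[OF degP]; simp)+
  then have ab': "\<bar>\<alpha>\<bar> \<le> 4 * S + 8 * \<delta>" "\<bar>\<gamma>\<bar> \<le> 4 * S + 8 * \<delta>" using ab by auto
  have "\<bar>\<alpha> * c\<bar> \<le> \<bar>\<alpha>\<bar>" "\<bar>\<gamma> * c\<bar> \<le> \<bar>\<gamma>\<bar>" using c by (auto simp: abs_mult mult_left_le)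
  \<comment> \<open>Endpoint values of P are at most S, so the total is at most S + 2 (4 S + 8
    \<delta>) = 9 S + 16 \<delta>. The division of \<eta> by 1 + G then cancels the weight in S <= A
    G.\<close>
  then have "S + \<bar>\<alpha> * c\<bar> + \<bar>\<gamma> * c\<bar> \<le> S + (4 * S + 8 * \<delta>) + (4 * S + 8 * \<delta>)"
    using ab' by (intro add_mono order_refl) auto
  also have "\<dots> \<le> 9 * (A * G) + 16 * D" using S \<delta>D by simp
  also have "\<dots> \<le> (9 * A + 16 * D) * (1 + G)"
    using A0 G0 \<delta>0 \<delta>D by (simp add: algebra_simps)
  finally have "\<eta> * (S + \<bar>\<alpha> * c\<bar> + \<bar>\<gamma> * c\<bar>) \<le> \<eta> * ((9 * A + 16 * D) * (1 + G))"
    using \<eta>0 by (intro mult_left_mono) auto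
  also have "\<dots> = exp (- real p) * (9 * A + 16 * D)" using G0 by (simp add: \<eta>_def)
  finally have err: "\<eta> * (S + \<bar>\<alpha> * c\<bar> + \<bar>\<gamma> * c\<bar>) \<le> exp (- real p) * (9 * A + 16 * D)" .
  have E: "exp (- (1 + x) / \<epsilon>) = c * exp (- x / \<epsilon>)" "exp (- (1 - x) / \<epsilon>) = c * exp (x / \<epsilon>)" for x
    by (simp_all add: c_def diff_divide_distrib add_divide_distrib flip: exp_add)
  have tri: "\<bar>w - r\<bar> \<le> s + t" if "\<bar>w - v\<bar> \<le> s" "\<bar>r - v\<bar> \<le> t" for w r v s t :: real
    using that by linarith
  have b0: "\<bar>U x - tanh_realization \<Phi> x\<bar> \<le> 2 * \<delta> + exp (- real p) * (9 * A + 16 * D)" if "x \<in> J" for x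
  proof (rule tri)
    have x: "x \<in> {-1..1}" "\<bar>x\<bar> \<le> 1" using that by auto
    have "poly P x + \<alpha> * exp (- (1 + x) / \<epsilon>) + \<gamma> * exp (- (1 - x) / \<epsilon>)
        = poly P x + \<alpha> * c * exp (- x / \<epsilon>) + \<gamma> * c * exp (x / \<epsilon>)"
      unfolding E by simp
    with Ub(1)[OF x(1)] show "\<bar>U x - (poly P x + \<alpha> * c * exp (- x / \<epsilon>) + \<gamma> * c * exp (x / \<epsilon>))\<bar> \<le> 2 * \<delta>"
      by (simp only:)
    show "\<bar>tanh_realization \<Phi> x - (poly P x + \<alpha> * c * exp (- x / \<epsilon>) + \<gamma> * c * exp (x / \<epsilon>))\<bar>
      \<le> exp (- real p) * (9 * A + 16 * D)"
      by (rule order_trans[OF Rb(1)[OF x(2)] err])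
  qed
  have b1: "\<bar>U' x - R' x\<bar> \<le> 2 * \<delta> + exp (- real p) * (9 * A + 16 * D)" if "x \<in> J" for x
  proof (rule tri)
    let ?V = "poly (pderiv P) x + \<alpha> * c * (- 1 / \<epsilon> * exp (- x / \<epsilon>)) + \<gamma> * c * (1 / \<epsilon> * exp (x / \<epsilon>))"
    have x: "x \<in> {-1..1}" "\<bar>x\<bar> \<le> 1" using that by auto
    have "poly (pderiv P) x - \<alpha> / \<epsilon> * exp (- (1 + x) / \<epsilon>) + \<gamma> / \<epsilon> * exp (- (1 - x) / \<epsilon>) = ?V"
      unfolding E by simp
    with Ub(2)[OF x(1)] show "\<bar>U' x - ?V\<bar> \<le> 2 * \<delta>"
      by (simp only:)
    show "\<bar>R' x - ?V\<bar> \<le> exp (- real p) * (9 * A + 16 * D)"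
      by (rule order_trans[OF Rb(2)[OF x(2)] err])
  qed
  have u: "u \<in> H10_on J" using sol by (simp add: reaction_diffusion_solution_def)
  have lg: "1 \<le> log 2 (real p)" using p by (subst le_log_iff) auto
  then have lg1: "1 \<le> \<lceil>log 2 (real p)\<rceil>" by linarith
  then have k1: "int k = \<lceil>log 2 (real p)\<rceil> - 1" unfolding k_def by linarith
  have "log 2 (real p) \<le> real p"
    using p less_exp[of p] by (subst log_le_iff) (auto simp: powr_realpow of_nat_less_iff[symmetric] simp del: of_nat_less_iff)
  then have kp: "k \<le> p" using k1 by linarith
  show thesis
  proof (rule that[OF net])
    show "int (network_depth \<Phi>) = \<lceil>log 2 (real p)\<rceil> + 1" using k1 dep by simp
    \<comment> \<open>14 = 1 + 3 + 10, from k <= p and 1 <= p.\<close>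
    have "network_size \<Phi> \<le> 14 * p" using size kp p by linarith
    then show "real (network_size \<Phi>) \<le> 14 * real p" by (metis of_nat_le_iff of_nat_mult of_nat_numeral)
  qed (rule sobolev_norms_le[OF u ae R R' b0 b1]; assumption)+
qed

text \<open>For p = 1 boundedness is enough: the decomposition is applied with P = Q = 0 and with
  \<delta> the size B of f and its first two derivatives. The layer coefficients are then at most 8
  B, hence 18 = 2 + 8 + 8, and the energy constant 6 * 2^2 + 3 * 8^2 = 216 is below 18^2.\<close>

lemma zero_network_approximates_solution:
  fixes F :: "nat \<Rightarrow> real \<Rightarrow> real"
  assumes F: "\<And>n. continuous_on {-1..1} (F n)"
    and d: "\<And>n x. x \<in> J \<Longrightarrow> (F n has_field_derivative F (Suc n) x) (at x)"
    and bd: "\<And>n x. n \<le> 2 \<Longrightarrow> x \<in> {-1..1} \<Longrightarrow> \<bar>F n x\<bar> \<le> B"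
    and e: "0 < \<epsilon>" "\<epsilon> \<le> 1"
    and sol: "reaction_diffusion_solution J \<epsilon> b f u" and b: "\<And>x. x \<in> J \<Longrightarrow> b x = 1"
    and Ff: "\<And>x. x \<in> J \<Longrightarrow> F 0 x = f x"
  shows "Linf_norm J (\<lambda>x. u x - tanh_realization zero_network x) \<le> ereal (18 * B)"
    and "L2_norm J (\<lambda>x. u x - tanh_realization zero_network x) \<le> ereal (36 * B)"
    and "ereal (sqrt \<epsilon>) * L2_norm J (\<lambda>x. weak_deriv J u x - weak_deriv J (tanh_realization zero_network) x) \<le> ereal (18 * B)"
proof -
  have B0: "B \<ge> 0" using bd[of 0 0] by (force intro: order_trans[OF abs_ge_zero])
  have ode: "0 - Polynomial.smult (\<epsilon>\<^sup>2) (pderiv (pderiv 0)) = (0 :: real poly)" by simp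
  have gs: "\<bar>F 0 x - poly 0 x\<bar> \<le> B" "\<bar>F 1 x - poly (pderiv 0) x\<bar> \<le> B" "\<bar>F 2 x - poly (pderiv (pderiv 0)) x\<bar> \<le> B"
    if "x \<in> {-1..1}" for x
    using that by (simp_all add: bd)
  obtain U U' U'' \<alpha> \<gamma> where Uc: "continuous_on {-1..1} U" "continuous_on {-1..1} U'" "continuous_on {-1..1} U''"
    and Ud: "\<And>x. x \<in> J \<Longrightarrow> (U has_field_derivative U' x) (at x)"
      "\<And>x. x \<in> J \<Longrightarrow> (U' has_field_derivative U'' x) (at x)"
    and bc: "U (-1) = 0" "U 1 = 0" and Uode: "\<And>x. x \<in> J \<Longrightarrow> U x - \<epsilon>\<^sup>2 * U'' x = F 0 x"
    and ab: "\<bar>\<alpha>\<bar> \<le> 2 * (\<bar>poly 0 (-1)\<bar> + \<bar>poly 0 1\<bar> + 4 * B)" "\<bar>\<gamma>\<bar> \<le> 2 * (\<bar>poly 0 (-1)\<bar> + \<bar>poly 0 1\<bar> + 4 * B)"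
    and Ub: "\<And>x. x \<in> {-1..1} \<Longrightarrow> \<bar>U x - (poly 0 x + \<alpha> * exp (- (1 + x) / \<epsilon>) + \<gamma> * exp (- (1 - x) / \<epsilon>))\<bar> \<le> 2 * B"
      "\<And>x. x \<in> {-1..1} \<Longrightarrow> \<bar>U' x - (poly (pderiv 0) x - \<alpha> / \<epsilon> * exp (- (1 + x) / \<epsilon>) + \<gamma> / \<epsilon> * exp (- (1 - x) / \<epsilon>))\<bar> \<le> 2 * B"
    using reaction_diffusion_decomposition[OF F d ode gs e] by blast
  have ab': "\<bar>\<alpha>\<bar> \<le> 8 * B" "\<bar>\<gamma>\<bar> \<le> 8 * B" using ab by auto
  have ae: "AE x in lebesgue_on J. u x = U x" "AE x in lebesgue_on J. weak_deriv J u x = U' x"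
    using reaction_diffusion_solution_unique[OF sol b e(1) Uc Ud bc] Uode Ff by auto
  have u: "u \<in> H10_on J" using sol by (simp add: reaction_diffusion_solution_def)
  have UB: "\<bar>U x\<bar> \<le> 18 * B" if x: "x \<in> J" for x
  proof -
    have E: "exp (- (1 + x) / \<epsilon>) \<le> 1" "exp (- (1 - x) / \<epsilon>) \<le> 1"
      using x e by (auto simp: divide_le_0_iff)
    have "\<bar>\<alpha> * exp (- (1 + x) / \<epsilon>)\<bar> \<le> 8 * B * 1" "\<bar>\<gamma> * exp (- (1 - x) / \<epsilon>)\<bar> \<le> 8 * B * 1"
      unfolding abs_mult using ab' E B0 by (intro mult_mono; simp)+
    moreover have "\<bar>U x - (\<alpha> * exp (- (1 + x) / \<epsilon>) + \<gamma> * exp (- (1 - x) / \<epsilon>))\<bar> \<le> 2 * B" using Ub(1)[of x] x by simp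
    moreover have "\<bar>w\<bar> \<le> 18 * B" if "\<bar>r\<bar> \<le> 8 * B * 1" "\<bar>s\<bar> \<le> 8 * B * 1" "\<bar>w - (r + s)\<bar> \<le> 2 * B" for w r s
      using that by linarith
    ultimately show ?thesis by blast
  qed
  note H = H10D[OF u]
  have J: "AE x in lebesgue_on J. x \<in> J" by (rule AE_I2) simp
  have uB: "AE x in lebesgue_on J. \<bar>u x\<bar> \<le> 18 * B"
    using ae(1) J by eventually_elim (use UB in simp)
  show "Linf_norm J (\<lambda>x. u x - tanh_realization zero_network x) \<le> ereal (18 * B)"
    using uB H(1) by (intro Linf_norm_le) (auto simp: zero_network square_integrable_on_def)
  have "L2_norm J u \<le> ereal (2 * (18 * B))"
    using B0 by (intro L2_norm_le_of_bound[OF H(1) uB]) simp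
  then show "L2_norm J (\<lambda>x. u x - tanh_realization zero_network x) \<le> ereal (36 * B)"
    by (simp add: zero_network)
  have w0: "has_weak_deriv_on (\<lambda>x. 0) (\<lambda>x. 0) J"
    by (rule classical_has_weak_deriv) auto
  let ?g = "\<lambda>x. weak_deriv J u x - weak_deriv J (\<lambda>x. 0) x"
  have s: "square_integrable_on ?g J"
    by (intro square_integrable_diff H classical_weak_deriv_square_integrable[OF w0]) simp
  have "(LINT x|lebesgue_on J. (?g x)\<^sup>2) = (LINT x|lebesgue_on J. (U' x)\<^sup>2)"
  proof (rule square_integrable_cong_AE(2)[OF continuous_square_integrable[OF Uc(2)]])
    show "?g \<in> borel_measurable (lebesgue_on J)" using s by (simp add: square_integrable_on_def)
    show "AE x in lebesgue_on J. U' x = ?g x"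
      using ae(2) weak_deriv_AE(1)[OF w0] by eventually_elim simp
  qed
  moreover have "\<epsilon> * (LINT x|lebesgue_on J. (U' x)\<^sup>2) \<le> 6 * (2 * B)\<^sup>2 + 3 * (8 * B)\<^sup>2"
    using Ub(2) by (intro boundary_layer_L2[OF e Uc(2) ab']) simp
  ultimately have "\<epsilon> * (LINT x|lebesgue_on J. (?g x)\<^sup>2) \<le> 6 * (2 * B)\<^sup>2 + 3 * (8 * B)\<^sup>2"
    by (simp only:)
  also have "\<dots> \<le> (18 * B)\<^sup>2"
    by (simp add: power_mult_distrib)
  finally have "sqrt (\<epsilon> * (LINT x|lebesgue_on J. (?g x)\<^sup>2)) \<le> sqrt ((18 * B)\<^sup>2)" by (rule real_sqrt_le_mono)
  then have "sqrt \<epsilon> * sqrt (LINT x|lebesgue_on J. (?g x)\<^sup>2) \<le> 18 * B"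
    using B0 by (simp add: real_sqrt_mult)
  then show "ereal (sqrt \<epsilon>) * L2_norm J (\<lambda>x. weak_deriv J u x - weak_deriv J (tanh_realization zero_network) x) \<le> ereal (18 * B)"
    using s by (simp add: zero_network L2_norm_def)
qed

theorem theorem7p4:
  fixes I :: "real set"
  assumes "I = {-1<..<1}"
  shows "\<exists>Ct>0. \<exists>hidden :: nat \<Rightarrow> real \<Rightarrow> real \<Rightarrow> layer list.
    \<forall>(f :: real \<Rightarrow> real) (Cf :: real) (Kf :: real) (b :: real \<Rightarrow> real) (u :: real \<Rightarrow> real \<Rightarrow> real).
      real_analytic_on f {-1..1} \<and> Cf > 0 \<and> Kf > 0 \<and>
      (\<forall>n. Linf_norm I ((deriv ^^ n) f) \<le> ereal (Cf * Kf ^ n * fact n)) \<and>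
      (\<forall>x\<in>I. b x = 1) \<and>
      (\<forall>\<epsilon>. 0 < \<epsilon> \<and> \<epsilon> \<le> 1 \<longrightarrow> reaction_diffusion_solution I \<epsilon> b f (u \<epsilon>))
      \<longrightarrow>
      (\<exists>C>0. \<exists>\<beta>>0. \<forall>(p::nat) (\<epsilon>::real). 1 \<le> p \<and> 0 < \<epsilon> \<and> \<epsilon> \<le> 1 \<longrightarrow>
        (\<exists>\<Phi>. is_network 1 1 \<Phi> \<and>
           (2 \<le> p \<longrightarrow> W1inf_norm I (\<lambda>x. u \<epsilon> x - tanh_realization \<Phi> x)
              \<le> ereal (C * exp (- \<beta> * real p))) \<and>
           ereal (sqrt \<epsilon>) *
               L2_norm I (\<lambda>x. weak_deriv I (u \<epsilon>) x - weak_deriv I (tanh_realization \<Phi>) x)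
             + L2_norm I (\<lambda>x. u \<epsilon> x - tanh_realization \<Phi> x)
             \<le> ereal (C * exp (- \<beta> * real p)) \<and>
           Linf_norm I (\<lambda>x. u \<epsilon> x - tanh_realization \<Phi> x) \<le> ereal (C * exp (- \<beta> * real p)) \<and>
           int (network_depth \<Phi>) = \<lceil>log 2 (real p)\<rceil> + 1 \<and>
           real (network_size \<Phi>) \<le> Ct * real p \<and>
           hidden_layers \<Phi> = hidden p \<epsilon> \<beta>))"
proof (rule exI[of _ 14], rule conjI, simp, rule exI[of _ "\<lambda>p \<epsilon> \<beta>. chosen_hidden p \<epsilon>"], intro allI impI, elim conjE)
  \<comment> \<open>The chosen hidden layers ignore \<beta>: their precision exp(-p), divided by a
    weight, serves every rate up to 1.\<close>
  fix f b :: "real \<Rightarrow> real" and Cf Kf :: real and u :: "real \<Rightarrow> real \<Rightarrow> real"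
  assume an: "real_analytic_on f {-1..1}" and Cf: "Cf > 0" and Kf: "Kf > 0"
    and bound: "\<forall>n. Linf_norm I ((deriv ^^ n) f) \<le> ereal (Cf * Kf ^ n * fact n)"
    and b1: "\<forall>x\<in>I. b x = 1"
    and sol: "\<forall>\<epsilon>. 0 < \<epsilon> \<and> \<epsilon> \<le> 1 \<longrightarrow> reaction_diffusion_solution I \<epsilon> b f (u \<epsilon>)"
  have b: "b x = 1" if "x \<in> J" for x using b1 that assms by simp
  have lf: "Linf_norm J ((deriv ^^ n) f) \<le> ereal (Cf * Kf ^ n * fact n)" for n using bound assms by simp
  obtain F where F: "\<And>n. continuous_on {-1..1} (F n)"
    and d: "\<And>n x. x \<in> J \<Longrightarrow> (F n has_field_derivative F (Suc n) x) (at x)"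
    and M: "\<And>n x. x \<in> {-1..1} \<Longrightarrow> \<bar>F n x\<bar> \<le> Cf * Kf ^ n * fact n"
    and Ff: "\<And>x. x \<in> J \<Longrightarrow> F 0 x = f x"
    by (rule analytic_derivs_extension[OF an lf]) blast
  obtain A D r a where r: "0 < r" "r < 1" and A0: "0 \<le> A" and D0: "0 \<le> D" and aA: "\<And>i. \<bar>a i :: real\<bar> \<le> A"
    and apx: "\<And>p x. 2 \<le> p \<Longrightarrow> x \<in> {-1..1} \<Longrightarrow> \<bar>F 0 x - poly (approx_poly a p) x\<bar> \<le> D * r ^ p \<and>
      \<bar>F 1 x - poly (pderiv (approx_poly a p)) x\<bar> \<le> D * r ^ p \<and>
      \<bar>F 2 x - poly (pderiv (pderiv (approx_poly a p))) x\<bar> \<le> D * r ^ p"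
    by (rule poly_approx_W2inf[OF F d M Kf], assumption, assumption, rule that, assumption+)
  define B where "B = Cf + Cf * Kf + 2 * Cf * Kf\<^sup>2"
  have B0: "B > 0" using Cf Kf by (auto simp: B_def intro!: add_pos_nonneg)
  have FB: "\<bar>F n x\<bar> \<le> B" if n: "n \<le> 2" and x: "x \<in> {-1..1}" for n x
  proof -
    consider "n = 0" | "n = 1" | "n = 2" using n by linarith
    then have "Cf * Kf ^ n * fact n \<le> B" using Cf Kf by cases (auto simp: B_def fact_2)
    then show ?thesis using M[OF x, of n] by linarith
  qed
  \<comment> \<open>The smaller of the rate of the Chebyshev error r^p and the rate 1 of the network
    error exp(-p).\<close>
  define \<beta> where "\<beta> = min 1 (- ln r)"
  have \<beta>: "0 < \<beta>" "\<beta> \<le> 1" using r by (auto simp: \<beta>_def)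
  have rp: "r ^ p \<le> exp (- \<beta> * real p)" for p
  proof -
    have "r ^ p = exp (ln r * real p)" using r by (simp add: exp_of_nat2_mult)
    also have "\<dots> \<le> exp (- \<beta> * real p)"
    proof -
      have "ln r \<le> - \<beta>" by (simp add: \<beta>_def)
      then have "ln r * real p \<le> - \<beta> * real p" by (rule mult_right_mono) simp
      then show ?thesis by simp
    qed
    finally show ?thesis .
  qed
  \<comment> \<open>The first summand serves p >= 2: both terms of the energy norm are at most twice
    the C^1 error, hence the 4. The second serves p = 1: 54 = 18 + 36, and exp 1 makes up for
    exp(-\<beta>), as \<beta> <= 1.\<close>
  define C where "C = 4 * (9 * A + 18 * D) + 54 * B * exp 1"
  have C0: "C > 0" using A0 D0 B0 by (auto simp: C_def intro!: add_nonneg_pos)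
  show "\<exists>C>0. \<exists>\<beta>>0. \<forall>(p::nat) (\<epsilon>::real). 1 \<le> p \<and> 0 < \<epsilon> \<and> \<epsilon> \<le> 1 \<longrightarrow>
        (\<exists>\<Phi>. is_network 1 1 \<Phi> \<and>
           (2 \<le> p \<longrightarrow> W1inf_norm I (\<lambda>x. u \<epsilon> x - tanh_realization \<Phi> x)
              \<le> ereal (C * exp (- \<beta> * real p))) \<and>
           ereal (sqrt \<epsilon>) *
               L2_norm I (\<lambda>x. weak_deriv I (u \<epsilon>) x - weak_deriv I (tanh_realization \<Phi>) x)
             + L2_norm I (\<lambda>x. u \<epsilon> x - tanh_realization \<Phi> x)
             \<le> ereal (C * exp (- \<beta> * real p)) \<and>
           Linf_norm I (\<lambda>x. u \<epsilon> x - tanh_realization \<Phi> x) \<le> ereal (C * exp (- \<beta> * real p)) \<and>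
           int (network_depth \<Phi>) = \<lceil>log 2 (real p)\<rceil> + 1 \<and>
           real (network_size \<Phi>) \<le> 14 * real p \<and>
           hidden_layers \<Phi> = chosen_hidden p \<epsilon>)"
    unfolding assms
  proof (rule exI[of _ C], rule conjI[OF C0], rule exI[of _ \<beta>], rule conjI[OF \<beta>(1)], intro allI impI)
    fix p :: nat and \<epsilon> :: real assume "1 \<le> p \<and> 0 < \<epsilon> \<and> \<epsilon> \<le> 1"
    then have p1: "1 \<le> p" and e: "0 < \<epsilon>" "\<epsilon> \<le> 1" by auto
    have sole: "reaction_diffusion_solution J \<epsilon> b f (u \<epsilon>)" using sol e assms by simp
    let ?X = "C * exp (- \<beta> * real p)"
    show "\<exists>\<Phi>. is_network 1 1 \<Phi> \<and>
           (2 \<le> p \<longrightarrow> W1inf_norm J (\<lambda>x. u \<epsilon> x - tanh_realization \<Phi> x) \<le> ereal ?X) \<and>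
           ereal (sqrt \<epsilon>) * L2_norm J (\<lambda>x. weak_deriv J (u \<epsilon>) x - weak_deriv J (tanh_realization \<Phi>) x)
             + L2_norm J (\<lambda>x. u \<epsilon> x - tanh_realization \<Phi> x) \<le> ereal ?X \<and>
           Linf_norm J (\<lambda>x. u \<epsilon> x - tanh_realization \<Phi> x) \<le> ereal ?X \<and>
           int (network_depth \<Phi>) = \<lceil>log 2 (real p)\<rceil> + 1 \<and>
           real (network_size \<Phi>) \<le> 14 * real p \<and> hidden_layers \<Phi> = chosen_hidden p \<epsilon>"
    proof (cases "p = 1")
      case True
      note zn = zero_network_approximates_solution[OF F d FB e sole b Ff]
      have "exp (- 1) \<le> exp (- \<beta> * real p)" using \<beta> True by simp
      then have "54 * B * exp 1 * exp (- 1) \<le> ?X"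
        using A0 D0 B0 by (intro mult_mono) (auto simp: C_def)
      then have X: "54 * B \<le> ?X" by (simp add: mult.assoc flip: exp_add)
      show ?thesis
      proof (intro exI[of _ zero_network] conjI impI)
        have "ereal (sqrt \<epsilon>) * L2_norm J (\<lambda>x. weak_deriv J (u \<epsilon>) x - weak_deriv J (tanh_realization zero_network) x)
             + L2_norm J (\<lambda>x. u \<epsilon> x - tanh_realization zero_network x) \<le> ereal (18 * B) + ereal (36 * B)"
          by (intro add_mono zn)
        also have "\<dots> \<le> ereal ?X" using X by simp
        finally show "ereal (sqrt \<epsilon>) * L2_norm J (\<lambda>x. weak_deriv J (u \<epsilon>) x - weak_deriv J (tanh_realization zero_network) x)
             + L2_norm J (\<lambda>x. u \<epsilon> x - tanh_realization zero_network x) \<le> ereal ?X" .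
        show "Linf_norm J (\<lambda>x. u \<epsilon> x - tanh_realization zero_network x) \<le> ereal ?X"
        proof (rule order_trans[OF zn(1)])
          have "18 * B \<le> ?X" using X B0 by linarith
          then show "ereal (18 * B) \<le> ereal ?X" by simp
        qed
        show "is_network 1 1 zero_network" by (rule zero_network(1))
      qed (use True in \<open>simp_all add: zero_network chosen_hidden_def\<close>)
    next
      case False
      then have p: "2 \<le> p" using p1 by simp
      have "D * r ^ p \<le> D * 1" using D0 r by (intro mult_left_mono power_le_one) auto
      then have dD: "D * r ^ p \<le> D" by simp
      have ap: "\<bar>F 0 x - poly (approx_poly a p) x\<bar> \<le> D * r ^ p" "\<bar>F 1 x - poly (pderiv (approx_poly a p)) x\<bar> \<le> D * r ^ p"
        "\<bar>F 2 x - poly (pderiv (pderiv (approx_poly a p))) x\<bar> \<le> D * r ^ p" if "x \<in> {-1..1}" for x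
        using apx[OF p that] by blast+
      let ?Y = "2 * (D * r ^ p) + exp (- real p) * (9 * A + 16 * D)"
      have Y0: "0 \<le> ?Y" using D0 A0 r by (intro add_nonneg_nonneg mult_nonneg_nonneg) auto
      have "exp (- real p) \<le> exp (- \<beta> * real p)" using \<beta> by (simp add: mult_left_le_one_le)
      then have "?Y \<le> 2 * (D * exp (- \<beta> * real p)) + exp (- \<beta> * real p) * (9 * A + 16 * D)"
        using A0 D0 rp[of p] by (intro add_mono mult_left_mono mult_right_mono) auto
      also have "\<dots> = (9 * A + 18 * D) * exp (- \<beta> * real p)" by (simp add: algebra_simps)
      finally have "4 * ?Y \<le> 4 * ((9 * A + 18 * D) * exp (- \<beta> * real p))" by (rule mult_left_mono) simp
      also have "\<dots> = (4 * (9 * A + 18 * D)) * exp (- \<beta> * real p)" by (simp only: mult.assoc)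
      also have "\<dots> \<le> ?X" using B0 by (intro mult_right_mono) (auto simp: C_def)
      finally have Y: "4 * ?Y \<le> ?X" .
      have "v \<le> w" if "4 * v \<le> w" "0 \<le> v" for v w :: real using that by linarith
      from this[OF Y Y0] have YX: "?Y \<le> ?X" .
      show ?thesis
      proof (rule network_approximates_solution[OF F d aA dD ap e p sole b Ff], assumption+)
        fix \<Phi>
        assume net: "is_network 1 1 \<Phi>" "hidden_layers \<Phi> = chosen_hidden p \<epsilon>"
          "int (network_depth \<Phi>) = \<lceil>log 2 (real p)\<rceil> + 1" "real (network_size \<Phi>) \<le> 14 * real p"
        and W: "W1inf_norm J (\<lambda>x. u \<epsilon> x - tanh_realization \<Phi> x) \<le> ereal ?Y"
          "Linf_norm J (\<lambda>x. u \<epsilon> x - tanh_realization \<Phi> x) \<le> ereal ?Y"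
        and L: "L2_norm J (\<lambda>x. u \<epsilon> x - tanh_realization \<Phi> x) \<le> ereal (2 * ?Y)"
          "L2_norm J (\<lambda>x. weak_deriv J (u \<epsilon>) x - weak_deriv J (tanh_realization \<Phi>) x) \<le> ereal (2 * ?Y)"
        show ?thesis
        proof (intro exI[of _ \<Phi>] conjI impI net)
          show "W1inf_norm J (\<lambda>x. u \<epsilon> x - tanh_realization \<Phi> x) \<le> ereal ?X"
            "Linf_norm J (\<lambda>x. u \<epsilon> x - tanh_realization \<Phi> x) \<le> ereal ?X"
            using W YX by (auto intro: order_trans)
          have "ereal (sqrt \<epsilon>) * L2_norm J (\<lambda>x. weak_deriv J (u \<epsilon>) x - weak_deriv J (tanh_realization \<Phi>) x)
               + L2_norm J (\<lambda>x. u \<epsilon> x - tanh_realization \<Phi> x) \<le> ereal 1 * ereal (2 * ?Y) + ereal (2 * ?Y)"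
          proof (intro add_mono L)
            have "ereal (sqrt \<epsilon>) * L2_norm J (\<lambda>x. weak_deriv J (u \<epsilon>) x - weak_deriv J (tanh_realization \<Phi>) x)
              \<le> ereal (sqrt \<epsilon>) * ereal (2 * ?Y)"
              using e by (intro ereal_mult_left_mono L) simp
            also have "\<dots> \<le> ereal 1 * ereal (2 * ?Y)"
              using e Y0 by (intro ereal_mult_right_mono) auto
            finally show "ereal (sqrt \<epsilon>) * L2_norm J (\<lambda>x. weak_deriv J (u \<epsilon>) x - weak_deriv J (tanh_realization \<Phi>) x)
              \<le> ereal 1 * ereal (2 * ?Y)" .
          qed
          also have "\<dots> = ereal (4 * ?Y)" by simp
          also have "\<dots> \<le> ereal ?X" using Y by simp
          finally show "ereal (sqrt \<epsilon>) * L2_norm J (\<lambda>x. weak_deriv J (u \<epsilon>) x - weak_deriv J (tanh_realization \<Phi>) x)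
               + L2_norm J (\<lambda>x. u \<epsilon> x - tanh_realization \<Phi> x) \<le> ereal ?X" .
        qed
      qed
    qed
  qed
qed

end
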